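(* Let $d\in\mathbb{N}$. There exists a constant $c_d>0$, depending only on $d$, with the following property. Let $L_0$ be a subfield of $\overline{\mathbb{Q}}$ and let $(K_i)_{i\in\mathbb{N}}$ be a sequence of number fields (subfields of $\overline{\mathbb{Q}}$) of degrees $d_i=[K_i:\mathbb{Q}]>1$. Suppose that the family $L_0,K_1,K_2,K_3,\ldots$ is linearly disjoint over $\mathbb{Q}$, and that all degrees $d_i$ are prime and satisfy $d_i\le d$. Let $R=\bigcup_n R_n$ with $R_n=\mathcal{O}_{L_0}\prod_{i=1}^n\mathcal{O}_{K_i}$. Then for every $\alpha\in R$ $$H(\alpha)\ \geq\ c_d\,\bigl(\log[L_0(\alpha):L_0]\bigr)^{\frac{1}{d^3}}.$$
   Context: $\overline{\mathbb{Q}}$ is a fixed algebraic closure of $\mathbb{Q}$. For a field $K\subseteq\overline{\mathbb{Q}}$ (possibly of infinite degree over $\mathbb{Q}$), $\mathcal{O}_K$ is its ring of algebraic integers. For subrings $S_i$ of $\overline{\mathbb{Q}}$, the product $\prod_i S_i$ denotes the composite ring, i.e. the smallest subring of $\overline{\mathbb{Q}}$ containing all $S_i$; thus $R_n$ is the subring generated by $\mathcal{O}_{L_0},\mathcal{O}_{K_1},\ldots,\mathcal{O}_{K_n}$. A family $L_0,K_1,K_2,\ldots$ is linearly disjoint over $\mathbb{Q}$ if every finite subfamily is linearly disjoint over $\mathbb{Q}$ (the natural map from the tensor product over $\mathbb{Q}$ to $\overline{\mathbb{Q}}$ is injective). With $L_n=L_0K_1\cdots K_n$ (compositum), this is equivalent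 to $[L_n:L_{n-1}]=[K_n:\mathbb{Q}]$ for every $n\in\mathbb{N}=\{1,2,\ldots\}$. $H$ is the absolute multiplicative Weil height: for $\alpha$ in a number field $K$, $H(\alpha)=\prod_v\max\{1,|\alpha|_v\}^{d_v/[K:\mathbb{Q}]}$, the product over all places $v$ of $K$, where $|\cdot|_v$ extends the usual archimedean or $p$-adic absolute value on $\mathbb{Q}$ and $d_v=[K_v:\mathbb{Q}_v]$; this is independent of the choice of $K\ni\alpha$. *)

theory Defs
  imports
    Complex_Main
    "HOL-Algebra.Algebra"
    "HOL-Algebra.Algebraic_Closure_Type"
    "HOL-Library.FuncSet"
    "HOL-Library.Poly_Mapping"
begin

section \<open>Subfields of the algebraic closure of the rationals\<close>

text \<open>The fixed algebraic closure of the rationals is the field of algebraic complex numbers. All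
  rings and fields are subsets of it; the operations on them are those of the ring of complex
  numbers, whose subring and subfield generated by a set of algebraic numbers again consist of
  algebraic numbers.\<close>

abbreviation CC :: "complex ring" where
  "CC \<equiv> ring_of_type_algebra"

definition Qbar :: "complex set" where
  "Qbar = {x. algebraic x}"

definition subfield_Qbar :: "complex set \<Rightarrow> bool" where
  "subfield_Qbar K \<longleftrightarrow> subfield K CC \<and> K \<subseteq> Qbar"

definition number_field :: "complex set \<Rightarrow> bool" where
  "number_field K \<longleftrightarrow> subfield_Qbar K \<and> ring.finite_dimension CC \<rat> K"

text \<open>The degree \<open>[E : F]\<close>, meaningful only if \<open>E\<close> has finite dimension over \<open>F\<close>.\<close>

definition ext_degree :: "complex set \<Rightarrow> complex set \<Rightarrow> nat" where
  "ext_degree F E = ring.dim CC F E"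

definition adjoin :: "complex set \<Rightarrow> complex \<Rightarrow> complex set" where
  "adjoin F \<alpha> = generate_field CC (insert \<alpha> F)"

definition ring_of_integers :: "complex set \<Rightarrow> complex set" where
  "ring_of_integers K = {x \<in> K. algebraic_int x}"


section \<open>Linear disjointness\<close>

text \<open>The tensor product over the rationals of the spaces \<open>F i\<close>, for \<open>i\<close> in a finite set \<open>I\<close>, is
  the rational vector space with basis the product of the sets \<open>F i\<close>, modulo the subspace spanned
  by the relations of multilinearity. In the rules below the coefficient \<open>q\<close> is arbitrary, so that
  the closure under addition is a rational subspace.\<close>

definition tensor_free :: "'i set \<Rightarrow> ('i \<Rightarrow> complex set) \<Rightarrow> (('i \<Rightarrow> complex) \<Rightarrow>\<^sub>0 rat) set" where
  "tensor_free I F = {c. Poly_Mapping.keys c \<subseteq> PiE I F}"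

inductive_set tensor_relations :: "'i set \<Rightarrow> ('i \<Rightarrow> complex set) \<Rightarrow> (('i \<Rightarrow> complex) \<Rightarrow>\<^sub>0 rat) set"
  for I :: "'i set" and F :: "'i \<Rightarrow> complex set" where
  zero: "0 \<in> tensor_relations I F"
| plus: "c \<in> tensor_relations I F \<Longrightarrow> c' \<in> tensor_relations I F \<Longrightarrow> c + c' \<in> tensor_relations I F"
| additive: "x \<in> PiE I F \<Longrightarrow> i \<in> I \<Longrightarrow> a \<in> F i \<Longrightarrow> b \<in> F i \<Longrightarrow>
    Poly_Mapping.single (x(i := a + b)) q
      - Poly_Mapping.single (x(i := a)) q - Poly_Mapping.single (x(i := b)) q
    \<in> tensor_relations I F"
| homogeneous: "x \<in> PiE I F \<Longrightarrow> i \<in> I \<Longrightarrow> a \<in> F i \<Longrightarrow>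
    Poly_Mapping.single (x(i := of_rat r * a)) q - Poly_Mapping.single (x(i := a)) (q * r)
    \<in> tensor_relations I F"

definition tensor_product ::
    "'i set \<Rightarrow> ('i \<Rightarrow> complex set) \<Rightarrow> (('i \<Rightarrow> complex) \<Rightarrow>\<^sub>0 rat) set set" where
  "tensor_product I F = tensor_free I F //
     {(c, c'). c \<in> tensor_free I F \<and> c' \<in> tensor_free I F \<and> c - c' \<in> tensor_relations I F}"

definition formal_product_sum :: "'i set \<Rightarrow> (('i \<Rightarrow> complex) \<Rightarrow>\<^sub>0 rat) \<Rightarrow> complex" where
  "formal_product_sum I c =
     (\<Sum>x\<in>Poly_Mapping.keys c. of_rat (Poly_Mapping.lookup c x) * (\<Prod>i\<in>I. x i))"

text \<open>The natural map sends the class of the tensor of \<open>x\<close> to the product of the \<open>x i\<close>; the sum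
  above is constant on each class.\<close>

definition tensor_natural_map :: "'i set \<Rightarrow> (('i \<Rightarrow> complex) \<Rightarrow>\<^sub>0 rat) set \<Rightarrow> complex" where
  "tensor_natural_map I C = the_elem (formal_product_sum I ` C)"

definition linearly_disjoint_family :: "('i \<Rightarrow> complex set) \<Rightarrow> bool" where
  "linearly_disjoint_family F \<longleftrightarrow>
     (\<forall>I. finite I \<longrightarrow> inj_on (tensor_natural_map I) (tensor_product I F))"


section \<open>Places\<close>

definition padic_abs :: "nat \<Rightarrow> rat \<Rightarrow> real" where
  "padic_abs p q = (if q = 0 then 0 else
     real p powi (int (multiplicity (int p) (snd (quotient_of q)))
                - int (multiplicity (int p) (fst (quotient_of q)))))"

definition absolute_value_on :: "complex set \<Rightarrow> (complex \<Rightarrow> real) \<Rightarrow> bool" where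
  "absolute_value_on K v \<longleftrightarrow>
     (\<forall>x\<in>K. 0 \<le> v x) \<and>
     (\<forall>x\<in>K. v x = 0 \<longleftrightarrow> x = 0) \<and>
     (\<forall>x\<in>K. \<forall>y\<in>K. v (x * y) = v x * v y) \<and>
     (\<forall>x\<in>K. \<forall>y\<in>K. v (x + y) \<le> v x + v y)"

text \<open>A place is represented by the unique absolute value in its equivalence class that extends the
  usual archimedean or a \<open>p\<close>-adic absolute value of the rationals. Extensionality makes this
  representative unique as a function on all complex numbers.\<close>

definition places :: "complex set \<Rightarrow> (complex \<Rightarrow> real) set" where
  "places K = {v \<in> extensional K. absolute_value_on K v \<and>
     ((\<forall>q::rat. v (of_rat q) = \<bar>of_rat q\<bar>) \<or>
      (\<exists>p::nat. Factorial_Ring.prime p \<and> (\<forall>q::rat. v (of_rat q) = padic_abs p q)))}"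

text \<open>The completion of \<open>K\<close> at \<open>v\<close>: Cauchy sequences modulo null sequences.\<close>

definition cauchy_ring :: "complex set \<Rightarrow> (complex \<Rightarrow> real) \<Rightarrow> (nat \<Rightarrow> complex) ring" where
  "cauchy_ring K v =
     \<lparr>carrier = {s. (\<forall>n. s n \<in> K) \<and> (\<forall>e>0. \<exists>N. \<forall>m\<ge>N. \<forall>n\<ge>N. v (s m - s n) < e)},
      monoid.mult = (\<lambda>s t n. s n * t n), one = (\<lambda>_. 1), ring.zero = (\<lambda>_. 0), add = (\<lambda>s t n. s n + t n)\<rparr>"

definition null_sequences :: "complex set \<Rightarrow> (complex \<Rightarrow> real) \<Rightarrow> (nat \<Rightarrow> complex) set" where
  "null_sequences K v = {s. (\<forall>n. s n \<in> K) \<and> (\<lambda>n. v (s n)) \<longlonglongrightarrow> 0}"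

definition completion :: "complex set \<Rightarrow> (complex \<Rightarrow> real) \<Rightarrow> (nat \<Rightarrow> complex) set ring" where
  "completion K v = cauchy_ring K v Quot null_sequences K v"

text \<open>The completion of the rationals at the place below \<open>v\<close>, embedded in the completion of \<open>K\<close>:
  the classes of the Cauchy sequences of rational numbers.\<close>

definition rational_completion ::
    "complex set \<Rightarrow> (complex \<Rightarrow> real) \<Rightarrow> (nat \<Rightarrow> complex) set set" where
  "rational_completion K v =
     (\<lambda>s. null_sequences K v +>\<^bsub>cauchy_ring K v\<^esub> s) ` carrier (cauchy_ring \<rat> v)"

definition local_degree :: "complex set \<Rightarrow> (complex \<Rightarrow> real) \<Rightarrow> nat" where
  "local_degree K v =
     ring.dim (completion K v) (rational_completion K v) (carrier (completion K v))"


section \<open>The absolute multiplicative Weil height\<close>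

text \<open>All but finitely many places satisfy \<open>v \<alpha> \<le> 1\<close> and contribute the factor 1. They are left
  out because a product over an infinite index set is 1 by convention.\<close>

definition height_in :: "complex set \<Rightarrow> complex \<Rightarrow> real" where
  "height_in K \<alpha> =
     (\<Prod>v\<in>{v \<in> places K. v \<alpha> > 1}.
        max 1 (v \<alpha>) powr (real (local_degree K v) / real (ext_degree \<rat> K)))"

text \<open>The value does not depend on the number field containing \<open>\<alpha>\<close>; the smallest one is used.\<close>

definition weil_height :: "complex \<Rightarrow> real" where
  "weil_height \<alpha> = height_in (adjoin \<rat> \<alpha>) \<alpha>"


section \<open>Composites of rings of integers\<close>

definition integers_composite :: "complex set \<Rightarrow> (nat \<Rightarrow> complex set) \<Rightarrow> nat \<Rightarrow> complex set" where
  "integers_composite L\<^sub>0 K n =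
     generate_ring CC (ring_of_integers L\<^sub>0 \<union> (\<Union>i\<in>{1..n}. ring_of_integers (K i)))"

end

theory Submission
  imports Defs "Jordan_Normal_Form.Char_Poly"
begin

text \<open>
  The theorem compares the degree and the height of \<open>\<alpha>\<close> through the number of fields \<open>K i\<close> that
  are really needed to write \<open>\<alpha>\<close>. Choose an integral basis of each \<open>K i\<close> that starts with 1. Then
  \<open>\<alpha>\<close> is a combination of products of basis elements, one from each \<open>K i\<close>, with coefficients that are
  integers of \<open>L\<close> (\<open>integral_composite_products_span\<close>), and by linear disjointness these products
  are independent over \<open>L\<close> (\<open>basis_products_independent\<close>). Call \<open>i\<close> involved if some term of \<open>\<alpha>\<close>
  contains a basis element of \<open>K i\<close> other than 1. The conjugates of \<open>\<alpha>\<close> over \<open>L\<close> are determined by the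
  embeddings of the involved fields, so the degree of \<open>\<alpha>\<close> over \<open>L\<close> is at most \<open>d\<close> to the number of
  involved indices (\<open>degree_le_involved\<close>). It remains to bound this number by a constant times the
  power \<open>d ^ 3\<close> of the height.

  Let \<open>i\<close> be involved, and collect the terms of \<open>\<alpha>\<close> by the basis elements of \<open>K i\<close>. The coefficients are
  algebraic integers in a field \<open>E\<close> over which the basis of \<open>K i\<close> is still independent, and the last
  nonzero one belongs to a basis element other than 1. Its norm is at least 1. A linear functional on
  the conjugates over \<open>E\<close> recovers this coefficient from \<open>\<alpha>\<close>, so if the functional is small then the
  height of \<open>\<alpha>\<close> must be large (\<open>height_lower_bound_functional\<close>). For a Korkin--Zolotarev reduced
  basis (\<open>reduced_basis_exists\<close>) the size of the functional is governed by the minimum of the integers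
  of \<open>K i\<close> projected orthogonally to the rationals. Hence this minimum is bounded by a constant times a
  power of the height with exponent at most \<open>d\<close>, and the second basis element, shifted by a
  rational integer, is an irrational integer \<open>x i\<close> of \<open>K i\<close> whose conjugates are bounded in the same
  way.

  By independence the \<open>x i\<close> are distinct (\<open>second_basis_elements_distinct\<close>). The number of algebraic
  integers of degree at most \<open>n\<close> with conjugates bounded by \<open>B\<close> is at most a constant times
  \<open>B ^ (n * (n + 1) div 2)\<close> (\<open>bounded_integers_count\<close>). With \<open>B\<close> of the order of the height to the power
  \<open>n\<close> and \<open>n \<le> d\<close>, this is at most a constant times the height to the power \<open>d ^ 3\<close>.

  The height enters only through its expression by complex embeddings
  (\<open>prod_embeddings_weil_height\<close>). For an algebraic integer only archimedean places contribute, and an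
  archimedean absolute value on a number field comes from an embedding
  (\<open>archimedean_place_is_embedding\<close>), whose local degree is one or two
  (\<open>local_degree_embedding\<close>).
\<close>

hide_const (open) Coset.order

section \<open>The ring of algebraic integers\<close>

definition int_span :: "'i set \<Rightarrow> ('i \<Rightarrow> complex) \<Rightarrow> complex set" where
  "int_span I v = {\<Sum>i\<in>I. of_int (c i) * v i | c. True}"

lemma int_spanI: "x = (\<Sum>i\<in>I. of_int (c i) * v i) \<Longrightarrow> x \<in> int_span I v"
  unfolding int_span_def by auto

lemma int_span_0: "0 \<in> int_span I v"
  unfolding int_span_def by (auto intro!: exI[of _ "\<lambda>_. 0"])

lemma int_span_add: "x \<in> int_span I v \<Longrightarrow> y \<in> int_span I v \<Longrightarrow> x + y \<in> int_span I v"
proof -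
  assume "x \<in> int_span I v" "y \<in> int_span I v"
  then obtain c c' where "x = (\<Sum>i\<in>I. of_int (c i) * v i)" "y = (\<Sum>i\<in>I. of_int (c' i) * v i)"
    unfolding int_span_def by blast
  then have "x + y = (\<Sum>i\<in>I. of_int (c i + c' i) * v i)"
    by (simp add: algebra_simps sum.distrib)
  then show ?thesis by (rule int_spanI)
qed

lemma int_span_scale: "x \<in> int_span I v \<Longrightarrow> of_int k * x \<in> int_span I v"
proof -
  assume "x \<in> int_span I v"
  then obtain c where "x = (\<Sum>i\<in>I. of_int (c i) * v i)"
    unfolding int_span_def by blast
  then have "of_int k * x = (\<Sum>i\<in>I. of_int (k * c i) * v i)"
    by (simp add: algebra_simps sum_distrib_left)
  then show ?thesis by (rule int_spanI)
qed

lemma int_span_sum: "(\<And>a. a \<in> A \<Longrightarrow> f a \<in> int_span I v) \<Longrightarrow> sum f A \<in> int_span I v"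
  by (induction A rule: infinite_finite_induct) (auto intro: int_span_0 int_span_add)

lemma int_span_base: "finite I \<Longrightarrow> i \<in> I \<Longrightarrow> v i \<in> int_span I v"
  unfolding int_span_def
  by (auto intro!: exI[of _ "\<lambda>j. if j = i then 1 else 0"] simp: if_distrib[of of_int] if_distrib[of "\<lambda>x. x * _"] sum.delta cong: if_cong)

lemma int_span_mult_closed:
  assumes "\<And>i. i \<in> I \<Longrightarrow> x * v i \<in> int_span I v" "y \<in> int_span I v"
  shows "x * y \<in> int_span I v"
proof -
  obtain c where "y = (\<Sum>i\<in>I. of_int (c i) * v i)"
    using assms(2) unfolding int_span_def by blast
  then have "x * y = (\<Sum>i\<in>I. of_int (c i) * (x * v i))"
    by (simp add: algebra_simps sum_distrib_left)
  then show ?thesis using assms(1) by (auto intro!: int_span_sum int_span_scale)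
qed

text \<open>The determinant trick: multiplication by \<open>x\<close> on a finitely generated group of numbers is an
  integral matrix, and \<open>x\<close> is a root of its characteristic polynomial.\<close>

lemma algebraic_int_if_int_span_stable:
  assumes fin: "finite I" and ne: "i\<^sub>0 \<in> I" "v i\<^sub>0 \<noteq> 0"
    and st: "\<And>i. i \<in> I \<Longrightarrow> x * v i \<in> int_span I v"
  shows "algebraic_int x"
proof -
  let ?n = "card I"
  obtain h where h: "bij_betw h {0..<?n} I" using ex_bij_betw_nat_finite[OF fin] by blast
  have hI: "h i \<in> I" if "i < ?n" for i using h that by (auto simp: bij_betw_def)
  have "\<forall>i\<in>I. \<exists>c. x * v i = (\<Sum>j\<in>I. of_int (c j) * v j)"
    using st unfolding int_span_def by blast
  then obtain C where C: "\<And>i. i \<in> I \<Longrightarrow> x * v i = (\<Sum>j\<in>I. of_int (C i j) * v j)"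
    by metis
  define A :: "int mat" where "A = mat ?n ?n (\<lambda>(i, j). C (h i) (h j))"
  define B :: "complex mat" where "B = map_mat of_int A"
  define w where "w = vec ?n (\<lambda>i. v (h i))"
  have A: "A \<in> carrier_mat ?n ?n" and B: "B \<in> carrier_mat ?n ?n" by (auto simp: A_def B_def)
  have w: "w \<in> carrier_vec ?n" by (auto simp: w_def)
  obtain k where k: "k < ?n" "h k = i\<^sub>0" using h ne(1) by (force simp: bij_betw_def)
  have "w $ k \<noteq> 0" using k ne(2) by (simp add: w_def)
  then have w0: "w \<noteq> 0\<^sub>v ?n" using k(1) by auto
  have "B *\<^sub>v w = x \<cdot>\<^sub>v w"
  proof (rule eq_vecI)
    fix i assume "i < dim_vec (x \<cdot>\<^sub>v w)"
    then have i: "i < ?n" by (simp add: w_def)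
    have "(B *\<^sub>v w) $ i = (\<Sum>j\<in>{0..<?n}. of_int (C (h i) (h j)) * v (h j))"
      using i by (simp add: B_def A_def w_def scalar_prod_def)
    also have "\<dots> = (\<Sum>j\<in>I. of_int (C (h i) j) * v j)"
      by (rule sum.reindex_bij_betw[OF h, of "\<lambda>j. of_int (C (h i) j) * v j"])
    also have "\<dots> = x * v (h i)" using C[OF hI[OF i]] by simp
    finally show "(B *\<^sub>v w) $ i = (x \<cdot>\<^sub>v w) $ i" using i by (simp add: w_def)
  qed (simp add: B_def A_def w_def)
  then have "eigenvalue B x" unfolding eigenvalue_def eigenvector_def using w w0 B by auto
  then have root: "poly (char_poly B) x = 0" using eigenvalue_root_char_poly[OF B] by simp
  interpret of_int_hom: comm_ring_hom "of_int :: int \<Rightarrow> complex" by unfold_locales auto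
  have "char_poly B = map_poly of_int (char_poly A)"
    unfolding B_def by (rule of_int_hom.char_poly_hom[OF A])
  moreover have "lead_coeff (char_poly A) = 1" using degree_monic_char_poly[OF A] by simp
  ultimately show ?thesis using root unfolding algebraic_int_altdef_ipoly by auto
qed

text \<open>The powers below the degree of a monic integral equation span a group stable under
  multiplication by the root.\<close>

lemma algebraic_int_powers_stable:
  assumes "algebraic_int (x :: complex)"
  obtains m where "m > 0" "\<And>i. i < m \<Longrightarrow> x * x ^ i \<in> int_span {..<m} (\<lambda>i. x ^ i)"
proof -
  obtain p :: "int poly" where p: "poly (map_poly of_int p) x = 0" "lead_coeff p = 1"
    using assms unfolding algebraic_int_altdef_ipoly by blast
  define m where "m = Polynomial.degree p"
  have "m > 0"
  proof (rule ccontr)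
    assume "\<not> m > 0"
    then have "Polynomial.degree p = 0" by (simp add: m_def)
    then obtain c where "p = [:c:]" by (metis degree_eq_zeroE)
    with p show False by simp
  qed
  have st: "x * x ^ i \<in> int_span {..<m} (\<lambda>i. x ^ i)" if "i < m" for i
  proof (cases "Suc i < m")
    case True
    then show ?thesis using int_span_base[of "{..<m}" "Suc i" "\<lambda>i. x ^ i"] by simp
  next
    case False
    then have i: "Suc i = m" using that by simp
    have "0 = (\<Sum>j\<le>m. of_int (Polynomial.coeff p j) * x ^ j)"
      using p(1) by (simp add: poly_altdef m_def degree_map_poly coeff_map_poly)
    also have "\<dots> = (\<Sum>j<m. of_int (Polynomial.coeff p j) * x ^ j) + x ^ m"
      using p(2) by (simp add: m_def flip: lessThan_Suc_atMost)
    finally have "x * x ^ i = (\<Sum>j<m. of_int (- Polynomial.coeff p j) * x ^ j)"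
      using i by (simp add: sum_negf eq_neg_iff_add_eq_0 add.commute flip: power_Suc)
    then show ?thesis by (rule int_spanI)
  qed
  show thesis by (rule that[OF \<open>m > 0\<close> st])
qed

text \<open>The products of powers of \<open>x\<close> and \<open>y\<close> below the degrees of their integral equations span a group
  stable under multiplication by \<open>x\<close> and by \<open>y\<close>, hence by their sum and product.\<close>

lemma algebraic_int_plus_times:
  assumes x: "algebraic_int (x :: complex)" and y: "algebraic_int y"
  shows algebraic_int_plus: "algebraic_int (x + y)" and algebraic_int_times: "algebraic_int (x * y)"
proof -
  obtain m where m: "m > 0" "\<And>i. i < m \<Longrightarrow> x * x ^ i \<in> int_span {..<m} (\<lambda>i. x ^ i)"
    using algebraic_int_powers_stable[OF x] by blast
  obtain n where n: "n > 0" "\<And>i. i < n \<Longrightarrow> y * y ^ i \<in> int_span {..<n} (\<lambda>i. y ^ i)"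
    using algebraic_int_powers_stable[OF y] by blast
  let ?I = "{..<m} \<times> {..<n}"
  define v where "v = (\<lambda>(i, j). x ^ i * y ^ j)"
  have fin: "finite ?I" by simp
  have sx: "x * v k \<in> int_span ?I v" if k: "k \<in> ?I" for k
  proof -
    obtain i j where ij: "k = (i, j)" "i < m" "j < n" using k by auto
    obtain c where c: "x * x ^ i = (\<Sum>l<m. of_int (c l) * x ^ l)"
      using m(2)[OF ij(2)] unfolding int_span_def by blast
    have "x * v k = (x * x ^ i) * y ^ j" by (simp add: ij v_def)
    also have "\<dots> = (\<Sum>l<m. of_int (c l) * v (l, j))"
      unfolding c by (simp add: v_def sum_distrib_right mult.assoc)
    also have "\<dots> \<in> int_span ?I v"
      using ij by (intro int_span_sum int_span_scale int_span_base) auto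
    finally show ?thesis .
  qed
  have sy: "y * v k \<in> int_span ?I v" if k: "k \<in> ?I" for k
  proof -
    obtain i j where ij: "k = (i, j)" "i < m" "j < n" using k by auto
    obtain c where c: "y * y ^ j = (\<Sum>l<n. of_int (c l) * y ^ l)"
      using n(2)[OF ij(3)] unfolding int_span_def by blast
    have "y * v k = x ^ i * (y * y ^ j)" by (simp add: ij v_def)
    also have "\<dots> = (\<Sum>l<n. of_int (c l) * v (i, l))"
      unfolding c by (simp add: v_def sum_distrib_left mult_ac)
    also have "\<dots> \<in> int_span ?I v"
      using ij by (intro int_span_sum int_span_scale int_span_base) auto
    finally show ?thesis .
  qed
  have z: "(0, 0) \<in> ?I" "v (0, 0) \<noteq> 0" using m(1) n(1) by (auto simp: v_def)
  show "algebraic_int (x + y)"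
    by (rule algebraic_int_if_int_span_stable[where v = v, OF fin z])
       (auto simp: distrib_right intro: int_span_add sx sy)
  show "algebraic_int (x * y)"
    by (rule algebraic_int_if_int_span_stable[where v = v, OF fin z])
       (auto simp: mult.assoc intro: int_span_mult_closed sx sy)
qed

lemma algebraic_int_diff: "algebraic_int (x :: complex) \<Longrightarrow> algebraic_int y \<Longrightarrow> algebraic_int (x - y)"
  using algebraic_int_plus[of x "- y"] by auto

lemma algebraic_int_sum: "(\<And>a. a \<in> A \<Longrightarrow> algebraic_int (f a :: complex)) \<Longrightarrow> algebraic_int (sum f A)"
  by (induction A rule: infinite_finite_induct) (auto intro: algebraic_int_plus)

lemma algebraic_int_prod: "(\<And>a. a \<in> A \<Longrightarrow> algebraic_int (f a :: complex)) \<Longrightarrow> algebraic_int (prod f A)"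
  by (induction A rule: infinite_finite_induct) (auto intro: algebraic_int_times)

lemma algebraic_int_pow: "algebraic_int (x :: complex) \<Longrightarrow> algebraic_int (x ^ n)"
  by (induction n) (auto intro: algebraic_int_times)

text \<open>The leading coefficient of an integral equation works: multiplied by a suitable power of it, the
  equation of \<open>x\<close> becomes a monic one for the multiple.\<close>

lemma algebraic_multiple_algebraic_int:
  assumes "algebraic (x :: complex)"
  obtains a :: int where "a > 0" "algebraic_int (of_int a * x)"
proof -
  obtain q :: "complex poly" where q: "\<And>i. Polynomial.coeff q i \<in> \<int>" "q \<noteq> 0" "poly q x = 0"
    using assms unfolding algebraic_def by blast
  have "\<forall>i. \<exists>c. Polynomial.coeff q i = of_int c" using q(1) by (metis Ints_cases)
  then obtain c where c: "\<And>i. Polynomial.coeff q i = of_int (c i)" by metis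
  define m where "m = Polynomial.degree q"
  define a where "a = c m"
  have a0: "a \<noteq> 0" using q(2) c[of m] by (auto simp: a_def m_def)
  define y where "y = of_int a * x"
  have "m > 0"
  proof (rule ccontr)
    assume "\<not> m > 0"
    then have "Polynomial.degree q = 0" by (simp add: m_def)
    then obtain b where "q = [:b:]" by (metis degree_eq_zeroE)
    with q show False by simp
  qed
  have eq: "0 = (\<Sum>j<m. of_int (c j) * x ^ j) + of_int a * x ^ m"
    using q(3) by (simp add: poly_altdef c a_def flip: m_def lessThan_Suc_atMost)
  have ym: "y ^ m = (\<Sum>j<m. of_int (- c j * a ^ (m - 1 - j)) * y ^ j)"
  proof -
    have "y ^ m = of_int a ^ (m - 1) * (of_int a * x ^ m)"
      using \<open>m > 0\<close> by (simp add: y_def power_mult_distrib flip: power_Suc2 mult.assoc)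
    also have "of_int a * x ^ m = - (\<Sum>j<m. of_int (c j) * x ^ j)"
      using eq by (simp add: eq_neg_iff_add_eq_0 add.commute)
    also have "of_int a ^ (m - 1) * - (\<Sum>j<m. of_int (c j) * x ^ j)
      = (\<Sum>j<m. - (of_int (c j) * (of_int a ^ (m - 1) * x ^ j)))"
      by (simp add: sum_distrib_left sum_negf mult_ac)
    also have "\<dots> = (\<Sum>j<m. of_int (- c j * a ^ (m - 1 - j)) * y ^ j)"
    proof (rule sum.cong)
      fix j assume "j \<in> {..<m}"
      then have "m - 1 = (m - 1 - j) + j" by simp
      then have "of_int a ^ (m - 1) = (of_int a ^ (m - 1 - j) * of_int a ^ j :: complex)"
        by (metis power_add)
      then show "- (of_int (c j) * (of_int a ^ (m - 1) * x ^ j))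
          = of_int (- c j * a ^ (m - 1 - j)) * y ^ j"
        by (simp add: y_def power_mult_distrib)
    qed simp
    finally show ?thesis .
  qed
  have "algebraic_int y"
  proof (rule algebraic_int_if_int_span_stable[of "{..<m}" 0 "\<lambda>i. y ^ i"])
    fix i assume i: "i \<in> {..<m}"
    show "y * y ^ i \<in> int_span {..<m} (\<lambda>i. y ^ i)"
    proof (cases "Suc i < m")
      case True
      then show ?thesis using int_span_base[of "{..<m}" "Suc i" "\<lambda>i. y ^ i"] by simp
    next
      case False
      then have "Suc i = m" using i by auto
      then have "y * y ^ i = y ^ m" by (metis power_Suc)
      then show ?thesis unfolding ym by (simp only:) (rule int_spanI[OF refl])
    qed
  qed (use \<open>m > 0\<close> in auto)
  then have "algebraic_int (of_int \<bar>a\<bar> * x)"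
    unfolding y_def by (cases "a > 0") (auto simp: abs_if)
  moreover have "\<bar>a\<bar> > 0" using a0 by simp
  ultimately show thesis using that by blast
qed

section \<open>Subfields of the complex numbers and polynomials over them\<close>

lemma CC_field: "field CC"
  by (rule field_from_type_algebra)

interpretation CC: ring CC
  by (rule ring_from_type_algebra)

lemma CC_sel [simp]:
  "carrier CC = UNIV" "x \<otimes>\<^bsub>CC\<^esub> y = x * y" "x \<oplus>\<^bsub>CC\<^esub> y = x + y" "\<one>\<^bsub>CC\<^esub> = 1" "\<zero>\<^bsub>CC\<^esub> = 0"
  by (simp_all add: ring_of_type_algebra_def)

lemma CC_a_inv [simp]: "\<ominus>\<^bsub>CC\<^esub> x = - x"
  by (rule CC.minus_equality) auto

lemma CC_m_inv [simp]: "x \<noteq> 0 \<Longrightarrow> inv\<^bsub>CC\<^esub> x = inverse x"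
  by (rule comm_monoid.comm_inv_char) (use CC_field in \<open>auto simp: field_def domain_def cring_def\<close>)

context
  fixes K :: "complex set"
  assumes K: "subfield K CC"
begin

lemma sf_0: "0 \<in> K" and sf_1: "1 \<in> K"
  and sf_add: "x \<in> K \<Longrightarrow> y \<in> K \<Longrightarrow> x + y \<in> K"
  and sf_mult: "x \<in> K \<Longrightarrow> y \<in> K \<Longrightarrow> x * y \<in> K"
  and sf_minus: "x \<in> K \<Longrightarrow> - x \<in> K"
  using subringE(2,3,5,6,7)[OF subfieldE(1)[OF K]] by auto

lemma sf_diff: "x \<in> K \<Longrightarrow> y \<in> K \<Longrightarrow> x - y \<in> K"
  using sf_add[of x "- y"] sf_minus by simp

lemma sf_inverse: "x \<in> K \<Longrightarrow> inverse x \<in> K"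
  using CC.subfield_m_inv(1)[OF K, of x] sf_0 by (cases "x = 0") auto

lemma sf_divide: "x \<in> K \<Longrightarrow> y \<in> K \<Longrightarrow> x / y \<in> K"
  by (simp add: divide_inverse sf_mult sf_inverse)

lemma sf_sum: "(\<And>a. a \<in> A \<Longrightarrow> f a \<in> K) \<Longrightarrow> sum f A \<in> K"
  by (induction A rule: infinite_finite_induct) (auto intro: sf_0 sf_add)

lemma sf_prod: "(\<And>a. a \<in> A \<Longrightarrow> f a \<in> K) \<Longrightarrow> prod f A \<in> K"
  by (induction A rule: infinite_finite_induct) (auto intro: sf_1 sf_mult)

lemma sf_power: "x \<in> K \<Longrightarrow> x ^ n \<in> K"
  by (induction n) (auto intro: sf_1 sf_mult)

lemma sf_of_nat: "of_nat n \<in> K"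
  by (induction n) (auto intro: sf_0 sf_1 sf_add)

lemma sf_of_int: "of_int n \<in> K"
  by (cases n rule: int_cases2) (auto intro: sf_of_nat sf_minus)

lemma sf_Rats: "\<rat> \<subseteq> K"
  by (auto elim!: Rats_cases' intro!: sf_divide sf_of_int)

lemma sf_of_rat: "of_rat q \<in> K"
  using sf_Rats by (meson Rats_of_rat subsetD)

end

lemma subfield_CC_I:
  assumes "1 \<in> K" "\<And>x y. x \<in> K \<Longrightarrow> y \<in> K \<Longrightarrow> x + y \<in> K" "\<And>x y. x \<in> K \<Longrightarrow> y \<in> K \<Longrightarrow> x * y \<in> K"
    "\<And>x. x \<in> K \<Longrightarrow> - x \<in> K" "\<And>x. x \<in> K \<Longrightarrow> x \<noteq> 0 \<Longrightarrow> inverse x \<in> K"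
  shows "subfield K CC"
proof (rule field.subfieldI'[OF CC_field])
  show "subring K CC" by (rule CC.subringI) (use assms in auto)
qed (use assms in auto)

lemma subfield_Rats: "subfield \<rat> CC"
  by (rule subfield_CC_I) auto

definition field_gen :: "complex set \<Rightarrow> complex set" where
  "field_gen S = generate_field CC S"

lemma adjoin_field_gen: "adjoin K \<theta> = field_gen (insert \<theta> K)"
  by (simp add: adjoin_def field_gen_def)

lemma field_gen_subfield: "subfield (field_gen S) CC"
  unfolding field_gen_def by (rule field.generate_field_is_subfield[OF CC_field]) simp

lemma field_gen_incl: "S \<subseteq> field_gen S"
  unfolding field_gen_def by (auto intro: generate_field.incl)

lemma field_gen_least: "subfield K CC \<Longrightarrow> S \<subseteq> K \<Longrightarrow> field_gen S \<subseteq> K"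
  unfolding field_gen_def by (rule field.generate_field_min_subfield1[OF CC_field]) auto

lemma field_gen_mono: "S \<subseteq> T \<Longrightarrow> field_gen S \<subseteq> field_gen T"
  unfolding field_gen_def by (rule field.mono_generate_field[OF CC_field]) auto

lemma field_gen_self: "subfield K CC \<Longrightarrow> field_gen K = K"
  using field_gen_incl field_gen_least by blast

lemma field_gen_insert: "field_gen (insert x (field_gen S)) = field_gen (insert x S)"
proof
  show "field_gen (insert x (field_gen S)) \<subseteq> field_gen (insert x S)"
    using field_gen_mono[of S "insert x S"] field_gen_incl[of "insert x S"]
    by (intro field_gen_least field_gen_subfield) auto
  show "field_gen (insert x S) \<subseteq> field_gen (insert x (field_gen S))"
    using field_gen_incl[of S] by (intro field_gen_mono) auto
qed

lemma adjoin_incl: "K \<subseteq> adjoin K \<theta>" and adjoin_gen: "\<theta> \<in> adjoin K \<theta>"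
  using field_gen_incl[of "insert \<theta> K"] by (auto simp: adjoin_field_gen)

lemma adjoin_subfield: "subfield (adjoin K \<theta>) CC"
  unfolding adjoin_field_gen by (rule field_gen_subfield)

definition polys_over :: "complex set \<Rightarrow> complex poly set" where
  "polys_over K = {p. \<forall>i. Polynomial.coeff p i \<in> K}"

context
  fixes K :: "complex set"
  assumes K: "subfield K CC"
begin

lemma polys_over_0: "0 \<in> polys_over K" and polys_over_1: "1 \<in> polys_over K"
  using sf_0[OF K] sf_1[OF K] by (auto simp: polys_over_def coeff_1)

lemma polys_over_pCons: "a \<in> K \<Longrightarrow> p \<in> polys_over K \<Longrightarrow> pCons a p \<in> polys_over K"
  by (auto simp: polys_over_def coeff_pCons split: nat.splits)

lemma polys_over_add: "p \<in> polys_over K \<Longrightarrow> q \<in> polys_over K \<Longrightarrow> p + q \<in> polys_over K"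
  and polys_over_diff: "p \<in> polys_over K \<Longrightarrow> q \<in> polys_over K \<Longrightarrow> p - q \<in> polys_over K"
  and polys_over_minus: "p \<in> polys_over K \<Longrightarrow> - p \<in> polys_over K"
  and polys_over_smult: "a \<in> K \<Longrightarrow> p \<in> polys_over K \<Longrightarrow> smult a p \<in> polys_over K"
  by (auto simp: polys_over_def intro: sf_add[OF K] sf_diff[OF K] sf_minus[OF K] sf_mult[OF K])

lemma polys_over_mult: "p \<in> polys_over K \<Longrightarrow> q \<in> polys_over K \<Longrightarrow> p * q \<in> polys_over K"
  by (auto simp: polys_over_def coeff_mult intro!: sf_sum[OF K] sf_mult[OF K])

lemma polys_over_power: "p \<in> polys_over K \<Longrightarrow> p ^ n \<in> polys_over K"
  by (induction n) (auto intro: polys_over_1 polys_over_mult)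

lemma polys_over_pderiv: "p \<in> polys_over K \<Longrightarrow> pderiv p \<in> polys_over K"
  by (auto simp: polys_over_def coeff_pderiv intro!: sf_mult[OF K] sf_of_nat[OF K] sf_add[OF K] sf_1[OF K] simp del: of_nat_Suc)

lemma poly_polys_over: "p \<in> polys_over K \<Longrightarrow> x \<in> K \<Longrightarrow> poly p x \<in> K"
  by (auto simp: polys_over_def poly_altdef intro!: sf_sum[OF K] sf_mult[OF K] sf_power[OF K])

text \<open>The coefficients of the remainder, not its degree, are restricted: this form has no exception for
  the zero remainder.\<close>

lemma polys_over_division:
  assumes m: "m \<in> polys_over K" "lead_coeff m = 1" and f: "f \<in> polys_over K"
  obtains q r where "q \<in> polys_over K" "r \<in> polys_over K" "f = q * m + r"
    "\<And>i. i \<ge> Polynomial.degree m \<Longrightarrow> Polynomial.coeff r i = 0"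
proof -
  have "\<exists>q r. q \<in> polys_over K \<and> r \<in> polys_over K \<and> f = q * m + r \<and>
    (\<forall>i\<ge>Polynomial.degree m. Polynomial.coeff r i = 0)"
    using f
  proof (induction f)
    case 0
    show ?case by (rule exI[of _ 0], rule exI[of _ 0]) (auto simp: polys_over_0)
  next
    case (pCons a f)
    have a: "a \<in> K" and f: "f \<in> polys_over K"
      using pCons.prems unfolding polys_over_def
      by (auto dest: spec[of _ 0]) (metis coeff_pCons_Suc)
    obtain q r where qr: "q \<in> polys_over K" "r \<in> polys_over K" "f = q * m + r"
      "\<forall>i\<ge>Polynomial.degree m. Polynomial.coeff r i = 0" using pCons.IH[OF f] by blast
    define c where "c = Polynomial.coeff (pCons a r) (Polynomial.degree m)"
    have c: "c \<in> K" using polys_over_pCons[OF a qr(2)] by (simp add: c_def polys_over_def)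
    have "pCons a f = (pCons 0 q + [:c:]) * m + (pCons a r - smult c m)"
      by (simp add: qr(3) algebra_simps)
    moreover have "Polynomial.coeff (pCons a r - smult c m) i = 0" if i: "i \<ge> Polynomial.degree m" for i
    proof (cases "i = Polynomial.degree m")
      case True
      then show ?thesis using m(2) by (simp add: c_def)
    next
      case False
      then obtain j where j: "i = Suc j" "j \<ge> Polynomial.degree m" using i by (cases i) auto
      then show ?thesis using qr(4) False i by (simp add: coeff_eq_0)
    qed
    moreover have "pCons 0 q + [:c:] \<in> polys_over K" "pCons a r - smult c m \<in> polys_over K"
      using a c qr m(1) by (auto intro!: polys_over_add polys_over_pCons polys_over_diff polys_over_smult polys_over_0 sf_0[OF K])
    ultimately show ?case by blast
  qed
  then show thesis using that by blast
qed

end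

definition is_minpoly :: "complex set \<Rightarrow> complex \<Rightarrow> complex poly \<Rightarrow> bool" where
  "is_minpoly K \<theta> m \<longleftrightarrow> m \<in> polys_over K \<and> lead_coeff m = 1 \<and> poly m \<theta> = 0 \<and>
     (\<forall>g\<in>polys_over K. poly g \<theta> = 0 \<longrightarrow> g \<noteq> 0 \<longrightarrow> Polynomial.degree m \<le> Polynomial.degree g)"

lemma minpoly_exists:
  assumes K: "subfield K CC" and "g \<in> polys_over K" "g \<noteq> 0" "poly g \<theta> = 0"
  obtains m where "is_minpoly K \<theta> m"
proof -
  let ?P = "\<lambda>g. g \<in> polys_over K \<and> g \<noteq> 0 \<and> poly g \<theta> = 0"
  define g where "g = arg_min Polynomial.degree ?P"
  have g: "?P g" and le: "\<And>h. ?P h \<Longrightarrow> Polynomial.degree g \<le> Polynomial.degree h"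
    unfolding g_def using arg_min_natI[of ?P] arg_min_nat_le[of ?P] assms by blast+
  define m where "m = smult (inverse (lead_coeff g)) g"
  have "lead_coeff g \<in> K" using g by (simp add: polys_over_def)
  then have "m \<in> polys_over K" unfolding m_def using g by (intro polys_over_smult[OF K] sf_inverse[OF K]) auto
  then have "is_minpoly K \<theta> m" unfolding is_minpoly_def using g le by (auto simp: m_def)
  then show thesis using that by blast
qed

lemma minpoly_exists_algebraic:
  assumes K: "subfield K CC" and "algebraic \<theta>"
  obtains m where "is_minpoly K \<theta> m"
proof -
  obtain g where g: "\<forall>i. Polynomial.coeff g i \<in> \<int>" "g \<noteq> 0" "poly g \<theta> = 0"
    using assms(2) unfolding algebraic_def by blast
  have "g \<in> polys_over K" using g(1) sf_of_int[OF K] by (auto simp: polys_over_def elim: Ints_cases) (metis Ints_cases)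
  with g that show thesis using minpoly_exists[OF K] by blast
qed

lemma minpoly_degree_pos: "is_minpoly K \<theta> m \<Longrightarrow> Polynomial.degree m > 0"
proof (rule ccontr)
  assume m: "is_minpoly K \<theta> m" "\<not> Polynomial.degree m > 0"
  then obtain c where "m = [:c:]" by (metis degree_eq_zeroE gr0I)
  with m show False by (auto simp: is_minpoly_def)
qed

lemma minpoly_dvd:
  assumes K: "subfield K CC" and m: "is_minpoly K \<theta> m" and g: "g \<in> polys_over K" "poly g \<theta> = 0"
  obtains h where "h \<in> polys_over K" "g = h * m"
proof -
  have m': "m \<in> polys_over K" "lead_coeff m = 1" "poly m \<theta> = 0" using m by (auto simp: is_minpoly_def)
  obtain q r where qr: "q \<in> polys_over K" "r \<in> polys_over K" "g = q * m + r"
    "\<And>i. i \<ge> Polynomial.degree m \<Longrightarrow> Polynomial.coeff r i = 0"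
    using polys_over_division[OF K m'(1,2) g(1)] by blast
  have "poly r \<theta> = 0" using qr(3) g(2) m'(3) by simp
  then have "r = 0" using m qr(2) qr(4)[of "Polynomial.degree r"] unfolding is_minpoly_def
    by (metis leading_coeff_0_iff)
  then show thesis using that qr by simp
qed

text \<open>A generator of the ideal spanned by \<open>g\<close> and the minimal polynomial \<open>m\<close> divides \<open>m\<close> without
  vanishing at \<open>\<theta>\<close>, so minimality of \<open>m\<close> forces it to be constant.\<close>

lemma minpoly_bezout:
  assumes K: "subfield K CC" and m: "is_minpoly K \<theta> m" and g: "g \<in> polys_over K" "poly g \<theta> \<noteq> 0"
  obtains u v where "u \<in> polys_over K" "v \<in> polys_over K" "u * g + v * m = 1"
proof -
  have m': "m \<in> polys_over K" "lead_coeff m = 1" "poly m \<theta> = 0"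
    and mmin: "\<And>g. g\<in>polys_over K \<Longrightarrow> poly g \<theta> = 0 \<Longrightarrow> g \<noteq> 0 \<Longrightarrow> Polynomial.degree m \<le> Polynomial.degree g"
    using m by (auto simp: is_minpoly_def)
  define I where "I = {u * g + v * m | u v. u \<in> polys_over K \<and> v \<in> polys_over K}"
  have I_sub: "I \<subseteq> polys_over K" using g m' K by (auto simp: I_def intro: polys_over_add polys_over_mult)
  have gI: "g \<in> I" unfolding I_def
    by (intro CollectI exI[of _ 1] exI[of _ 0]) (auto simp: polys_over_0[OF K] polys_over_1[OF K])
  have mI: "m \<in> I" unfolding I_def
    by (intro CollectI exI[of _ 0] exI[of _ 1]) (auto simp: polys_over_0[OF K] polys_over_1[OF K])
  have I_mult: "h * p \<in> I" if p: "p \<in> I" and h: "h \<in> polys_over K" for h p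
  proof -
    obtain u v where "p = u * g + v * m" "u \<in> polys_over K" "v \<in> polys_over K" using p by (auto simp: I_def)
    then have "h * p = (h * u) * g + (h * v) * m" "h * u \<in> polys_over K" "h * v \<in> polys_over K"
      using h K by (auto simp: algebra_simps intro: polys_over_mult)
    then show ?thesis unfolding I_def by blast
  qed
  have I_diff: "p - q \<in> I" if p: "p \<in> I" "q \<in> I" for p q
  proof -
    obtain u v u' v' where "p = u * g + v * m" "u \<in> polys_over K" "v \<in> polys_over K"
      "q = u' * g + v' * m" "u' \<in> polys_over K" "v' \<in> polys_over K" using p by (auto simp: I_def)
    then have "p - q = (u - u') * g + (v - v') * m" "u - u' \<in> polys_over K" "v - v' \<in> polys_over K"
      using K by (auto simp: algebra_simps intro: polys_over_diff)
    then show ?thesis unfolding I_def by blast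
  qed
  let ?P = "\<lambda>p. p \<in> I \<and> p \<noteq> 0"
  define d0 where "d0 = arg_min Polynomial.degree ?P"
  have "?P m" using mI m' by auto
  then have d0: "?P d0" and d0le: "\<And>h. ?P h \<Longrightarrow> Polynomial.degree d0 \<le> Polynomial.degree h"
    unfolding d0_def using arg_min_natI[of ?P] arg_min_nat_le[of ?P] by blast+
  define d where "d = [:inverse (lead_coeff d0):] * d0"
  have "lead_coeff d0 \<in> K" using d0 I_sub by (auto simp: polys_over_def)
  then have dI: "d \<in> I" unfolding d_def using d0
    by (intro I_mult polys_over_pCons[OF K] sf_inverse[OF K] polys_over_0[OF K]) auto
  have d1: "lead_coeff d = 1" and ddeg: "Polynomial.degree d = Polynomial.degree d0" using d0 by (auto simp: d_def)
  have div: "\<exists>q\<in>polys_over K. p = q * d" if p: "p \<in> I" for p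
  proof -
    obtain q r where qr: "q \<in> polys_over K" "r \<in> polys_over K" "p = q * d + r"
      "\<And>i. i \<ge> Polynomial.degree d \<Longrightarrow> Polynomial.coeff r i = 0"
      using polys_over_division[OF K _ d1] dI p I_sub by blast
    have "r = p - q * d" using qr(3) by simp
    then have "r \<in> I" using I_diff I_mult p dI qr(1) by blast
    have "r = 0"
    proof (rule ccontr)
      assume "r \<noteq> 0"
      then have "Polynomial.degree d \<le> Polynomial.degree r" using d0le \<open>r \<in> I\<close> ddeg by simp
      then have "lead_coeff r = 0" using qr(4) by blast
      with \<open>r \<noteq> 0\<close> show False by simp
    qed
    then show ?thesis using qr by auto
  qed
  obtain q where q: "q \<in> polys_over K" "m = q * d" using div[OF mI] by blast
  obtain q' where q': "q' \<in> polys_over K" "g = q' * d" using div[OF gI] by blast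
  have "poly d \<theta> \<noteq> 0" using q' g(2) by auto
  then have "poly q \<theta> = 0" using q m' by auto
  have "q \<noteq> 0" "d \<noteq> 0" using q m' by auto
  then have "Polynomial.degree m \<le> Polynomial.degree q" using mmin q \<open>poly q \<theta> = 0\<close> by blast
  then have "Polynomial.degree d = 0" using q \<open>q \<noteq> 0\<close> \<open>d \<noteq> 0\<close> by (simp add: degree_mult_eq)
  then have "d = 1" using d1 by (metis degree_eq_zeroE lead_coeff_pCons(2) one_pCons)
  then show thesis using dI that unfolding I_def by auto
qed

text \<open>In characteristic zero the derivative of the minimal polynomial is nonzero of smaller degree, so it
  does not vanish at \<open>\<theta>\<close>.\<close>

lemma minpoly_separable:
  assumes K: "subfield K CC" and m: "is_minpoly K \<theta> m"
  obtains u v where "u \<in> polys_over K" "v \<in> polys_over K" "u * pderiv m + v * m = 1"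
proof -
  have d: "pderiv m \<in> polys_over K" using m by (auto simp: is_minpoly_def intro: polys_over_pderiv[OF K])
  have "pderiv m \<noteq> 0" "Polynomial.degree (pderiv m) < Polynomial.degree m"
    using minpoly_degree_pos[OF m] by (auto simp: pderiv_eq_0_iff degree_pderiv)
  then have "poly (pderiv m) \<theta> \<noteq> 0" using m d by (auto simp: is_minpoly_def)
  then show thesis using minpoly_bezout[OF K m d] that by blast
qed

text \<open>The values are closed under inverses by the Bezout identity with the minimal polynomial.\<close>

lemma adjoin_eq_poly_values:
  assumes K: "subfield K CC" and m: "is_minpoly K \<theta> m"
  shows "adjoin K \<theta> = (\<lambda>g. poly g \<theta>) ` polys_over K"
proof
  have "subfield ((\<lambda>g. poly g \<theta>) ` polys_over K) CC"
  proof (rule subfield_CC_I, goal_cases)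
    case 1 then show ?case using polys_over_1[OF K] by (force simp: image_iff)
  next
    case (2 x y) then show ?case using polys_over_add[OF K] by (force simp: image_iff)
  next
    case (3 x y) then show ?case using polys_over_mult[OF K] by (force simp: image_iff)
  next
    case (4 x) then show ?case using polys_over_minus[OF K] by (force simp: image_iff)
  next
    case (5 x)
    then obtain g where g: "g \<in> polys_over K" "x = poly g \<theta>" by auto
    then obtain u v where uv: "u \<in> polys_over K" "u * g + v * m = 1"
      using minpoly_bezout[OF K m g(1)] 5 by blast
    have "poly (u * g + v * m) \<theta> = 1" by (simp only: uv(2)) simp
    then have "poly u \<theta> * x = 1" using m g(2) by (simp add: is_minpoly_def)
    then have "inverse x = poly u \<theta>" by (metis inverse_unique mult.commute)
    then show ?case using uv by auto
  qed
  moreover have "insert \<theta> K \<subseteq> (\<lambda>g. poly g \<theta>) ` polys_over K"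
  proof
    fix x assume "x \<in> insert \<theta> K"
    then consider "x = \<theta>" | "x \<in> K" by auto
    then show "x \<in> (\<lambda>g. poly g \<theta>) ` polys_over K"
    proof cases
      case 1
      then show ?thesis
        by (intro image_eqI[of _ _ "[:0, 1:]"]) (auto intro!: polys_over_pCons[OF K] polys_over_0[OF K] sf_0[OF K] sf_1[OF K])
    next
      case 2
      then show ?thesis
        by (intro image_eqI[of _ _ "[:x:]"]) (auto intro!: polys_over_pCons[OF K] polys_over_0[OF K])
    qed
  qed
  ultimately show "adjoin K \<theta> \<subseteq> (\<lambda>g. poly g \<theta>) ` polys_over K"
    unfolding adjoin_field_gen by (rule field_gen_least)
  show "(\<lambda>g. poly g \<theta>) ` polys_over K \<subseteq> adjoin K \<theta>"
  proof safe
    fix g assume "g \<in> polys_over K"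
    moreover have "K \<subseteq> adjoin K \<theta>" "\<theta> \<in> adjoin K \<theta>" by (auto simp: adjoin_gen intro: adjoin_incl[THEN subsetD])
    ultimately show "poly g \<theta> \<in> adjoin K \<theta>"
      unfolding adjoin_field_gen by (intro poly_polys_over[OF field_gen_subfield]) (auto simp: polys_over_def)
  qed
qed

section \<open>Complex embeddings\<close>

text \<open>Extensionality makes an embedding the same thing as its values on \<open>K\<close>, so that embeddings can be
  counted.\<close>

definition embeddings :: "complex set \<Rightarrow> (complex \<Rightarrow> complex) set" where
  "embeddings K = {\<sigma> \<in> extensional K. \<sigma> 1 = 1 \<and>
     (\<forall>x\<in>K. \<forall>y\<in>K. \<sigma> (x + y) = \<sigma> x + \<sigma> y \<and> \<sigma> (x * y) = \<sigma> x * \<sigma> y)}"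

context
  fixes K \<sigma>
  assumes K: "subfield K CC" and s: "\<sigma> \<in> embeddings K"
begin

lemma emb_1: "\<sigma> 1 = 1"
  and emb_add: "x \<in> K \<Longrightarrow> y \<in> K \<Longrightarrow> \<sigma> (x + y) = \<sigma> x + \<sigma> y"
  and emb_mult: "x \<in> K \<Longrightarrow> y \<in> K \<Longrightarrow> \<sigma> (x * y) = \<sigma> x * \<sigma> y"
  using s by (auto simp: embeddings_def)

lemma emb_0: "\<sigma> 0 = 0"
  using emb_add[of 0 0] sf_0[OF K] by simp

lemma emb_minus: "x \<in> K \<Longrightarrow> \<sigma> (- x) = - \<sigma> x"
  using emb_add[of x "- x"] emb_0 sf_minus[OF K] by (simp add: eq_neg_iff_add_eq_0 add.commute)

lemma emb_diff: "x \<in> K \<Longrightarrow> y \<in> K \<Longrightarrow> \<sigma> (x - y) = \<sigma> x - \<sigma> y"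
  using emb_add[of x "- y"] emb_minus[of y] sf_minus[OF K] by simp

lemma emb_sum: "(\<And>a. a \<in> A \<Longrightarrow> f a \<in> K) \<Longrightarrow> \<sigma> (sum f A) = (\<Sum>a\<in>A. \<sigma> (f a))"
  by (induction A rule: infinite_finite_induct) (auto simp: emb_0 emb_add sf_sum[OF K])

lemma emb_prod: "(\<And>a. a \<in> A \<Longrightarrow> f a \<in> K) \<Longrightarrow> \<sigma> (prod f A) = (\<Prod>a\<in>A. \<sigma> (f a))"
  by (induction A rule: infinite_finite_induct) (auto simp: emb_1 emb_mult sf_prod[OF K])

lemma emb_power: "x \<in> K \<Longrightarrow> \<sigma> (x ^ n) = \<sigma> x ^ n"
  by (induction n) (auto simp: emb_1 emb_mult sf_power[OF K])

lemma emb_eq_0_iff: "x \<in> K \<Longrightarrow> \<sigma> x = 0 \<longleftrightarrow> x = 0"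
  using emb_mult[of x "inverse x"] emb_0 emb_1 sf_inverse[OF K, of x] by (cases "x = 0") auto

lemma emb_inverse: "x \<in> K \<Longrightarrow> \<sigma> (inverse x) = inverse (\<sigma> x)"
  using emb_mult[of x "inverse x"] emb_0 emb_1 sf_inverse[OF K]
  by (cases "x = 0") (auto simp: inverse_unique)

lemma emb_of_nat: "\<sigma> (of_nat n) = of_nat n"
  by (induction n) (auto simp: emb_0 emb_1 emb_add sf_of_nat[OF K] sf_1[OF K])

lemma emb_of_int: "\<sigma> (of_int n) = of_int n"
  by (cases n rule: int_cases2) (auto simp: emb_of_nat emb_minus sf_of_nat[OF K])

lemma emb_Rats: "x \<in> \<rat> \<Longrightarrow> \<sigma> x = x"
  by (auto elim!: Rats_cases' simp: divide_inverse emb_mult emb_inverse emb_of_int sf_of_int[OF K] sf_inverse[OF K])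

lemma emb_poly:
  assumes "p \<in> polys_over K" "x \<in> K"
  shows "\<sigma> (poly p x) = poly (map_poly \<sigma> p) (\<sigma> x)"
proof -
  have "Polynomial.degree (map_poly \<sigma> p) \<le> Polynomial.degree p" by (rule degree_map_poly_le)
  then have "poly (map_poly \<sigma> p) (\<sigma> x) = (\<Sum>i\<le>Polynomial.degree p. Polynomial.coeff (map_poly \<sigma> p) i * \<sigma> x ^ i)"
    unfolding poly_altdef by (intro sum.mono_neutral_left) (auto simp: coeff_eq_0)
  also have "\<dots> = \<sigma> (poly p x)"
    using assms unfolding poly_altdef
    by (subst emb_sum) (auto simp: coeff_map_poly emb_0 emb_mult emb_power polys_over_def sf_mult[OF K] sf_power[OF K])
  finally show ?thesis ..
qed

lemma emb_map_poly_add: "p \<in> polys_over K \<Longrightarrow> q \<in> polys_over K \<Longrightarrow> map_poly \<sigma> (p + q) = map_poly \<sigma> p + map_poly \<sigma> q"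
  by (rule poly_eqI) (auto simp: coeff_map_poly emb_0 polys_over_def emb_add)

lemma emb_map_poly_diff: "p \<in> polys_over K \<Longrightarrow> q \<in> polys_over K \<Longrightarrow> map_poly \<sigma> (p - q) = map_poly \<sigma> p - map_poly \<sigma> q"
  by (rule poly_eqI) (auto simp: coeff_map_poly emb_0 polys_over_def emb_diff)

lemma emb_map_poly_mult: "p \<in> polys_over K \<Longrightarrow> q \<in> polys_over K \<Longrightarrow> map_poly \<sigma> (p * q) = map_poly \<sigma> p * map_poly \<sigma> q"
  by (rule poly_eqI)
     (auto simp: coeff_map_poly emb_0 polys_over_def emb_mult coeff_mult emb_sum sf_mult[OF K])

lemma emb_map_poly_pderiv: "p \<in> polys_over K \<Longrightarrow> map_poly \<sigma> (pderiv p) = pderiv (map_poly \<sigma> p)"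
  by (rule poly_eqI)
     (auto simp: coeff_map_poly emb_0 polys_over_def emb_mult coeff_pderiv emb_of_nat sf_of_nat[OF K] simp del: of_nat_Suc)

lemma emb_map_poly_monic:
  assumes "lead_coeff p = 1"
  shows "Polynomial.degree (map_poly \<sigma> p) = Polynomial.degree p" "lead_coeff (map_poly \<sigma> p) = 1"
proof -
  have "Polynomial.coeff (map_poly \<sigma> p) (Polynomial.degree p) = 1" using assms by (simp add: coeff_map_poly emb_0 emb_1)
  then have "Polynomial.degree p \<le> Polynomial.degree (map_poly \<sigma> p)" by (intro le_degree) simp
  then show *: "Polynomial.degree (map_poly \<sigma> p) = Polynomial.degree p" using degree_map_poly_le[of \<sigma> p] by simp
  then show "lead_coeff (map_poly \<sigma> p) = 1" using \<open>Polynomial.coeff (map_poly \<sigma> p) (Polynomial.degree p) = 1\<close> by simp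
qed

lemma emb_restrict: "subfield E CC \<Longrightarrow> E \<subseteq> K \<Longrightarrow> restrict \<sigma> E \<in> embeddings E"
  using s sf_1 sf_add sf_mult unfolding embeddings_def by (auto simp: subset_iff)

lemma emb_algebraic_int:
  assumes "x \<in> K" "algebraic_int x" shows "algebraic_int (\<sigma> x)"
proof -
  obtain p where p: "lead_coeff p = 1" "\<forall>i. Polynomial.coeff p i \<in> \<int>" "poly p x = 0"
    using assms(2) by (auto elim: algebraic_int.cases)
  have "p \<in> polys_over K" using p(2) sf_of_int[OF K] by (auto simp: polys_over_def) (metis Ints_cases)
  moreover have "map_poly \<sigma> p = p"
    by (rule poly_eqI) (metis Ints_subset_Rats coeff_map_poly emb_0 emb_Rats p(2) subsetD)
  ultimately have "poly p (\<sigma> x) = 0" using emb_poly[OF _ assms(1), of p] p(3) emb_0 by simp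
  then show ?thesis using p by (auto intro: algebraic_int.intros)
qed

end

lemma embeddings_eqI:
  assumes "\<sigma> \<in> embeddings K" "\<sigma>' \<in> embeddings K" "\<And>x. x \<in> K \<Longrightarrow> \<sigma> x = \<sigma>' x"
  shows "\<sigma> = \<sigma>'"
  using assms by (auto simp: embeddings_def intro: extensionalityI)

lemma embeddings_Rats: "embeddings \<rat> = {restrict id \<rat>}"
proof -
  have id: "restrict id \<rat> \<in> embeddings \<rat>" by (auto simp: embeddings_def)
  have "\<sigma> = restrict id \<rat>" if s: "\<sigma> \<in> embeddings \<rat>" for \<sigma>
    by (rule embeddings_eqI[OF s id]) (simp add: emb_Rats[OF subfield_Rats s])
  with id show ?thesis by blast
qed

text \<open>The Bezout identity of the minimal polynomial and its derivative is preserved by the embedding.\<close>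

lemma minpoly_map_rsquarefree:
  assumes K: "subfield K CC" and m: "is_minpoly K \<theta> m" and t: "\<tau> \<in> embeddings K"
  shows "rsquarefree (map_poly \<tau> m)"
proof -
  obtain u v where uv: "u \<in> polys_over K" "v \<in> polys_over K" "u * pderiv m + v * m = 1"
    using minpoly_separable[OF K m] by blast
  have m': "m \<in> polys_over K" using m by (simp add: is_minpoly_def)
  have one: "map_poly \<tau> (u * pderiv m + v * m) = 1"
    unfolding uv(3) by (rule poly_eqI) (auto simp: coeff_map_poly emb_0[OF K t] coeff_1 emb_1[OF K t])
  have "map_poly \<tau> (u * pderiv m + v * m) = map_poly \<tau> u * pderiv (map_poly \<tau> m) + map_poly \<tau> v * map_poly \<tau> m"
    using uv(1,2) m' by (simp add: emb_map_poly_add[OF K t] emb_map_poly_mult[OF K t] emb_map_poly_pderiv[OF K t]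
       polys_over_mult[OF K] polys_over_pderiv[OF K])
  with one have "map_poly \<tau> u * pderiv (map_poly \<tau> m) + map_poly \<tau> v * map_poly \<tau> m = 1" by simp
  then have "poly (map_poly \<tau> u) a * poly (pderiv (map_poly \<tau> m)) a + poly (map_poly \<tau> v) a * poly (map_poly \<tau> m) a = 1" for a
    by (metis poly_1 poly_add poly_mult)
  then show ?thesis unfolding rsquarefree_roots by (metis add.right_neutral mult_zero_right zero_neq_one)
qed

lemma rsquarefree_card_roots:
  assumes "rsquarefree (p :: complex poly)"
  shows "finite {z. poly p z = 0}" "card {z. poly p z = 0} = Polynomial.degree p"
proof -
  have p0: "p \<noteq> 0" using assms by (auto simp: rsquarefree_def)
  show fin: "finite {z. poly p z = 0}" using poly_roots_finite[OF p0] .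
  have "Polynomial.degree p = Polynomial.degree (smult (lead_coeff p) (\<Prod>z|poly p z = 0. [:-z, 1:]))"
    using complex_poly_decompose_rsquarefree[OF assms] by simp
  also have "\<dots> = (\<Sum>z|poly p z = 0. Polynomial.degree [:-z, 1:])"
    using p0 by (simp add: degree_prod_eq_sum_degree)
  finally show "card {z. poly p z = 0} = Polynomial.degree p" by simp
qed

text \<open>A root \<open>r\<close> of the transported minimal polynomial is a possible image of \<open>\<theta>\<close>, because polynomials with
  the same value at \<open>\<theta>\<close> differ by a multiple of the minimal polynomial and so agree at \<open>r\<close> after
  transport.\<close>

lemma simple_extension_embedding_exists:
  assumes K: "subfield K CC" and m: "is_minpoly K \<theta> m" and t: "\<tau> \<in> embeddings K"
    and r: "poly (map_poly \<tau> m) r = 0"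
  obtains \<sigma> where "\<sigma> \<in> embeddings (adjoin K \<theta>)" "restrict \<sigma> K = \<tau>" "\<sigma> \<theta> = r"
proof -
  define s where "s x = poly (map_poly \<tau> (SOME g. g \<in> polys_over K \<and> x = poly g \<theta>)) r" for x
  have s: "s (poly g \<theta>) = poly (map_poly \<tau> g) r" if g: "g \<in> polys_over K" for g
  proof -
    define g' where "g' = (SOME h. h \<in> polys_over K \<and> poly g \<theta> = poly h \<theta>)"
    have "g' \<in> polys_over K \<and> poly g \<theta> = poly g' \<theta>"
      unfolding g'_def by (rule someI[of _ g]) (use g in auto)
    then have g': "g' \<in> polys_over K" "poly (g - g') \<theta> = 0" by auto
    have "g - g' \<in> polys_over K" using g g' K by (auto intro: polys_over_diff)
    then obtain h where h: "h \<in> polys_over K" "g - g' = h * m" using minpoly_dvd[OF K m] g'(2) by blast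
    have "map_poly \<tau> g - map_poly \<tau> g' = map_poly \<tau> h * map_poly \<tau> m"
      using h m g g' by (simp add: is_minpoly_def flip: emb_map_poly_diff[OF K t] emb_map_poly_mult[OF K t])
    then have "poly (map_poly \<tau> g - map_poly \<tau> g') r = 0" using r by simp
    then show ?thesis by (simp add: s_def g'_def)
  qed
  note F = adjoin_eq_poly_values[OF K m]
  define \<sigma> where "\<sigma> = restrict s (adjoin K \<theta>)"
  have incl: "K \<subseteq> adjoin K \<theta>" "\<theta> \<in> adjoin K \<theta>" by (auto simp: adjoin_gen intro: adjoin_incl[THEN subsetD])
  have "map_poly \<tau> [:x:] = [:\<tau> x:]" for x
    by (rule poly_eqI) (simp add: coeff_map_poly coeff_pCons emb_0[OF K t] split: nat.split)
  then have sc: "s x = \<tau> x" if "x \<in> K" for x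
    using s[of "[:x:]"] that by (simp add: polys_over_pCons[OF K] polys_over_0[OF K] map_poly_pCons emb_0[OF K t])
  have st: "s \<theta> = r"
    using s[of "[:0, 1:]"] by (simp add: polys_over_pCons[OF K] polys_over_0[OF K] map_poly_pCons sf_0[OF K] sf_1[OF K] emb_0[OF K t] emb_1[OF K t])
  have sF: "subfield (adjoin K \<theta>) CC" by (rule adjoin_subfield)
  have "\<sigma> \<in> embeddings (adjoin K \<theta>)"
    unfolding embeddings_def
  proof (intro CollectI conjI ballI)
    show "\<sigma> \<in> extensional (adjoin K \<theta>)" by (simp add: \<sigma>_def)
    show "\<sigma> 1 = 1" using sc[OF sf_1[OF K]] sf_1[OF sF] by (simp add: \<sigma>_def emb_1[OF K t])
  next
    fix x y assume xy: "x \<in> adjoin K \<theta>" "y \<in> adjoin K \<theta>"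
    then obtain g h where gh: "g \<in> polys_over K" "x = poly g \<theta>" "h \<in> polys_over K" "y = poly h \<theta>"
      unfolding F by auto
    have "s (x + y) = s x + s y"
      using s[of "g + h"] gh by (simp add: polys_over_add[OF K] s emb_map_poly_add[OF K t])
    then show "\<sigma> (x + y) = \<sigma> x + \<sigma> y" using xy by (simp add: \<sigma>_def sf_add[OF sF])
    have "s (x * y) = s x * s y"
      using s[of "g * h"] gh by (simp add: polys_over_mult[OF K] s emb_map_poly_mult[OF K t])
    then show "\<sigma> (x * y) = \<sigma> x * \<sigma> y" using xy by (simp add: \<sigma>_def sf_mult[OF sF])
  qed
  moreover have "restrict \<sigma> K = \<tau>"
    using sc incl t by (auto simp: \<sigma>_def fun_eq_iff restrict_def embeddings_def extensional_def)
  moreover have "\<sigma> \<theta> = r" using st incl by (simp add: \<sigma>_def)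
  ultimately show thesis using that by blast
qed

lemma simple_extension_embedding_unique:
  assumes K: "subfield K CC" and m: "is_minpoly K \<theta> m"
    and s: "\<sigma> \<in> embeddings (adjoin K \<theta>)" "\<sigma>' \<in> embeddings (adjoin K \<theta>)"
    and eq: "restrict \<sigma> K = restrict \<sigma>' K" "\<sigma> \<theta> = \<sigma>' \<theta>"
  shows "\<sigma> = \<sigma>'"
proof (rule embeddings_eqI[OF s])
  fix x assume "x \<in> adjoin K \<theta>"
  then obtain g where g: "g \<in> polys_over K" "x = poly g \<theta>" unfolding adjoin_eq_poly_values[OF K m] by auto
  have incl: "K \<subseteq> adjoin K \<theta>" "\<theta> \<in> adjoin K \<theta>" by (auto simp: adjoin_gen intro: adjoin_incl[THEN subsetD])
  have sF: "subfield (adjoin K \<theta>) CC" by (rule adjoin_subfield)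
  have g': "g \<in> polys_over (adjoin K \<theta>)" using g(1) incl by (auto simp: polys_over_def)
  have "map_poly \<sigma> g = map_poly \<sigma>' g"
    using g(1) eq(1) unfolding polys_over_def
    by (intro poly_eqI) (auto simp: coeff_map_poly emb_0[OF sF s(1)] emb_0[OF sF s(2)], metis restrict_apply')
  then show "\<sigma> x = \<sigma>' x" using emb_poly[OF sF s(1) g' incl(2)] emb_poly[OF sF s(2) g' incl(2)] g(2) eq(2) by simp
qed

lemma emb_root_of_minpoly:
  assumes K: "subfield K CC" and m: "is_minpoly K \<theta> m" and F: "subfield F CC" "K \<subseteq> F" "\<theta> \<in> F"
    and s: "\<sigma> \<in> embeddings F"
  shows "poly (map_poly (restrict \<sigma> K) m) (\<sigma> \<theta>) = 0"
proof -
  have "m \<in> polys_over K" using m by (simp add: is_minpoly_def)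
  then have m': "m \<in> polys_over F" using F(2) by (auto simp: polys_over_def)
  have "map_poly (restrict \<sigma> K) m = map_poly \<sigma> m"
    using \<open>m \<in> polys_over K\<close> unfolding polys_over_def
    by (intro poly_eqI) (auto simp: coeff_map_poly emb_0[OF F(1) s] sf_0[OF K])
  moreover have "poly (map_poly \<sigma> m) (\<sigma> \<theta>) = \<sigma> (poly m \<theta>)" using emb_poly[OF F(1) s m' F(3)] by simp
  ultimately show ?thesis using m emb_0[OF F(1) s] by (simp add: is_minpoly_def)
qed

lemma simple_extension_card:
  assumes K: "subfield K CC" and m: "is_minpoly K \<theta> m" and t: "\<tau> \<in> embeddings K"
  shows "finite {\<sigma> \<in> embeddings (adjoin K \<theta>). restrict \<sigma> K = \<tau>}" (is "finite ?A")
    "card {\<sigma> \<in> embeddings (adjoin K \<theta>). restrict \<sigma> K = \<tau>} = Polynomial.degree m"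
proof -
  have incl: "K \<subseteq> adjoin K \<theta>" "\<theta> \<in> adjoin K \<theta>" by (auto simp: adjoin_gen intro: adjoin_incl[THEN subsetD])
  have sF: "subfield (adjoin K \<theta>) CC" unfolding adjoin_field_gen by (rule field_gen_subfield)
  note sq = rsquarefree_card_roots[OF minpoly_map_rsquarefree[OF K m t]]
  have "bij_betw (\<lambda>\<sigma>. \<sigma> \<theta>) ?A {z. poly (map_poly \<tau> m) z = 0}"
    unfolding bij_betw_def
  proof
    show "inj_on (\<lambda>\<sigma>. \<sigma> \<theta>) ?A"
      by (rule inj_onI) (auto intro: simple_extension_embedding_unique[OF K m])
    show "(\<lambda>\<sigma>. \<sigma> \<theta>) ` ?A = {z. poly (map_poly \<tau> m) z = 0}"
    proof
      show "(\<lambda>\<sigma>. \<sigma> \<theta>) ` ?A \<subseteq> {z. poly (map_poly \<tau> m) z = 0}"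
        using emb_root_of_minpoly[OF K m sF incl] by auto
      show "{z. poly (map_poly \<tau> m) z = 0} \<subseteq> (\<lambda>\<sigma>. \<sigma> \<theta>) ` ?A"
      proof
        fix r assume "r \<in> {z. poly (map_poly \<tau> m) z = 0}"
        then obtain \<sigma> where "\<sigma> \<in> ?A" "\<sigma> \<theta> = r" using simple_extension_embedding_exists[OF K m t, of r] by blast
        then show "r \<in> (\<lambda>\<sigma>. \<sigma> \<theta>) ` ?A" by blast
      qed
    qed
  qed
  then have "finite ?A = finite {z. poly (map_poly \<tau> m) z = 0}" "card ?A = card {z. poly (map_poly \<tau> m) z = 0}"
    by (auto dest: bij_betw_finite bij_betw_same_card)
  then show "finite ?A" "card ?A = Polynomial.degree m"
    using sq emb_map_poly_monic(1)[OF K t, of m] m by (auto simp: is_minpoly_def)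
qed

text \<open>All embeddings of the base field extend in the same number of ways, which replaces Galois
  theory in everything that follows.\<close>

lemma extension_fibers_same_card:
  assumes K: "subfield K CC" and S: "finite S" "S \<subseteq> Qbar"
  obtains k where "k > 0"
    "\<And>\<tau>. \<tau> \<in> embeddings K \<Longrightarrow> finite {\<sigma> \<in> embeddings (field_gen (K \<union> S)). restrict \<sigma> K = \<tau>}"
    "\<And>\<tau>. \<tau> \<in> embeddings K \<Longrightarrow> card {\<sigma> \<in> embeddings (field_gen (K \<union> S)). restrict \<sigma> K = \<tau>} = k"
proof -
  have "\<exists>k>0. \<forall>\<tau>\<in>embeddings K. finite {\<sigma> \<in> embeddings (field_gen (K \<union> S)). restrict \<sigma> K = \<tau>} \<and>
      card {\<sigma> \<in> embeddings (field_gen (K \<union> S)). restrict \<sigma> K = \<tau>} = k"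
    using S
  proof (induction S)
    case empty
    have "restrict \<tau> K = \<tau>" if "\<tau> \<in> embeddings K" for \<tau>
      using that by (auto simp: embeddings_def extensional_restrict)
    then have "{\<sigma> \<in> embeddings K. restrict \<sigma> K = \<tau>} = {\<tau>}" if "\<tau> \<in> embeddings K" for \<tau>
      using that by auto
    then show ?case by (intro exI[of _ 1] conjI ballI) (simp_all only: field_gen_self[OF K] Un_empty_right, simp_all)
  next
    case (insert x S)
    let ?F = "field_gen (K \<union> S)" and ?G = "field_gen (K \<union> insert x S)"
    let ?A = "\<lambda>\<tau>. {\<sigma> \<in> embeddings ?F. restrict \<sigma> K = \<tau>}"
    let ?B = "\<lambda>\<tau>. {\<sigma> \<in> embeddings ?G. restrict \<sigma> K = \<tau>}"
    let ?C = "\<lambda>\<tau>. {\<sigma> \<in> embeddings ?G. restrict \<sigma> ?F = \<tau>}"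
    obtain k where k: "k > 0" "\<And>\<tau>. \<tau> \<in> embeddings K \<Longrightarrow> finite (?A \<tau>)" "\<And>\<tau>. \<tau> \<in> embeddings K \<Longrightarrow> card (?A \<tau>) = k"
      using insert.IH insert.prems by blast
    have sF: "subfield ?F CC" and sG: "subfield ?G CC" by (rule field_gen_subfield)+
    have KF: "K \<subseteq> ?F" and FG: "?F \<subseteq> ?G" using field_gen_incl[of "K \<union> S"] field_gen_mono[of "K \<union> S" "K \<union> insert x S"] by auto
    have G: "?G = adjoin ?F x" unfolding adjoin_field_gen by (simp add: field_gen_insert)
    have "algebraic x" using insert.prems by (auto simp: Qbar_def)
    then obtain m where m: "is_minpoly ?F x m" using minpoly_exists_algebraic[OF sF] by blast
    note c = simple_extension_card[OF sF m, folded G]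
    have "finite (?B \<tau>) \<and> card (?B \<tau>) = k * Polynomial.degree m" if t: "\<tau> \<in> embeddings K" for \<tau>
    proof -
      have rr: "restrict (restrict \<sigma> ?F) K = restrict \<sigma> K" for \<sigma> :: "complex \<Rightarrow> complex"
        using KF by (simp add: Int_absorb1)
      have "?B \<tau> = (\<Union>\<sigma>'\<in>?A \<tau>. ?C \<sigma>')"
      proof
        show "?B \<tau> \<subseteq> (\<Union>\<sigma>'\<in>?A \<tau>. ?C \<sigma>')"
        proof
          fix \<sigma> assume s: "\<sigma> \<in> ?B \<tau>"
          then have "restrict \<sigma> ?F \<in> ?A \<tau>" using emb_restrict[OF sG _ sF FG] rr by (simp del: restrict_restrict)
          then show "\<sigma> \<in> (\<Union>\<sigma>'\<in>?A \<tau>. ?C \<sigma>')" using s by blast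
        qed
        show "(\<Union>\<sigma>'\<in>?A \<tau>. ?C \<sigma>') \<subseteq> ?B \<tau>"
        proof
          fix \<sigma> assume "\<sigma> \<in> (\<Union>\<sigma>'\<in>?A \<tau>. ?C \<sigma>')"
          then show "\<sigma> \<in> ?B \<tau>" using rr[of \<sigma>] by simp
        qed
      qed
      moreover have "finite (\<Union>\<sigma>'\<in>?A \<tau>. ?C \<sigma>')" using k(2)[OF t] c(1) by blast
      moreover have "card (\<Union>\<sigma>'\<in>?A \<tau>. ?C \<sigma>') = (\<Sum>\<sigma>'\<in>?A \<tau>. card (?C \<sigma>'))"
        using k(2)[OF t] c(1) by (intro card_UN_disjoint) blast+
      moreover have "(\<Sum>\<sigma>'\<in>?A \<tau>. card (?C \<sigma>')) = (\<Sum>\<sigma>'\<in>?A \<tau>. Polynomial.degree m)"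
        using c(2) by (intro sum.cong) blast+
      moreover have "\<dots> = k * Polynomial.degree m" by (simp only: sum_constant k(3)[OF t] of_nat_id)
      ultimately show ?thesis by (metis (no_types, lifting))
    qed
    moreover have "k * Polynomial.degree m > 0" using k(1) minpoly_degree_pos[OF m] by simp
    ultimately show ?case by blast
  qed
  then show thesis using that by blast
qed

text \<open>Number fields given by generators, the form in which embeddings are extended one generator at a
  time.\<close>

definition fin_gen_field :: "complex set \<Rightarrow> bool" where
  "fin_gen_field F \<longleftrightarrow> (\<exists>S. finite S \<and> S \<subseteq> Qbar \<and> F = field_gen S)"

lemma fin_gen_field_subfield: "fin_gen_field F \<Longrightarrow> subfield F CC"
  by (auto simp: fin_gen_field_def field_gen_subfield)

lemma map_poly_id_on_Rats: "m \<in> polys_over \<rat> \<Longrightarrow> map_poly (restrict id \<rat>) m = m"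
  by (rule poly_eqI) (auto simp: coeff_map_poly polys_over_def)

text \<open>The embeddings with \<open>\<sigma> \<alpha> = z\<close> are the extensions of the unique embedding of \<open>\<rat>(\<alpha>)\<close> that takes \<open>\<alpha>\<close>
  to \<open>z\<close>, and all embeddings of \<open>\<rat>(\<alpha>)\<close> have the same number of extensions.\<close>

lemma fin_gen_field_fibers:
  assumes F: "fin_gen_field F" and a: "\<alpha> \<in> F" and m: "is_minpoly \<rat> \<alpha> m"
  obtains k where "k > 0" "finite (embeddings F)"
    "\<And>\<sigma>. \<sigma> \<in> embeddings F \<Longrightarrow> poly m (\<sigma> \<alpha>) = 0"
    "\<And>z. poly m z = 0 \<Longrightarrow> card {\<sigma> \<in> embeddings F. \<sigma> \<alpha> = z} = k"
proof -
  obtain S where S: "finite S" "S \<subseteq> Qbar" "F = field_gen S" using F by (auto simp: fin_gen_field_def)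
  note sF = fin_gen_field_subfield[OF F]
  let ?E = "adjoin \<rat> \<alpha>"
  have sE: "subfield ?E CC" by (rule adjoin_subfield)
  have incl: "\<rat> \<subseteq> ?E" "\<alpha> \<in> ?E" by (auto simp: adjoin_gen intro: adjoin_incl[THEN subsetD])
  have EF: "?E \<subseteq> F" unfolding adjoin_field_gen using a sf_Rats[OF sF] by (intro field_gen_least sF) auto
  have F_eq: "F = field_gen (?E \<union> S)"
  proof
    show "F \<subseteq> field_gen (?E \<union> S)" unfolding S(3) by (rule field_gen_mono) auto
    show "field_gen (?E \<union> S) \<subseteq> F" using EF field_gen_incl[of S] S(3) by (intro field_gen_least sF) auto
  qed
  obtain k where k: "k > 0"
    "\<And>\<tau>. \<tau> \<in> embeddings ?E \<Longrightarrow> finite {\<sigma> \<in> embeddings F. restrict \<sigma> ?E = \<tau>}"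
    "\<And>\<tau>. \<tau> \<in> embeddings ?E \<Longrightarrow> card {\<sigma> \<in> embeddings F. restrict \<sigma> ?E = \<tau>} = k"
    using extension_fibers_same_card[OF sE S(1,2)] unfolding F_eq[symmetric] by blast
  have idQ: "restrict id \<rat> \<in> embeddings \<rat>" using embeddings_Rats by simp
  have mQ: "map_poly (restrict id \<rat>) m = m" using m map_poly_id_on_Rats by (simp add: is_minpoly_def)
  have rQ: "restrict \<sigma> \<rat> = restrict id \<rat>" if "\<sigma> \<in> embeddings H" "subfield H CC" for \<sigma> H
    using emb_restrict[OF that(2,1) subfield_Rats sf_Rats[OF that(2)]] embeddings_Rats by simp
  have finE: "finite (embeddings ?E)"
    by (rule finite_subset[OF _ simple_extension_card(1)[OF subfield_Rats m idQ]]) (blast intro: rQ[OF _ sE])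
  have root: "poly m (\<sigma> \<alpha>) = 0" if s: "\<sigma> \<in> embeddings F" for \<sigma>
    using emb_root_of_minpoly[OF subfield_Rats m sF sf_Rats[OF sF] a s] rQ[OF s sF] mQ by simp
  have card: "card {\<sigma> \<in> embeddings F. \<sigma> \<alpha> = z} = k" if z: "poly m z = 0" for z
  proof -
    obtain \<tau> where t: "\<tau> \<in> embeddings ?E" "\<tau> \<alpha> = z"
      using simple_extension_embedding_exists[OF subfield_Rats m idQ, of z] z unfolding mQ by blast
    have "{\<sigma> \<in> embeddings F. \<sigma> \<alpha> = z} = {\<sigma> \<in> embeddings F. restrict \<sigma> ?E = \<tau>}"
    proof safe
      fix \<sigma> assume s: "\<sigma> \<in> embeddings F" "z = \<sigma> \<alpha>"
      have s': "restrict \<sigma> ?E \<in> embeddings ?E" by (rule emb_restrict[OF sF s(1) sE EF])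
      show "restrict \<sigma> ?E = \<tau>"
        by (rule simple_extension_embedding_unique[OF subfield_Rats m s' t(1)])
           (use t(2) s(2) incl(2) in \<open>simp_all only: rQ[OF s' sE] rQ[OF t(1) sE], simp_all\<close>)
    next
      fix \<sigma> assume "\<sigma> \<in> embeddings F" "\<tau> = restrict \<sigma> ?E"
      then show "\<sigma> \<alpha> = z" using t incl by auto
    qed
    then show ?thesis using k(3)[OF t(1)] by simp
  qed
  have "embeddings F \<subseteq> (\<Union>\<tau>\<in>embeddings ?E. {\<sigma> \<in> embeddings F. restrict \<sigma> ?E = \<tau>})"
    using emb_restrict[OF sF _ sE EF] by blast
  then have "finite (embeddings F)" by (rule finite_subset) (use finE k(2) in auto)
  then show thesis using that k(1) root card by blast
qed

lemma minpoly_Rats_roots: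
  assumes m: "is_minpoly \<rat> \<alpha> m"
  shows "finite {z. poly m z = 0}" "card {z. poly m z = 0} = Polynomial.degree m"
    "m = (\<Prod>z|poly m z = 0. [:-z, 1:])"
proof -
  have "map_poly (restrict id \<rat>) m = m" using m map_poly_id_on_Rats by (simp add: is_minpoly_def)
  then have sq: "rsquarefree m"
    using minpoly_map_rsquarefree[OF subfield_Rats m, of "restrict id \<rat>"] embeddings_Rats by simp
  show "finite {z. poly m z = 0}" "card {z. poly m z = 0} = Polynomial.degree m"
    using rsquarefree_card_roots[OF sq] by auto
  show "m = (\<Prod>z|poly m z = 0. [:-z, 1:])"
    using complex_poly_decompose_rsquarefree[OF sq] m by (simp add: is_minpoly_def)
qed

text \<open>Every conjugate of \<open>\<alpha>\<close> occurs equally often. With linear factors for \<open>f\<close> this compares the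
  characteristic with the minimal polynomial, with absolute values it compares norms and heights in
  different fields.\<close>

lemma embeddings_prod:
  fixes f :: "complex \<Rightarrow> 'a :: comm_semiring_1"
  assumes F: "fin_gen_field F" and a: "\<alpha> \<in> F" and m: "is_minpoly \<rat> \<alpha> m"
  obtains k where "k > 0" "card (embeddings F) = k * Polynomial.degree m"
    "(\<Prod>\<sigma>\<in>embeddings F. f (\<sigma> \<alpha>)) = (\<Prod>z|poly m z = 0. f z) ^ k"
proof -
  obtain k where k: "k > 0" "finite (embeddings F)"
    "\<And>\<sigma>. \<sigma> \<in> embeddings F \<Longrightarrow> poly m (\<sigma> \<alpha>) = 0"
    "\<And>z. poly m z = 0 \<Longrightarrow> card {\<sigma> \<in> embeddings F. \<sigma> \<alpha> = z} = k"
    using fin_gen_field_fibers[OF assms] by blast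
  note fin = minpoly_Rats_roots(1)[OF m]
  have "(\<Prod>\<sigma>\<in>embeddings F. f (\<sigma> \<alpha>)) = (\<Prod>z|poly m z = 0. \<Prod>\<sigma>\<in>{\<sigma>\<in>embeddings F. \<sigma> \<alpha> = z}. f (\<sigma> \<alpha>))"
    using k by (intro prod.group[symmetric] fin) auto
  also have "\<dots> = (\<Prod>z|poly m z = 0. f z ^ k)"
    using k(4) by (intro prod.cong) auto
  finally have 1: "(\<Prod>\<sigma>\<in>embeddings F. f (\<sigma> \<alpha>)) = (\<Prod>z|poly m z = 0. f z) ^ k"
    by (simp add: prod_power_distrib)
  have "card (embeddings F) = (\<Sum>\<sigma>\<in>embeddings F. 1)" by simp
  also have "\<dots> = (\<Sum>z|poly m z = 0. \<Sum>\<sigma>\<in>{\<sigma>\<in>embeddings F. \<sigma> \<alpha> = z}. 1)"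
    using k by (intro sum.group[symmetric] fin) auto
  also have "\<dots> = (\<Sum>z|poly m z = 0. k)" using k(4) by (intro sum.cong) auto
  finally have "card (embeddings F) = k * Polynomial.degree m"
    using minpoly_Rats_roots(2)[OF m] by simp
  then show thesis using that k(1) 1 by blast
qed

lemma fin_gen_field_embeddings:
  assumes F: "fin_gen_field F" shows "finite (embeddings F)" "card (embeddings F) > 0"
proof -
  have "algebraic (0 :: complex)" by auto
  then obtain m where m: "is_minpoly \<rat> 0 m" using minpoly_exists_algebraic[OF subfield_Rats] by blast
  obtain k where "k > 0" "card (embeddings F) = k * Polynomial.degree m"
    using embeddings_prod[OF F sf_0[OF fin_gen_field_subfield[OF F]] m, of "\<lambda>_. (1::nat)"] by blast
  then show "card (embeddings F) > 0" using minpoly_degree_pos[OF m] by simp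
  then show "finite (embeddings F)" by (rule card_ge_0_finite)
qed

text \<open>Up to sign, the product is a power of the constant coefficient of the minimal polynomial.\<close>

lemma prod_embeddings_in_Rats:
  assumes F: "fin_gen_field F" and a: "\<alpha> \<in> F" "algebraic \<alpha>"
  shows "(\<Prod>\<sigma>\<in>embeddings F. \<sigma> \<alpha>) \<in> \<rat>"
proof -
  obtain m where m: "is_minpoly \<rat> \<alpha> m" using minpoly_exists_algebraic[OF subfield_Rats a(2)] by blast
  obtain k where k: "(\<Prod>\<sigma>\<in>embeddings F. - \<sigma> \<alpha>) = (\<Prod>z|poly m z = 0. - z) ^ k"
    using embeddings_prod[OF F a(1) m, of "\<lambda>z. - z"] by blast
  have "poly m 0 = (\<Prod>z|poly m z = 0. - z)"
    by (subst minpoly_Rats_roots(3)[OF m]) (simp add: poly_prod)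
  moreover have "poly m 0 \<in> \<rat>" using m by (intro poly_polys_over[OF subfield_Rats]) (auto simp: is_minpoly_def)
  ultimately have "(\<Prod>\<sigma>\<in>embeddings F. - \<sigma> \<alpha>) \<in> \<rat>" using k by simp
  then have "(-1) ^ card (embeddings F) * (\<Prod>\<sigma>\<in>embeddings F. - \<sigma> \<alpha>) \<in> \<rat>" by (intro Rats_mult Rats_power) auto
  moreover have "(-1) ^ card (embeddings F) * (\<Prod>\<sigma>\<in>embeddings F. - \<sigma> \<alpha>) = (\<Prod>\<sigma>\<in>embeddings F. \<sigma> \<alpha>)"
    by (simp add: prod_uminus flip: power_mult_distrib mult.assoc)
  ultimately show ?thesis by simp
qed

text \<open>The norm of a nonzero algebraic integer is a nonzero rational integer.\<close>

lemma norm_ge_1: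
  assumes F: "fin_gen_field F" and a: "\<alpha> \<in> F" "algebraic_int \<alpha>" "\<alpha> \<noteq> 0"
  shows "(\<Prod>\<sigma>\<in>embeddings F. cmod (\<sigma> \<alpha>)) \<ge> 1"
proof -
  note sF = fin_gen_field_subfield[OF F]
  let ?N = "\<Prod>\<sigma>\<in>embeddings F. \<sigma> \<alpha>"
  have "?N \<in> \<rat>" using prod_embeddings_in_Rats[OF F a(1)] a(2) by auto
  moreover have "algebraic_int ?N" using emb_algebraic_int[OF sF _ a(1,2)] by (intro algebraic_int_prod) auto
  ultimately have "?N \<in> \<int>" by (metis rational_algebraic_int_is_int)
  moreover have "?N \<noteq> 0" using emb_eq_0_iff[OF sF _ a(1)] a(3) fin_gen_field_embeddings[OF F] by auto
  ultimately have "cmod ?N \<ge> 1" by (auto elim!: Ints_cases simp: simp flip: of_int_abs)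
  then show ?thesis by (simp add: prod_norm)
qed

text \<open>The coefficients are rational, because the characteristic polynomial is a power of the minimal
  polynomial, and they are algebraic integers, because they are sums of products of conjugates.\<close>

lemma char_poly_integral:
  assumes F: "fin_gen_field F" and a: "\<alpha> \<in> F" "algebraic_int \<alpha>"
  shows "Polynomial.coeff (\<Prod>\<sigma>\<in>embeddings F. [:- \<sigma> \<alpha>, 1:]) i \<in> \<int>"
    "poly (\<Prod>\<sigma>\<in>embeddings F. [:- \<sigma> \<alpha>, 1:]) \<alpha> = 0"
proof -
  note sF = fin_gen_field_subfield[OF F]
  obtain m where m: "is_minpoly \<rat> \<alpha> m" using minpoly_exists_algebraic[OF subfield_Rats] a(2) by blast
  obtain k where k: "k > 0" "(\<Prod>\<sigma>\<in>embeddings F. [:- \<sigma> \<alpha>, 1:]) = (\<Prod>z|poly m z = 0. [:-z, 1:]) ^ k"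
    using embeddings_prod[OF F a(1) m, of "\<lambda>z. [:-z, 1:]"] by blast
  then have eq: "(\<Prod>\<sigma>\<in>embeddings F. [:- \<sigma> \<alpha>, 1:]) = m ^ k" using minpoly_Rats_roots(3)[OF m] by simp
  have "m ^ k \<in> polys_over \<rat>" using m by (auto simp: is_minpoly_def intro: polys_over_power[OF subfield_Rats])
  then have "Polynomial.coeff (\<Prod>\<sigma>\<in>embeddings F. [:- \<sigma> \<alpha>, 1:]) i \<in> \<rat>" by (simp add: eq polys_over_def)
  moreover have "algebraic_int (Polynomial.coeff (\<Prod>\<sigma>\<in>A. [:- \<sigma> \<alpha>, 1:]) i)"
    if "A \<subseteq> embeddings F" for A
  proof -
    have "finite A" using that fin_gen_field_embeddings[OF F] finite_subset by blast
    then show ?thesis using that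
    proof (induction A arbitrary: i)
      case (insert \<sigma> A)
      then have "algebraic_int (\<sigma> \<alpha>)" using emb_algebraic_int[OF sF _ a] by auto
      then show ?case using insert
        by (auto simp: coeff_pCons intro!: algebraic_int_diff algebraic_int_times split: nat.splits)
    qed (auto simp: coeff_1)
  qed
  ultimately show "Polynomial.coeff (\<Prod>\<sigma>\<in>embeddings F. [:- \<sigma> \<alpha>, 1:]) i \<in> \<int>"
    by (metis rational_algebraic_int_is_int subset_refl)
  show "poly (\<Prod>\<sigma>\<in>embeddings F. [:- \<sigma> \<alpha>, 1:]) \<alpha> = 0" using eq m k(1) by (simp add: is_minpoly_def)
qed

section \<open>Dimensions of field extensions\<close>

lemma CC_combine: "CC.combine Ks Us = (\<Sum>i<min (length Ks) (length Us). Ks ! i * Us ! i)"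
proof (induction Ks Us rule: CC.combine.induct)
  case (1 k Ks u Us)
  then show ?case by (simp add: sum.lessThan_Suc_shift del: sum.lessThan_Suc)
qed simp_all

lemma CC_independentI:
  assumes K: "subfield K CC"
    and ind: "\<And>c. (\<And>i. i < n \<Longrightarrow> c i \<in> K) \<Longrightarrow> (\<Sum>i<n. c i * v i) = 0 \<Longrightarrow> (\<forall>i<n. c i = 0)"
  shows "CC.independent K (map v [0..<n])"
proof (rule CC.trivial_combine_imp_independent[OF K])
  fix Ks assume Ks: "set Ks \<subseteq> K" "CC.combine Ks (map v [0..<n]) = \<zero>\<^bsub>CC\<^esub>"
  define c where "c i = (if i < length Ks then Ks ! i else 0)" for i
  have "(\<Sum>i<n. c i * v i) = (\<Sum>i<min (length Ks) n. c i * v i)"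
    by (rule sum.mono_neutral_right) (auto simp: c_def)
  also have "\<dots> = (\<Sum>i<min (length Ks) n. Ks ! i * map v [0..<n] ! i)"
    by (rule sum.cong) (auto simp: c_def)
  also have "\<dots> = 0" using Ks(2) by (simp add: CC_combine)
  finally have "\<forall>i<n. c i = 0"
    by (intro ind) (use Ks(1) sf_0[OF K] in \<open>auto simp: c_def\<close>)
  then have "Ks ! i = 0" if "i < n" "i < length Ks" for i
    using that by (auto simp: c_def dest: spec[of _ i])
  then show "set (take (length (map v [0..<n])) Ks) \<subseteq> {\<zero>\<^bsub>CC\<^esub>}"
    by (auto simp: in_set_conv_nth)
qed simp

lemma ext_degree_eqI: "subfield K CC \<Longrightarrow> CC.dimension n K E \<Longrightarrow> ext_degree K E = n"
  unfolding ext_degree_def by (simp add: CC.dimI[unfolded over_def])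

text \<open>The powers of \<open>\<theta>\<close> below the degree of the minimal polynomial form a basis.\<close>

lemma dimension_adjoin:
  assumes K: "subfield K CC" and m: "is_minpoly K \<theta> m"
  shows "CC.dimension (Polynomial.degree m) K (adjoin K \<theta>)"
proof -
  let ?n = "Polynomial.degree m" and ?v = "\<lambda>i. \<theta> ^ i"
  have m': "m \<in> polys_over K" "lead_coeff m = 1" "poly m \<theta> = 0" using m by (auto simp: is_minpoly_def)
  let ?Us = "map ?v [0..<?n]"
  have ind: "CC.independent K ?Us"
  proof (rule CC_independentI[OF K])
    fix c assume c: "\<And>i. i < ?n \<Longrightarrow> c i \<in> K" "(\<Sum>i<?n. c i * \<theta> ^ i) = 0"
    define g where "g = (\<Sum>i<?n. Polynomial.monom (c i) i)"
    have co: "Polynomial.coeff g j = (if j < ?n then c j else 0)" for j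
      by (auto simp: g_def coeff_sum)
    have "g \<in> polys_over K" using c(1) sf_0[OF K] by (auto simp: polys_over_def co)
    moreover have "poly g \<theta> = 0" using c(2) by (simp add: g_def poly_sum poly_monom)
    moreover have "Polynomial.degree g < ?n" using minpoly_degree_pos[OF m] co by (auto intro: degree_lessI)
    ultimately have "g = 0" using m by (auto simp: is_minpoly_def)
    then show "\<forall>i<?n. c i = 0" using co by (metis coeff_0)
  qed
  have "CC.Span K ?Us = adjoin K \<theta>"
  proof
    show "CC.Span K ?Us \<subseteq> adjoin K \<theta>"
    proof
      fix x assume "x \<in> CC.Span K ?Us"
      then obtain Ks where Ks: "set Ks \<subseteq> K" "length Ks = ?n" "x = CC.combine Ks ?Us"
        using CC.Span_mem_iff_length_version[OF K, of ?Us x] by auto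
      have "Ks ! i \<in> adjoin K \<theta>" if "i < ?n" for i
        using that Ks(1,2) adjoin_incl[of K \<theta>] by (metis nth_mem subset_iff)
      then show "x \<in> adjoin K \<theta>"
        unfolding Ks(3) CC_combine using Ks(2)
        by (intro sf_sum[OF adjoin_subfield] sf_mult[OF adjoin_subfield])
           (auto intro!: sf_power[OF adjoin_subfield] adjoin_gen)
    qed
    show "adjoin K \<theta> \<subseteq> CC.Span K ?Us"
    proof
      fix x assume "x \<in> adjoin K \<theta>"
      then obtain g where g: "g \<in> polys_over K" "x = poly g \<theta>" unfolding adjoin_eq_poly_values[OF K m] by auto
      obtain q r where qr: "q \<in> polys_over K" "r \<in> polys_over K" "g = q * m + r"
        "\<And>i. i \<ge> ?n \<Longrightarrow> Polynomial.coeff r i = 0"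
        using polys_over_division[OF K m'(1,2) g(1)] by blast
      define Ks where "Ks = map (Polynomial.coeff r) [0..<?n]"
      have "x = poly r \<theta>" using qr(3) m'(3) g(2) by simp
      also have "\<dots> = (\<Sum>i<?n. Polynomial.coeff r i * \<theta> ^ i)"
      proof -
        have "\<dots> = (\<Sum>i<max ?n (Suc (Polynomial.degree r)). Polynomial.coeff r i * \<theta> ^ i)"
          unfolding poly_altdef by (rule sum.mono_neutral_left) (auto simp: coeff_eq_0)
        also have "\<dots> = (\<Sum>i<?n. Polynomial.coeff r i * \<theta> ^ i)"
          by (rule sum.mono_neutral_right) (auto simp: qr(4))
        finally show ?thesis .
      qed
      also have "\<dots> = CC.combine Ks ?Us" by (simp add: CC_combine Ks_def)
      finally have "x = CC.combine Ks ?Us" .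
      moreover have "set Ks \<subseteq> K" using qr(2) by (auto simp: Ks_def polys_over_def)
      moreover have "length Ks = length ?Us" by (simp add: Ks_def)
      moreover have carr: "set ?Us \<subseteq> carrier CC" by simp
      ultimately show "x \<in> CC.Span K ?Us" unfolding CC.Span_mem_iff_length_version[OF K carr] by blast
    qed
  qed
  with CC.dimensionI[OF K ind] show ?thesis by simp
qed

lemma ext_degree_adjoin:
  "subfield K CC \<Longrightarrow> is_minpoly K \<theta> m \<Longrightarrow> ext_degree K (adjoin K \<theta>) = Polynomial.degree m"
  by (rule ext_degree_eqI) (auto intro: dimension_adjoin)

context
  fixes K :: "complex set"
  assumes K: "number_field K"
begin

lemma number_field_subfield: "subfield K CC" and number_field_algebraic: "x \<in> K \<Longrightarrow> algebraic x"
  using K by (auto simp: number_field_def subfield_Qbar_def Qbar_def)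

lemma number_field_dimension: "CC.dimension (ext_degree \<rat> K) \<rat> K"
  using K unfolding number_field_def ext_degree_def
  by (metis CC.finite_dimension_def CC.dimI[unfolded over_def] subfield_Rats)

lemma number_field_spanning:
  obtains n v where "\<And>i. i < n \<Longrightarrow> v i \<in> K" "\<And>x. x \<in> K \<Longrightarrow> \<exists>c. (\<forall>i<n. c i \<in> \<rat>) \<and> x = (\<Sum>i<(n::nat). c i * v i)"
proof -
  obtain Us where Us: "set Us \<subseteq> carrier CC" "CC.independent \<rat> Us" "CC.Span \<rat> Us = K"
    using CC.exists_base[OF subfield_Rats number_field_dimension] by blast
  have "set Us \<subseteq> K" using CC.Span_base_incl[OF subfield_Rats Us(1)] Us(3) by simp
  moreover have "\<exists>c. (\<forall>i<length Us. c i \<in> \<rat>) \<and> x = (\<Sum>i<length Us. c i * Us ! i)" if "x \<in> K" for x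
  proof -
    have "x \<in> CC.Span \<rat> Us" using that by (simp only: Us(3))
    then obtain Ks where "set Ks \<subseteq> \<rat>" "length Ks = length Us" "x = CC.combine Ks Us"
      unfolding CC.Span_mem_iff_length_version[OF subfield_Rats Us(1)] by blast
    then show ?thesis by (intro exI[of _ "(!) Ks"]) (auto simp: CC_combine)
  qed
  moreover have "Us ! i \<in> K" if "i < length Us" for i
    using that \<open>set Us \<subseteq> K\<close> by (metis nth_mem subset_iff)
  ultimately show thesis using that[of "length Us" "(!) Us"] by blast
qed

lemma number_field_fin_gen: "fin_gen_field K"
proof -
  obtain n v where v: "\<And>i. i < n \<Longrightarrow> v i \<in> K" "\<And>x. x \<in> K \<Longrightarrow> \<exists>c. (\<forall>i<n. c i \<in> \<rat>) \<and> x = (\<Sum>i<(n::nat). c i * v i)"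
    using number_field_spanning by blast
  have "K = field_gen (v ` {..<n})"
  proof
    show "field_gen (v ` {..<n}) \<subseteq> K" using v(1) by (intro field_gen_least number_field_subfield) auto
    show "K \<subseteq> field_gen (v ` {..<n})"
    proof
      fix x assume "x \<in> K"
      then obtain c where c: "\<forall>i<n. c i \<in> \<rat>" "x = (\<Sum>i<n. c i * v i)" using v(2) by blast
      show "x \<in> field_gen (v ` {..<n})"
        unfolding c(2) using c(1) sf_Rats[OF field_gen_subfield] field_gen_incl[of "v ` {..<n}"]
        by (intro sf_sum[OF field_gen_subfield] sf_mult[OF field_gen_subfield]) auto
    qed
  qed
  moreover have "v ` {..<n} \<subseteq> Qbar" using v(1) number_field_algebraic by (auto simp: Qbar_def)
  ultimately show ?thesis unfolding fin_gen_field_def by blast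
qed

lemma number_field_independent_le:
  assumes v: "\<And>i. i < r \<Longrightarrow> v i \<in> K"
    and ind: "\<And>c. (\<And>i. i < r \<Longrightarrow> c i \<in> \<rat>) \<Longrightarrow> (\<Sum>i<r. c i * v i) = 0 \<Longrightarrow> (\<forall>i<r. c i = 0)"
  shows "r \<le> ext_degree \<rat> K"
proof -
  have "CC.independent \<rat> (map v [0..<r])" by (rule CC_independentI[OF subfield_Rats]) (use ind in blast)
  then have "length (map v [0..<r]) \<le> ext_degree \<rat> K"
    by (rule CC.independent_length_le_dimension[OF subfield_Rats number_field_dimension]) (use v in auto)
  then show ?thesis by simp
qed

text \<open>An element with pairwise distinct conjugates exists because a polynomial in \<open>t\<close> separating two
  embeddings has only finitely many roots; its powers are independent over the rationals.\<close>

lemma card_embeddings_le_degree: "card (embeddings K) \<le> ext_degree \<rat> K"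
proof -
  note sK = number_field_subfield
  note fin = fin_gen_field_embeddings[OF number_field_fin_gen]
  obtain n v where v: "\<And>i. i < n \<Longrightarrow> v i \<in> K" "\<And>x. x \<in> K \<Longrightarrow> \<exists>c. (\<forall>i<n. c i \<in> \<rat>) \<and> x = (\<Sum>i<(n::nat). c i * v i)"
    using number_field_spanning by blast
  define P where "P \<sigma> \<sigma>' = (\<Sum>i<n. Polynomial.monom (\<sigma> (v i) - \<sigma>' (v i)) i)" for \<sigma> \<sigma>' :: "complex \<Rightarrow> complex"
  define B where "B = (\<Union>(\<sigma>,\<sigma>')\<in>{p \<in> embeddings K \<times> embeddings K. P (fst p) (snd p) \<noteq> 0}. {t. poly (P \<sigma> \<sigma>') t = 0})"
  have "finite B" unfolding B_def using fin by (auto intro!: finite_UN_I poly_roots_finite)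
  moreover have "infinite (range (of_nat :: nat \<Rightarrow> complex))" by (simp add: range_inj_infinite inj_of_nat)
  ultimately obtain t :: nat where t: "of_nat t \<notin> B" by (metis finite_subset image_subset_iff)
  define x where "x = (\<Sum>i<n. of_nat t ^ i * v i)"
  have xK: "x \<in> K" unfolding x_def using v(1)
    by (auto intro!: sf_sum[OF sK] sf_mult[OF sK] sf_power[OF sK] sf_of_nat[OF sK])
  have sx: "\<sigma> x = (\<Sum>i<n. of_nat t ^ i * \<sigma> (v i))" if s: "\<sigma> \<in> embeddings K" for \<sigma>
    unfolding x_def using v(1)
    by (subst emb_sum[OF sK s])
       (auto simp: emb_mult[OF sK s] emb_power[OF sK s] emb_of_nat[OF sK s] sf_power[OF sK] sf_of_nat[OF sK] sf_mult[OF sK])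
  have inj: "inj_on (\<lambda>\<sigma>. \<sigma> x) (embeddings K)"
  proof (rule inj_onI, rule ccontr)
    fix \<sigma> \<sigma>' assume s: "\<sigma> \<in> embeddings K" "\<sigma>' \<in> embeddings K" "\<sigma> x = \<sigma>' x" "\<sigma> \<noteq> \<sigma>'"
    have "poly (P \<sigma> \<sigma>') (of_nat t) = \<sigma> x - \<sigma>' x"
      by (simp add: P_def sx[OF s(1)] sx[OF s(2)] poly_sum poly_monom algebra_simps sum_subtractf)
    then have "poly (P \<sigma> \<sigma>') (of_nat t) = 0" using s by simp
    moreover have "P \<sigma> \<sigma>' \<noteq> 0"
    proof
      assume "P \<sigma> \<sigma>' = 0"
      then have "\<sigma> (v i) = \<sigma>' (v i)" if "i < n" for i
        using that by (auto simp: P_def coeff_sum poly_eq_iff dest: spec[of _ i])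
      then have "\<sigma> y = \<sigma>' y" if y: "y \<in> K" for y
      proof -
        obtain c where c: "\<forall>i<n. c i \<in> \<rat>" "y = (\<Sum>i<n. c i * v i)" using v(2)[OF y] by blast
        have cK: "c i \<in> K" if "i < n" for i using c(1) sf_Rats[OF sK] that by auto
        have eq: "\<sigma> y = (\<Sum>i<n. c i * \<sigma> (v i))" if s: "\<sigma> \<in> embeddings K" for \<sigma>
          unfolding c(2) using v(1) c(1) cK
          by (subst emb_sum[OF sK s]) (auto simp: emb_mult[OF sK s] emb_Rats[OF sK s] sf_mult[OF sK])
        show ?thesis unfolding eq[OF s(1)] eq[OF s(2)]
          by (rule sum.cong) (use \<open>\<And>i. i < n \<Longrightarrow> \<sigma> (v i) = \<sigma>' (v i)\<close> in simp_all)
      qed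
      then show False using embeddings_eqI[OF s(1,2)] s(4) by blast
    qed
    ultimately show False using t s by (auto simp: B_def)
  qed
  let ?N = "card (embeddings K)"
  show ?thesis
  proof (rule number_field_independent_le[of ?N "\<lambda>i. x ^ i"])
    fix c assume c: "\<And>i. i < ?N \<Longrightarrow> c i \<in> \<rat>" "(\<Sum>i<?N. c i * x ^ i) = 0"
    define g where "g = (\<Sum>i<?N. Polynomial.monom (c i) i)"
    have co: "Polynomial.coeff g j = (if j < ?N then c j else 0)" for j
      by (auto simp: g_def coeff_sum)
    have g0: "poly g (\<sigma> x) = 0" if s: "\<sigma> \<in> embeddings K" for \<sigma>
    proof -
      have cK: "c i \<in> K" if "i < ?N" for i using c(1) sf_Rats[OF sK] that by auto
      have "poly g (\<sigma> x) = (\<Sum>i<?N. c i * \<sigma> x ^ i)" by (simp add: g_def poly_sum poly_monom)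
      also have "\<dots> = \<sigma> (\<Sum>i<?N. c i * x ^ i)" using cK xK c(1)
        by (subst emb_sum[OF sK s]) (auto simp: emb_mult[OF sK s] emb_power[OF sK s] emb_Rats[OF sK s] sf_mult[OF sK] sf_power[OF sK])
      finally show ?thesis using c(2) emb_0[OF sK s] by simp
    qed
    have "g = 0"
    proof (rule ccontr)
      assume g: "g \<noteq> 0"
      have "?N = card ((\<lambda>\<sigma>. \<sigma> x) ` embeddings K)" by (simp add: card_image inj)
      also have "\<dots> \<le> card {z. poly g z = 0}" using g0 g by (intro card_mono poly_roots_finite) auto
      also have "\<dots> \<le> Polynomial.degree g" using g by (rule card_poly_roots_bound)
      also have "\<dots> < ?N" using fin(2) co by (auto intro: degree_lessI)
      finally show False by simp
    qed
    then show "\<forall>i<?N. c i = 0" using co by (metis coeff_0)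
  qed (use xK in \<open>auto intro: sf_power[OF sK]\<close>)
qed

end

section \<open>Counting algebraic integers with bounded conjugates\<close>

text \<open>A further linear factor replaces each coefficient by its left neighbour minus a root times the
  coefficient itself, and each of the two terms is at most half of the new bound.\<close>

lemma coeff_prod_linear_bound:
  fixes z :: "nat \<Rightarrow> complex"
  assumes "B \<ge> 1" "\<And>i. i < n \<Longrightarrow> cmod (z i) \<le> B"
  shows "cmod (Polynomial.coeff (\<Prod>i<n. [:- z i, 1:]) j) \<le> 2 ^ n * B ^ (n - j)"
  using assms(2)
proof (induction n arbitrary: j)
  case 0
  then show ?case by (simp add: coeff_1)
next
  case (Suc n)
  let ?p = "\<Prod>i<n. [:- z i, 1:]"
  have IH: "cmod (Polynomial.coeff ?p j) \<le> 2 ^ n * B ^ (n - j)" for j using Suc by auto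
  have zn: "cmod (z n) \<le> B" using Suc by auto
  have deg: "Polynomial.degree ?p \<le> n"
    by (rule order_trans[OF degree_prod_sum_le]) auto
  have eq: "(\<Prod>i<Suc n. [:- z i, 1:]) = pCons 0 ?p - smult (z n) ?p" by (simp add: algebra_simps)
  have 1: "cmod (z n * Polynomial.coeff ?p j) \<le> 2 ^ n * B ^ (Suc n - j)"
  proof (cases "j \<le> n")
    case True
    have "cmod (z n * Polynomial.coeff ?p j) \<le> B * (2 ^ n * B ^ (n - j))"
      unfolding norm_mult using zn IH[of j] assms(1) by (intro mult_mono) auto
    then show ?thesis using True by (simp add: Suc_diff_le mult_ac)
  next
    case False
    then show ?thesis using deg assms(1) by (simp add: coeff_eq_0)
  qed
  have 2: "cmod (Polynomial.coeff (pCons 0 ?p) j) \<le> 2 ^ n * B ^ (Suc n - j)"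
    using IH assms(1) by (cases j) (auto simp: coeff_pCons)
  have "cmod (Polynomial.coeff (\<Prod>i<Suc n. [:- z i, 1:]) j) \<le> cmod (Polynomial.coeff (pCons 0 ?p) j) + cmod (z n * Polynomial.coeff ?p j)"
    unfolding eq by (simp add: norm_triangle_ineq4)
  also have "\<dots> \<le> 2 ^ Suc n * B ^ (Suc n - j)" using 1 2 by simp
  finally show ?case .
qed

text \<open>Roots of monic integral polynomials of degree \<open>n\<close> all of whose roots are bounded by \<open>B\<close>. The
  polynomial may be reducible, so that the characteristic polynomial in a field of degree \<open>n\<close> can be
  used for elements of smaller degree.\<close>

definition bounded_integers :: "nat \<Rightarrow> real \<Rightarrow> complex set" where
  "bounded_integers n B = {x. \<exists>z. (\<forall>i<n. cmod (z i) \<le> B) \<and>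
     (\<forall>j. Polynomial.coeff (\<Prod>i<n. [:- z i, 1:]) j \<in> \<int>) \<and> poly (\<Prod>i<n. [:- z i, 1:]) x = 0}"

text \<open>The coefficient of degree \<open>j\<close> is an integer bounded by a constant times \<open>B ^ (n - j)\<close>, and the
  exponents \<open>n - j\<close> add up to \<open>n * (n + 1) div 2\<close>.\<close>

lemma bounded_integers_count:
  assumes B: "B \<ge> 1"
  shows "finite (bounded_integers n B)"
    "real (card (bounded_integers n B)) \<le> real n * (3 * 2 ^ n) ^ n * B ^ (n * (n + 1) div 2)"
proof -
  define J where "J j = {-\<lfloor>2 ^ n * B ^ (n - j)\<rfloor>..\<lfloor>2 ^ n * B ^ (n - j)\<rfloor>}" for j
  define poly_of :: "(nat \<Rightarrow> int) \<Rightarrow> complex poly" where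
    "poly_of c = (\<Sum>j<n. Polynomial.monom (of_int (c j)) j) + Polynomial.monom 1 n" for c
  have co: "Polynomial.coeff (poly_of c) j = (if j < n then of_int (c j) else if j = n then 1 else 0)" for c j
    by (auto simp: poly_of_def coeff_sum)
  have nz: "poly_of c \<noteq> 0" and deg: "Polynomial.degree (poly_of c) = n" for c
  proof -
    have "Polynomial.coeff (poly_of c) n = 1" by (simp add: co)
    then show "poly_of c \<noteq> 0" by auto
    have "Polynomial.degree (poly_of c) \<le> n" by (rule degree_le) (simp add: co)
    moreover have "n \<le> Polynomial.degree (poly_of c)" by (rule le_degree) (simp add: co)
    ultimately show "Polynomial.degree (poly_of c) = n" by simp
  qed
  let ?C = "PiE {..<n} J"
  have finC: "finite ?C" by (intro finite_PiE) (auto simp: J_def)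
  have sub: "bounded_integers n B \<subseteq> (\<Union>c\<in>?C. {x. poly (poly_of c) x = 0})"
  proof
    fix x assume "x \<in> bounded_integers n B"
    then obtain z where z: "\<And>i. i < n \<Longrightarrow> cmod (z i) \<le> B" "\<And>j. Polynomial.coeff (\<Prod>i<n. [:- z i, 1:]) j \<in> \<int>"
      "poly (\<Prod>i<n. [:- z i, 1:]) x = 0" by (auto simp: bounded_integers_def)
    let ?p = "\<Prod>i<n. [:- z i, 1:]"
    have "\<forall>j. \<exists>c. Polynomial.coeff ?p j = of_int c" using z(2) by (meson Ints_cases)
    then obtain c where c: "\<And>j. Polynomial.coeff ?p j = of_int (c j)" by metis
    have degp: "Polynomial.degree ?p = n" by (subst degree_prod_eq_sum_degree) auto
    have "lead_coeff ?p = 1" by (simp add: lead_coeff_prod)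
    then have cn: "Polynomial.coeff ?p n = 1" by (simp add: degp)
    have e: "?p = poly_of (restrict c {..<n})"
    proof (rule poly_eqI)
      fix j
      consider "j < n" | "j = n" | "j > n" by linarith
      then show "Polynomial.coeff ?p j = Polynomial.coeff (poly_of (restrict c {..<n})) j"
      proof cases
        case 1 then show ?thesis by (simp only: c co) simp
      next
        case 2 then show ?thesis by (simp only: cn co) simp
      next
        case 3 then show ?thesis using coeff_eq_0[of ?p j] degp by (simp add: co)
      qed
    qed
    have m: "restrict c {..<n} \<in> ?C"
    proof (rule PiE_I)
      fix j
      have "\<bar>real_of_int (c j)\<bar> \<le> 2 ^ n * B ^ (n - j)"
        using coeff_prod_linear_bound[of B n z j, OF B z(1)] unfolding c by (simp flip: of_int_abs)
      then have "\<bar>c j\<bar> \<le> \<lfloor>2 ^ n * B ^ (n - j)\<rfloor>" unfolding le_floor_iff by simp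
      then show "restrict c {..<n} j \<in> J j" if "j \<in> {..<n}"
        using that by (simp add: J_def abs_le_iff)
    qed simp
    show "x \<in> (\<Union>c\<in>?C. {x. poly (poly_of c) x = 0})"
      by (rule UN_I[OF m]) (use z(3) in \<open>simp only: e mem_Collect_eq\<close>)
  qed
  have finR: "finite (\<Union>c\<in>?C. {x. poly (poly_of c) x = 0})"
    using finC nz by (auto intro!: poly_roots_finite)
  show "finite (bounded_integers n B)" using finite_subset[OF sub finR] .
  have "card (bounded_integers n B) \<le> card (\<Union>c\<in>?C. {x. poly (poly_of c) x = 0})"
    by (rule card_mono[OF finR sub])
  also have "\<dots> \<le> (\<Sum>c\<in>?C. card {x. poly (poly_of c) x = 0})" by (rule card_UN_le[OF finC])
  also have "\<dots> \<le> (\<Sum>c\<in>?C. n)" using card_poly_roots_bound[OF nz] deg by (intro sum_mono) metis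
  also have "\<dots> = n * card ?C" by simp
  finally have 1: "card (bounded_integers n B) \<le> n * card ?C" .
  have Jc: "real (card (J j)) \<le> 3 * 2 ^ n * B ^ (n - j)" for j
  proof -
    define M where "M = 2 ^ n * B ^ (n - j)"
    have "1 * 1 \<le> 2 ^ n * B ^ (n - j)" using B by (intro mult_mono one_le_power) auto
    then have M: "M \<ge> 1" by (simp add: M_def)
    then have M': "\<lfloor>M\<rfloor> \<ge> 0" "real_of_int \<lfloor>M\<rfloor> \<le> M" by linarith+
    have "J j = {- \<lfloor>M\<rfloor>..\<lfloor>M\<rfloor>}" unfolding J_def M_def ..
    then have "real (card (J j)) = 2 * real_of_int \<lfloor>M\<rfloor> + 1" using M'(1) by simp
    also have "\<dots> \<le> 3 * M" using M M'(2) by linarith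
    also have "\<dots> = 3 * 2 ^ n * B ^ (n - j)" by (simp add: M_def)
    finally show ?thesis .
  qed
  have "real (card ?C) = (\<Prod>j<n. real (card (J j)))" by (simp add: card_PiE)
  also have "\<dots> \<le> (\<Prod>j<n. 3 * 2 ^ n * B ^ (n - j))" using Jc by (intro prod_mono) auto
  also have "\<dots> = (3 * 2 ^ n) ^ n * (\<Prod>j<n. B ^ (n - j))" by (simp add: prod.distrib)
  also have "(\<Prod>j<n. B ^ (n - j)) = B ^ (\<Sum>j<n. n - j)" by (simp add: power_sum)
  also have "(\<Sum>j<n. n - j) = n * (n + 1) div 2"
  proof -
    have "(\<Sum>j<n. n - j) = (\<Sum>j\<in>{1..n}. j)"
      by (rule sum.reindex_bij_witness[of _ "\<lambda>j. n - j" "\<lambda>j. n - j"]) auto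
    also have "\<dots> = n * (n + 1) div 2" by (simp add: Sum_Icc_nat)
    finally show ?thesis .
  qed
  finally have 2: "real (card ?C) \<le> (3 * 2 ^ n) ^ n * B ^ (n * (n + 1) div 2)" .
  have "real (card (bounded_integers n B)) \<le> real n * real (card ?C)"
    using 1 by (simp flip: of_nat_mult)
  also have "\<dots> \<le> real n * ((3 * 2 ^ n) ^ n * B ^ (n * (n + 1) div 2))" using 2 by (intro mult_left_mono) auto
  finally show "real (card (bounded_integers n B)) \<le> real n * (3 * 2 ^ n) ^ n * B ^ (n * (n + 1) div 2)"
    by (simp add: mult_ac)
qed

lemma mem_bounded_integers:
  assumes F: "fin_gen_field F" and a: "\<alpha> \<in> F" "algebraic_int \<alpha>"
    and B: "\<And>\<sigma>. \<sigma> \<in> embeddings F \<Longrightarrow> cmod (\<sigma> \<alpha>) \<le> B"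
  shows "\<alpha> \<in> bounded_integers (card (embeddings F)) B"
proof -
  obtain h where h: "bij_betw h {..<card (embeddings F)} (embeddings F)"
    using ex_bij_betw_nat_finite[OF fin_gen_field_embeddings(1)[OF F]] by (auto simp: atLeast0LessThan)
  have eq: "(\<Prod>i<card (embeddings F). [:- h i \<alpha>, 1:]) = (\<Prod>\<sigma>\<in>embeddings F. [:- \<sigma> \<alpha>, 1:])"
    by (rule prod.reindex_bij_betw[OF h, of "\<lambda>\<sigma>. [:- \<sigma> \<alpha>, 1:]"])
  show ?thesis unfolding bounded_integers_def
    by (intro CollectI exI[of _ "\<lambda>i. h i \<alpha>"])
       (use eq char_poly_integral[OF F a] B bij_betwE[OF h] in auto)
qed

section \<open>Reduced bases of rings of integers\<close>

text \<open>The standard Hermitian product and squared norm of vectors indexed by \<open>I\<close>.\<close>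

definition cip :: "'s set \<Rightarrow> ('s \<Rightarrow> complex) \<Rightarrow> ('s \<Rightarrow> complex) \<Rightarrow> complex" where
  "cip I u v = (\<Sum>s\<in>I. u s * cnj (v s))"

definition sqn :: "'s set \<Rightarrow> ('s \<Rightarrow> complex) \<Rightarrow> real" where
  "sqn I u = (\<Sum>s\<in>I. (cmod (u s))\<^sup>2)"

lemma cip_self: "cip I u u = of_real (sqn I u)"
  unfolding cip_def sqn_def of_real_sum by (rule sum.cong) (simp_all only: complex_norm_square)

lemma cip_diff_left: "cip I (\<lambda>s. u s - c * w s) v = cip I u v - c * cip I w v"
  by (simp add: cip_def algebra_simps sum_subtractf sum_distrib_left)

lemma cip_diff_right: "cip I u (\<lambda>s. v s - of_real c * w s) = cip I u v - of_real c * cip I u w"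
  by (simp add: cip_def algebra_simps sum_subtractf sum_distrib_left)

lemma cip_commute: "cip I v u = cnj (cip I u v)"
  by (simp add: cip_def mult.commute)

lemma sqn_nonneg: "sqn I u \<ge> 0"
  by (simp add: sqn_def sum_nonneg)

lemma sqn_eq_0_iff: "finite I \<Longrightarrow> sqn I u = 0 \<longleftrightarrow> (\<forall>s\<in>I. u s = 0)"
  by (simp add: sqn_def sum_nonneg_eq_0_iff)

lemma norm_le_sqn: "finite I \<Longrightarrow> s \<in> I \<Longrightarrow> (cmod (u s))\<^sup>2 \<le> sqn I u"
  unfolding sqn_def by (rule member_le_sum) auto

text \<open>The map \<open>P\<close> is the composition of \<open>\<Phi>\<close> with an orthogonal projection; it takes the group \<open>G\<close>
  to a lattice on which the Hermitian product is real. Reality allows the coefficients of a projection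
  to be rounded to integers, and discreteness provides shortest vectors.\<close>

definition lattice_proj :: "'s set \<Rightarrow> complex set \<Rightarrow> (complex \<Rightarrow> 's \<Rightarrow> complex) \<Rightarrow> (complex \<Rightarrow> 's \<Rightarrow> complex) \<Rightarrow> bool" where
  "lattice_proj I G \<Phi> P \<longleftrightarrow> finite I \<and> 0 \<in> G \<and> (\<forall>x\<in>G. \<forall>y\<in>G. x + y \<in> G \<and> x - y \<in> G) \<and>
     (\<forall>x s. s \<notin> I \<longrightarrow> P x s = 0) \<and>
     (\<forall>x\<in>G. \<forall>y\<in>G. \<forall>s. P (x + y) s = P x s + P y s) \<and>
     (\<forall>x\<in>G. \<forall>y\<in>G. cip I (P x) (P y) \<in> \<real>) \<and>
     (\<forall>x\<in>G. \<forall>y\<in>G. cip I (\<Phi> x) (P y) = cip I (P x) (P y)) \<and>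
     (\<forall>B. finite (P ` {x\<in>G. sqn I (P x) \<le> B}))"

definition proj_coeff :: "'s set \<Rightarrow> (complex \<Rightarrow> 's \<Rightarrow> complex) \<Rightarrow> complex \<Rightarrow> complex \<Rightarrow> real" where
  "proj_coeff I P b x = Re (cip I (P x) (P b)) / sqn I (P b)"

definition proj_away :: "'s set \<Rightarrow> (complex \<Rightarrow> 's \<Rightarrow> complex) \<Rightarrow> complex \<Rightarrow> complex \<Rightarrow> 's \<Rightarrow> complex" where
  "proj_away I P b x = (\<lambda>s. P x s - of_real (proj_coeff I P b x) * P b s)"

context
  fixes I :: "'s set" and G \<Phi> P
  assumes L: "lattice_proj I G \<Phi> P"
begin

lemma lp_fin: "finite I" and lp_0: "0 \<in> G"
  and lp_add_mem: "x \<in> G \<Longrightarrow> y \<in> G \<Longrightarrow> x + y \<in> G" and lp_diff_mem: "x \<in> G \<Longrightarrow> y \<in> G \<Longrightarrow> x - y \<in> G"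
  and lp_outside: "s \<notin> I \<Longrightarrow> P x s = 0"
  and lp_add: "x \<in> G \<Longrightarrow> y \<in> G \<Longrightarrow> P (x + y) s = P x s + P y s"
  and lp_real: "x \<in> G \<Longrightarrow> y \<in> G \<Longrightarrow> cip I (P x) (P y) \<in> \<real>"
  and lp_adj: "x \<in> G \<Longrightarrow> y \<in> G \<Longrightarrow> cip I (\<Phi> x) (P y) = cip I (P x) (P y)"
  and lp_discrete: "finite (P ` {x\<in>G. sqn I (P x) \<le> B})"
  using L unfolding lattice_proj_def by blast+

lemma lp_P0: "P 0 s = 0"
  using lp_add[OF lp_0 lp_0, of s] by simp

lemma lp_diff: "x \<in> G \<Longrightarrow> y \<in> G \<Longrightarrow> P (x - y) s = P x s - P y s"
  using lp_add[OF lp_diff_mem, of x y y s] by simp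

lemma lp_nat_mult: "x \<in> G \<Longrightarrow> of_nat k * x \<in> G \<and> P (of_nat k * x) s = of_nat k * P x s"
proof (induction k)
  case 0
  then show ?case by (simp add: lp_0 lp_P0)
next
  case (Suc k)
  then show ?case using lp_add[of "of_nat k * x" x s] lp_add_mem[of "of_nat k * x" x] by (simp add: algebra_simps)
qed

lemma lp_int_mult: "x \<in> G \<Longrightarrow> of_int k * x \<in> G \<and> P (of_int k * x) s = of_int k * P x s"
proof (cases k rule: int_cases2)
  case (nonneg n)
  assume "x \<in> G" then show ?thesis using lp_nat_mult[of x n s] nonneg by simp
next
  case (nonpos n)
  assume x: "x \<in> G"
  then show ?thesis using lp_nat_mult[of x n s] lp_diff[OF lp_0, of "of_nat n * x" s] lp_diff_mem[OF lp_0, of "of_nat n * x"]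
      nonpos by (simp add: lp_P0)
qed

lemma lp_sqn_eq_0: "sqn I (P x) = 0 \<longleftrightarrow> P x = (\<lambda>_. 0)"
  using sqn_eq_0_iff[OF lp_fin, of "P x"] lp_outside by (auto simp: fun_eq_iff)

context
  fixes b
  assumes b: "b \<in> G" "P b \<noteq> (\<lambda>_. 0)"
begin

private abbreviation "Q \<equiv> proj_away I P b"
private abbreviation "tc \<equiv> proj_coeff I P b"

lemma lp_sqn_pos: "sqn I (P b) > 0"
  using lp_sqn_eq_0[of b] b(2) sqn_nonneg[of I "P b"] by (auto simp: less_le)

lemma lp_cip_b: "x \<in> G \<Longrightarrow> cip I (P x) (P b) = of_real (tc x * sqn I (P b))"
  using lp_real[OF _ b(1), of x] lp_sqn_pos by (simp add: proj_coeff_def of_real_Re)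

lemma tc_add: "x \<in> G \<Longrightarrow> y \<in> G \<Longrightarrow> tc (x + y) = tc x + tc y"
proof -
  assume "x \<in> G" "y \<in> G"
  then have "cip I (P (x + y)) (P b) = cip I (P x) (P b) + cip I (P y) (P b)"
    by (simp add: cip_def lp_add algebra_simps sum.distrib)
  then show ?thesis by (simp add: proj_coeff_def add_divide_distrib)
qed

lemma proj_orth: "x \<in> G \<Longrightarrow> cip I (Q x) (P b) = 0"
  unfolding proj_away_def cip_diff_left by (simp add: lp_cip_b cip_self)

lemma proj_cip: "x \<in> G \<Longrightarrow> y \<in> G \<Longrightarrow> cip I (Q x) (Q y) = cip I (P x) (P y) - of_real (tc y * tc x * sqn I (P b))"
proof -
  assume xy: "x \<in> G" "y \<in> G"
  have "cip I (Q x) (Q y) = cip I (Q x) (P y) - of_real (tc y) * cip I (Q x) (P b)"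
    by (subst (2) proj_away_def) (rule cip_diff_right)
  also have "\<dots> = cip I (P x) (P y) - of_real (tc x) * cip I (P b) (P y)"
    unfolding proj_orth[OF xy(1)] by (simp add: proj_away_def cip_diff_left)
  also have "cip I (P b) (P y) = of_real (tc y * sqn I (P b))"
    using lp_cip_b[OF xy(2)] by (subst cip_commute) simp
  finally show ?thesis by (simp add: mult_ac)
qed

lemma proj_pythagoras: "x \<in> G \<Longrightarrow> sqn I (P x) = sqn I (Q x) + (tc x)\<^sup>2 * sqn I (P b)"
proof -
  assume "x \<in> G"
  from proj_cip[OF this this] have "complex_of_real (sqn I (Q x)) = of_real (sqn I (P x) - tc x * tc x * sqn I (P b))"
    by (simp add: cip_self)
  then show ?thesis unfolding of_real_eq_iff by (simp add: power2_eq_square)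
qed

lemma proj_shift:
  assumes x: "x \<in> G"
  shows "x - of_int k * b \<in> G" "Q (x - of_int k * b) = Q x" "tc (x - of_int k * b) = tc x - of_int k"
    "P (x - of_int k * b) = (\<lambda>s. P x s - of_int k * P b s)"
proof -
  note kb = lp_int_mult[OF b(1), of k]
  show 1: "x - of_int k * b \<in> G" using x kb lp_diff_mem by blast
  show 2: "P (x - of_int k * b) = (\<lambda>s. P x s - of_int k * P b s)"
    using x kb by (simp add: lp_diff fun_eq_iff)
  have "cip I (P (x - of_int k * b)) (P b) = cip I (P x) (P b) - of_int k * of_real (sqn I (P b))"
    unfolding 2 cip_diff_left cip_self by simp
  then have "Re (cip I (P (x - of_int k * b)) (P b)) = Re (cip I (P x) (P b)) - of_int k * sqn I (P b)" by simp
  then show 3: "tc (x - of_int k * b) = tc x - of_int k"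
    using lp_sqn_pos by (simp add: proj_coeff_def field_simps)
  show "Q (x - of_int k * b) = Q x"
    unfolding proj_away_def 3 2 by (simp add: algebra_simps)
qed

text \<open>Projecting away from a further lattice vector keeps the lattice discrete: a vector that is short
  after the projection is the image of one whose coefficient at \<open>b\<close> is at most one in absolute value,
  and that one is short by the theorem of Pythagoras.\<close>

lemma lattice_proj_away: "lattice_proj I G \<Phi> Q"
  unfolding lattice_proj_def
proof (intro conjI ballI allI impI)
  fix x s assume "s \<notin> I" then show "Q x s = 0" by (simp add: proj_away_def lp_outside)
next
  fix x y s assume "x \<in> G" "y \<in> G"
  then show "Q (x + y) s = Q x s + Q y s" by (simp add: proj_away_def lp_add tc_add algebra_simps)
next
  fix x y assume xy: "x \<in> G" "y \<in> G"
  then show "cip I (Q x) (Q y) \<in> \<real>" using lp_real by (simp add: proj_cip)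
  have "cip I (\<Phi> x) (Q y) = cip I (\<Phi> x) (P y) - of_real (tc y) * cip I (\<Phi> x) (P b)"
    unfolding proj_away_def by (rule cip_diff_right)
  also have "\<dots> = cip I (Q x) (Q y)"
    unfolding proj_cip[OF xy] lp_adj[OF xy] lp_adj[OF xy(1) b(1)] lp_cip_b[OF xy(1)] by (simp add: mult_ac)
  finally show "cip I (\<Phi> x) (Q y) = cip I (Q x) (Q y)" .
next
  fix B
  let ?W = "P ` {x\<in>G. sqn I (P x) \<le> B + sqn I (P b)}"
  have "Q ` {x \<in> G. sqn I (Q x) \<le> B} \<subseteq> (\<lambda>w. \<lambda>s. w s - of_real (Re (cip I w (P b)) / sqn I (P b)) * P b s) ` ?W"
  proof
    fix w assume "w \<in> Q ` {x \<in> G. sqn I (Q x) \<le> B}"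
    then obtain x where x: "x \<in> G" "sqn I (Q x) \<le> B" "w = Q x" by auto
    define y where "y = x - of_int \<lfloor>tc x\<rfloor> * b"
    have y: "y \<in> G" "Q y = Q x" "tc y = tc x - of_int \<lfloor>tc x\<rfloor>"
      unfolding y_def using proj_shift[OF x(1), of "\<lfloor>tc x\<rfloor>"] by blast+
    have "\<bar>tc y\<bar> \<le> 1" unfolding y(3) by linarith
    then have "(tc y)\<^sup>2 \<le> 1" by (simp add: abs_square_le_1)
    then have "(tc y)\<^sup>2 * sqn I (P b) \<le> 1 * sqn I (P b)" by (rule mult_right_mono) (rule sqn_nonneg)
    then have le: "sqn I (P y) \<le> B + sqn I (P b)" unfolding proj_pythagoras[OF y(1)] y(2) using x(2) by simp
    have m: "P y \<in> ?W" by (intro imageI CollectI conjI y(1) le)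
    have "w = Q y" using x(3) y(2) by (rule trans[OF _ sym])
    then have e: "w = (\<lambda>w. \<lambda>s. w s - of_real (Re (cip I w (P b)) / sqn I (P b)) * P b s) (P y)"
      unfolding proj_away_def proj_coeff_def by assumption
    show "w \<in> (\<lambda>w. \<lambda>s. w s - of_real (Re (cip I w (P b)) / sqn I (P b)) * P b s) ` ?W" by (rule rev_image_eqI[OF m]) (rule e)
  qed
  then show "finite (Q ` {x \<in> G. sqn I (Q x) \<le> B})" by (rule finite_subset) (intro finite_imageI lp_discrete)
qed (use lp_fin lp_0 lp_add_mem lp_diff_mem in auto)

text \<open>Let \<open>P b\<close> be a shortest nonzero vector. Subtracting a multiple of \<open>b\<close> brings the coefficient at \<open>b\<close> to
  at most one half in absolute value. An element of the kernel of the next projection is then shorter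
  than \<open>P b\<close>, hence zero, and the squared length of any other element drops at most to three quarters
  of that of \<open>P b\<close>.\<close>

lemma proj_kernel:
  assumes min: "\<And>x. x \<in> G \<Longrightarrow> P x \<noteq> (\<lambda>_. 0) \<Longrightarrow> sqn I (P b) \<le> sqn I (P x)"
    and x: "x \<in> G" "Q x = (\<lambda>_. 0)"
  obtains k where "P (x - of_int k * b) = (\<lambda>_. 0)"
proof -
  let ?y = "x - of_int \<lfloor>tc x\<rfloor> * b"
  note y = proj_shift[OF x(1), of "\<lfloor>tc x\<rfloor>"]
  have "0 \<le> tc ?y" "tc ?y < 1" unfolding y(3) by linarith+
  then have "(tc ?y)\<^sup>2 < 1" by (simp add: power_less_one_iff abs_square_less_1)
  then have "(tc ?y)\<^sup>2 * sqn I (P b) < 1 * sqn I (P b)" using lp_sqn_pos by (intro mult_strict_right_mono)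
  moreover have "sqn I (Q ?y) = 0" unfolding y(2) x(2) by (simp add: sqn_def)
  ultimately have "sqn I (P ?y) < sqn I (P b)" unfolding proj_pythagoras[OF y(1)] by simp
  then have "P ?y = (\<lambda>_. 0)" using min[OF y(1)] by force
  then show thesis using that by blast
qed

lemma proj_min:
  assumes min: "\<And>x. x \<in> G \<Longrightarrow> P x \<noteq> (\<lambda>_. 0) \<Longrightarrow> sqn I (P b) \<le> sqn I (P x)"
    and x: "x \<in> G" "Q x \<noteq> (\<lambda>_. 0)"
  shows "3 / 4 * sqn I (P b) \<le> sqn I (Q x)"
proof -
  let ?y = "x - of_int (round (tc x)) * b"
  note y = proj_shift[OF x(1), of "round (tc x)"]
  have Qy: "Q ?y \<noteq> (\<lambda>_. 0)" using x(2) y(2) by simp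
  have "P ?y \<noteq> (\<lambda>_. 0)"
  proof
    assume "P ?y = (\<lambda>_. 0)"
    then have "sqn I (P ?y) = 0" by (simp add: sqn_def)
    then have "sqn I (Q ?y) = 0" using proj_pythagoras[OF y(1)] sqn_nonneg[of I "Q ?y"] sqn_nonneg[of I "P b"]
      by (metis add_nonneg_eq_0_iff mult_nonneg_nonneg zero_le_power2)
    then have "Q ?y s = 0" for s using sqn_eq_0_iff[OF lp_fin, of "Q ?y"] by (cases "s \<in> I") (auto simp: proj_away_def lp_outside)
    with Qy show False by auto
  qed
  then have 1: "sqn I (P b) \<le> sqn I (P ?y)" using min y(1) by blast
  have "\<bar>tc ?y\<bar> \<le> 1 / 2" unfolding y(3) using of_int_round_abs_le[of "tc x"] by linarith
  then have "\<bar>tc ?y\<bar>\<^sup>2 \<le> (1 / 2)\<^sup>2" by (intro power_mono) auto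
  then have "(tc ?y)\<^sup>2 \<le> 1 / 4" by (simp add: power2_eq_square)
  then have "(tc ?y)\<^sup>2 * sqn I (P b) \<le> 1 / 4 * sqn I (P b)" by (rule mult_right_mono) (rule sqn_nonneg)
  then show ?thesis using 1 unfolding proj_pythagoras[OF y(1)] y(2) by simp
qed

end

end

lemma lattice_proj_min_exists:
  assumes L: "lattice_proj I G \<Phi> P" and x: "x \<in> G" "P x \<noteq> (\<lambda>_. 0)"
  obtains b where "b \<in> G" "P b \<noteq> (\<lambda>_. 0)" "\<And>y. y \<in> G \<Longrightarrow> P y \<noteq> (\<lambda>_. 0) \<Longrightarrow> sqn I (P b) \<le> sqn I (P y)"
proof -
  let ?W = "{w \<in> P ` {y\<in>G. sqn I (P y) \<le> sqn I (P x)}. w \<noteq> (\<lambda>_. 0)}"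
  have fin: "finite ?W" using lp_discrete[OF L] by simp
  have "P x \<in> ?W" using x by auto
  then have "?W \<noteq> {}" by blast
  then obtain w where w: "w \<in> ?W" "\<And>v. v \<in> ?W \<Longrightarrow> sqn I w \<le> sqn I v"
    using arg_min_if_finite(1)[OF fin, of "sqn I"] arg_min_least[OF fin, of _ "sqn I"] by blast
  then obtain b where b: "b \<in> G" "w = P b" "sqn I (P b) \<le> sqn I (P x)" by auto
  have "sqn I (P b) \<le> sqn I (P y)" if y: "y \<in> G" "P y \<noteq> (\<lambda>_. 0)" for y
  proof (cases "sqn I (P y) \<le> sqn I (P x)")
    case True
    then show ?thesis using w(2)[of "P y"] y b(2) by auto
  qed (use b(3) in simp)
  then show thesis using that b w(1) by auto
qed

text \<open>The canonical embedding of \<open>K\<close> into the vectors indexed by its complex embeddings.\<close>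

definition conj_vec :: "complex set \<Rightarrow> complex \<Rightarrow> (complex \<Rightarrow> complex) \<Rightarrow> complex" where
  "conj_vec K x \<sigma> = (if \<sigma> \<in> embeddings K then \<sigma> x else 0)"

lemma cnj_embedding:
  assumes K: "subfield K CC" and s: "\<sigma> \<in> embeddings K"
  shows "restrict (cnj \<circ> \<sigma>) K \<in> embeddings K"
  using s unfolding embeddings_def by (auto simp: sf_1[OF K] sf_add[OF K] sf_mult[OF K])

lemma cnj_embedding_involution:
  assumes "\<sigma> \<in> embeddings K"
  shows "restrict (cnj \<circ> restrict (cnj \<circ> \<sigma>) K) K = \<sigma>"
  using assms by (auto simp: embeddings_def extensional_def fun_eq_iff)

lemma sum_cnj_embeddings:
  assumes K: "subfield K CC"
  shows "(\<Sum>\<sigma>\<in>embeddings K. f (restrict (cnj \<circ> \<sigma>) K)) = (\<Sum>\<sigma>\<in>embeddings K. f \<sigma>)"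
  by (rule sum.reindex_bij_witness[of _ "\<lambda>\<sigma>. restrict (cnj \<circ> \<sigma>) K" "\<lambda>\<sigma>. restrict (cnj \<circ> \<sigma>) K"])
     (simp_all only: cnj_embedding_involution cnj_embedding[OF K])

lemma subring_of_integers:
  assumes L: "subfield L CC"
  shows "of_int k \<in> ring_of_integers L"
    "x \<in> ring_of_integers L \<Longrightarrow> y \<in> ring_of_integers L \<Longrightarrow> x + y \<in> ring_of_integers L"
    "x \<in> ring_of_integers L \<Longrightarrow> y \<in> ring_of_integers L \<Longrightarrow> x * y \<in> ring_of_integers L"
    "x \<in> ring_of_integers L \<Longrightarrow> y \<in> ring_of_integers L \<Longrightarrow> x - y \<in> ring_of_integers L"
  by (auto simp: ring_of_integers_def sf_of_int[OF L] sf_add[OF L] sf_mult[OF L] sf_diff[OF L]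
      intro: algebraic_int_plus algebraic_int_times algebraic_int_diff)

text \<open>What is used of a Korkin--Zolotarev reduced integral basis \<open>b\<close> starting with 1: there are functionals
  \<open>u k\<close> on the conjugates that vanish on the earlier basis elements and take the value one on \<open>b k\<close>, and
  \<open>\<mu>\<close> stands for the squared minimum of the lattice of integers projected orthogonally to the
  rationals. A large \<open>\<mu>\<close> makes all functionals except the first small, and a small
  \<open>\<mu>\<close> makes the conjugates of \<open>b 1\<close> small up to the integral shift \<open>m\<close>.\<close>

definition reduced_basis ::
    "complex set \<Rightarrow> nat \<Rightarrow> (nat \<Rightarrow> complex) \<Rightarrow> (nat \<Rightarrow> (complex \<Rightarrow> complex) \<Rightarrow> complex) \<Rightarrow> real \<Rightarrow> int \<Rightarrow> bool" where
  "reduced_basis K r b u \<mu> m \<longleftrightarrow> 2 \<le> r \<and> \<mu> > 0 \<and> b 0 = 1 \<and> (\<forall>i<r. b i \<in> ring_of_integers K) \<and>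
     ring_of_integers K = int_span {..<r} b \<and>
     (\<forall>k i. k < r \<longrightarrow> i \<le> k \<longrightarrow> (\<Sum>\<sigma>\<in>embeddings K. \<sigma> (b i) * u k \<sigma>) = (if i = k then 1 else 0)) \<and>
     (\<forall>k. 1 \<le> k \<longrightarrow> k < r \<longrightarrow> sqn (embeddings K) (u k) \<le> (4/3) ^ ext_degree \<rat> K / \<mu>) \<and>
     (\<forall>\<sigma>\<in>embeddings K. cmod (\<sigma> (b 1 - of_int m)) \<le> sqrt \<mu> + 1/2)"

context
  fixes K :: "complex set"
  assumes K: "number_field K"
begin

private abbreviation "I \<equiv> embeddings K"
private abbreviation "G \<equiv> ring_of_integers K"

lemma integers_mem: "x \<in> G \<Longrightarrow> x \<in> K" "x \<in> G \<Longrightarrow> algebraic_int x"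
  by (auto simp: ring_of_integers_def)

private lemmas integers_of_int = subring_of_integers(1)[OF number_field_subfield[OF K]]
  and integers_add = subring_of_integers(2)[OF number_field_subfield[OF K]]
  and integers_mult = subring_of_integers(3)[OF number_field_subfield[OF K]]
  and integers_diff = subring_of_integers(4)[OF number_field_subfield[OF K]]

text \<open>The Hermitian product is real because complex conjugation permutes the embeddings, and the image is
  discrete because there are only finitely many integers with bounded conjugates.\<close>

lemma lattice_proj_integers: "lattice_proj I G (conj_vec K) (conj_vec K)"
  unfolding lattice_proj_def
proof (intro conjI ballI allI impI)
  note sK = number_field_subfield[OF K] and fg = number_field_fin_gen[OF K]
  show "finite I" using fin_gen_field_embeddings[OF fg] by blast
  show "0 \<in> G" using integers_of_int[of 0] by simp
  fix x y assume x: "x \<in> G" and y: "y \<in> G"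
  show "x + y \<in> G" "x - y \<in> G" using x y by (auto intro: integers_add integers_diff)
  have "cnj (cip I (conj_vec K x) (conj_vec K y)) = (\<Sum>\<sigma>\<in>I. cnj (\<sigma> x) * \<sigma> y)"
    by (simp add: cip_def conj_vec_def)
  also have "\<dots> = (\<Sum>\<sigma>\<in>I. restrict (cnj \<circ> \<sigma>) K x * cnj (restrict (cnj \<circ> \<sigma>) K y))"
    using x y by (simp add: integers_mem)
  also have "\<dots> = (\<Sum>\<sigma>\<in>I. \<sigma> x * cnj (\<sigma> y))"
    by (rule sum_cnj_embeddings[OF sK, of "\<lambda>\<sigma>. \<sigma> x * cnj (\<sigma> y)"])
  also have "\<dots> = cip I (conj_vec K x) (conj_vec K y)" by (simp add: cip_def conj_vec_def)
  finally show "cip I (conj_vec K x) (conj_vec K y) \<in> \<real>" by (simp add: Reals_cnj_iff)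
  fix s show "conj_vec K (x + y) s = conj_vec K x s + conj_vec K y s"
    using emb_add[OF sK, of s x y] x y by (simp add: conj_vec_def integers_mem)
next
  fix B
  note sK = number_field_subfield[OF K] and fg = number_field_fin_gen[OF K]
  have "{x \<in> G. sqn I (conj_vec K x) \<le> B} \<subseteq> bounded_integers (card I) (max 1 (sqrt B))"
  proof
    fix x assume x: "x \<in> {x \<in> G. sqn I (conj_vec K x) \<le> B}"
    show "x \<in> bounded_integers (card I) (max 1 (sqrt B))"
    proof (rule mem_bounded_integers[OF fg])
      show "x \<in> K" "algebraic_int x" using x by (auto simp: integers_mem)
      fix \<sigma> assume s: "\<sigma> \<in> I"
      have "(cmod (\<sigma> x))\<^sup>2 \<le> sqn I (conj_vec K x)"
        using norm_le_sqn[OF fin_gen_field_embeddings(1)[OF fg] s, of "conj_vec K x"] s by (simp add: conj_vec_def)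
      then have "(cmod (\<sigma> x))\<^sup>2 \<le> B" using x by auto
      then have "cmod (\<sigma> x) \<le> sqrt B" by (rule real_le_rsqrt)
      then show "cmod (\<sigma> x) \<le> max 1 (sqrt B)" by simp
    qed
  qed
  then have "finite {x \<in> G. sqn I (conj_vec K x) \<le> B}"
    by (rule finite_subset) (rule bounded_integers_count, simp)
  then show "finite (conj_vec K ` {x \<in> G. sqn I (conj_vec K x) \<le> B})" by (rule finite_imageI)
qed (auto simp: conj_vec_def)

lemma integer_if_conjugates_equal:
  assumes x: "x \<in> G" and t: "\<And>\<sigma>. \<sigma> \<in> I \<Longrightarrow> \<sigma> x = t"
  shows "x \<in> \<int>"
proof -
  note fg = number_field_fin_gen[OF K]
  obtain m where m: "is_minpoly \<rat> x m"
    using minpoly_exists_algebraic[OF subfield_Rats] integers_mem(2)[OF x] by blast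
  obtain k where k: "k > 0" "finite I" "\<And>\<sigma>. \<sigma> \<in> I \<Longrightarrow> poly m (\<sigma> x) = 0"
    "\<And>z. poly m z = 0 \<Longrightarrow> card {\<sigma> \<in> I. \<sigma> x = z} = k"
    using fin_gen_field_fibers[OF fg integers_mem(1)[OF x] m] by blast
  have "{z. poly m z = 0} \<subseteq> {t}"
  proof
    fix z assume z: "z \<in> {z. poly m z = 0}"
    then have "card {\<sigma> \<in> I. \<sigma> x = z} > 0" using k by auto
    then obtain \<sigma> where "\<sigma> \<in> I" "\<sigma> x = z" by (auto simp: card_gt_0_iff)
    then show "z \<in> {t}" using t by auto
  qed
  then have "card {z. poly m z = 0} \<le> 1" using card_mono[of "{t}"] by simp
  then have "Polynomial.degree m = 1" using minpoly_Rats_roots(2)[OF m] minpoly_degree_pos[OF m] by simp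
  then have "m = [:Polynomial.coeff m 0, Polynomial.coeff m 1:]" by (intro poly_eqI) (auto simp: coeff_pCons coeff_eq_0 split: nat.split)
  moreover have "Polynomial.coeff m 1 = 1" using m \<open>Polynomial.degree m = 1\<close> by (simp add: is_minpoly_def)
  moreover have "poly m x = 0" using m by (simp add: is_minpoly_def)
  ultimately have "Polynomial.coeff m 0 + x = 0" by (metis mult.right_neutral mult_zero_right add.right_neutral poly_0 poly_pCons)
  then have "x = - Polynomial.coeff m 0" by (simp add: eq_neg_iff_add_eq_0 add.commute)
  moreover have "Polynomial.coeff m 0 \<in> \<rat>" using m by (simp add: is_minpoly_def polys_over_def)
  ultimately have "x \<in> \<rat>" by simp
  then show ?thesis using rational_algebraic_int_is_int integers_mem(2)[OF x] by blast
qed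

text \<open>The projection orthogonal to the rationals, whose kernel on the integers is \<open>\<int>\<close>.\<close>

private definition "P1 = proj_away I (conj_vec K) 1"

private lemma one_mem: "1 \<in> G" using integers_of_int[of 1] by simp

private lemma card_I: "finite I" "card I > 0"
  using fin_gen_field_embeddings[OF number_field_fin_gen[OF K]] by blast+

private lemma conj_vec_1: "conj_vec K 1 \<noteq> (\<lambda>_. 0)"
proof -
  obtain \<sigma> where "\<sigma> \<in> I" using card_I by (metis all_not_in_conv card.empty less_nat_zero_code)
  then have "conj_vec K 1 \<sigma> = 1" by (simp add: conj_vec_def embeddings_def)
  then show ?thesis by (metis zero_neq_one)
qed

private lemma P1_proj: "lattice_proj I G (conj_vec K) P1"
  unfolding P1_def by (rule lattice_proj_away[OF lattice_proj_integers one_mem conj_vec_1])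

private lemma P1_kernel:
  assumes "x \<in> G" shows "P1 x = (\<lambda>_. 0) \<longleftrightarrow> x \<in> \<int>"
proof
  assume P: "P1 x = (\<lambda>_. 0)"
  have "\<sigma> x = of_real (proj_coeff I (conj_vec K) 1 x)" if s: "\<sigma> \<in> I" for \<sigma>
    using fun_cong[OF P, of \<sigma>] s by (simp add: P1_def proj_away_def conj_vec_def emb_1[OF number_field_subfield[OF K] s])
  then show "x \<in> \<int>" using integer_if_conjugates_equal[OF assms] by blast
next
  assume "x \<in> \<int>"
  then obtain k where k: "x = of_int k" by (auto elim: Ints_cases)
  have "P1 (x - of_int k * 1) = P1 x" unfolding P1_def
    by (rule proj_shift(2)[OF lattice_proj_integers one_mem conj_vec_1 assms])
  then show "P1 x = (\<lambda>_. 0)" using lp_P0[OF P1_proj] by (auto simp: k)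
qed

text \<open>The invariant of the construction of a reduced basis: \<open>r\<close> elements are chosen, \<open>P\<close> is the projection
  away from all of them, and its squared minimum has dropped at most to three quarters in every step
  since the first projection. The case \<open>r = 1\<close> is singled out because the first shortest vector after it realizes
  \<open>\<mu>\<close>.\<close>

definition reduced_upto where
  "reduced_upto \<mu> r b u P \<longleftrightarrow> lattice_proj I G (conj_vec K) P \<and> r \<ge> 1 \<and> b 0 = 1 \<and> (\<forall>i<r. b i \<in> G) \<and>
    (\<forall>x\<in>G. P x = (\<lambda>_. 0) \<longleftrightarrow> x \<in> int_span {..<r} b) \<and>
    (\<forall>k<r. \<forall>i\<le>k. (\<Sum>\<sigma>\<in>I. \<sigma> (b i) * u k \<sigma>) = (if i = k then 1 else 0)) \<and>
    (\<forall>k<r. 1 \<le> k \<longrightarrow> sqn I (u k) \<le> (4/3) ^ (k - 1) / \<mu>) \<and>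
    (\<forall>x\<in>G. P x \<noteq> (\<lambda>_. 0) \<longrightarrow> sqn I (P x) \<ge> (3/4) ^ (r - 1) * \<mu>) \<and>
    (r = 1 \<longrightarrow> P = P1) \<and> (r \<ge> 2 \<longrightarrow> sqn I (P1 (b 1)) \<le> \<mu>)"

lemma int_span_Suc:
  "x \<in> int_span {..<Suc r} b \<longleftrightarrow> (\<exists>k. x - of_int k * b r \<in> int_span {..<r} b)"
proof
  assume "x \<in> int_span {..<Suc r} b"
  then obtain c where "x = (\<Sum>i<Suc r. of_int (c i) * b i)" unfolding int_span_def by blast
  then have "x - of_int (c r) * b r = (\<Sum>i<r. of_int (c i) * b i)" by simp
  then have "x - of_int (c r) * b r \<in> int_span {..<r} b" by (rule int_spanI)
  then show "\<exists>k. x - of_int k * b r \<in> int_span {..<r} b" by blast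
next
  assume "\<exists>k. x - of_int k * b r \<in> int_span {..<r} b"
  then obtain k c where "x - of_int k * b r = (\<Sum>i<r. of_int (c i) * b i)" unfolding int_span_def by blast
  then have "x = (\<Sum>i<r. of_int (c i) * b i) + of_int k * b r" by (simp add: algebra_simps)
  also have "\<dots> = (\<Sum>i<Suc r. of_int ((c(r := k)) i) * b i)" by simp
  finally show "x \<in> int_span {..<Suc r} b" by (rule int_spanI)
qed

lemma int_span_cong: "(\<And>i. i \<in> A \<Longrightarrow> b i = b' i) \<Longrightarrow> int_span A b = int_span A b'"
  unfolding int_span_def by (auto intro!: exI sum.cong)

text \<open>The next basis element \<open>c\<close> has a shortest nonzero projection, and its functional is the Hermitian
  product with this projection, normalized; its norm is the inverse of the length of \<open>P c\<close>.\<close>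

lemma reduced_upto_step:
  assumes R: "reduced_upto \<mu> r b u P" and \<mu>: "\<mu> > 0" and ex: "\<exists>x\<in>G. P x \<noteq> (\<lambda>_. 0)"
    and \<mu>1: "\<exists>x\<in>G. P1 x \<noteq> (\<lambda>_. 0) \<and> sqn I (P1 x) = \<mu>"
  shows "\<exists>b' u' P'. reduced_upto \<mu> (Suc r) b' u' P'"
proof -
  have L: "lattice_proj I G (conj_vec K) P" and r: "r \<ge> 1" and b0: "b 0 = 1" and bG: "\<And>i. i < r \<Longrightarrow> b i \<in> G"
    and ker: "\<And>x. x \<in> G \<Longrightarrow> P x = (\<lambda>_. 0) \<longleftrightarrow> x \<in> int_span {..<r} b"
    and tri: "\<And>k i. k < r \<Longrightarrow> i \<le> k \<Longrightarrow> (\<Sum>\<sigma>\<in>I. \<sigma> (b i) * u k \<sigma>) = (if i = k then 1 else 0)"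
    and un: "\<And>k. k < r \<Longrightarrow> 1 \<le> k \<Longrightarrow> sqn I (u k) \<le> (4/3) ^ (k - 1) / \<mu>"
    and low: "\<And>x. x \<in> G \<Longrightarrow> P x \<noteq> (\<lambda>_. 0) \<Longrightarrow> sqn I (P x) \<ge> (3/4) ^ (r - 1) * \<mu>"
    and r1: "r = 1 \<Longrightarrow> P = P1" and r2: "r \<ge> 2 \<Longrightarrow> sqn I (P1 (b 1)) \<le> \<mu>"
    using R unfolding reduced_upto_def by blast+
  obtain c where c: "c \<in> G" "P c \<noteq> (\<lambda>_. 0)" "\<And>y. y \<in> G \<Longrightarrow> P y \<noteq> (\<lambda>_. 0) \<Longrightarrow> sqn I (P c) \<le> sqn I (P y)"
    using ex lattice_proj_min_exists[OF L] by metis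
  define b' where "b' = b(r := c)"
  define uc where "uc = (\<lambda>\<sigma>. cnj (P c \<sigma>) / of_real (sqn I (P c)))"
  define u' where "u' = u(r := uc)"
  define P' where "P' = proj_away I P c"
  have pos: "sqn I (P c) > 0" by (rule lp_sqn_pos[OF L c(1,2)])
  have uc: "(\<Sum>\<sigma>\<in>I. \<sigma> x * uc \<sigma>) = cip I (P x) (P c) / of_real (sqn I (P c))" if x: "x \<in> G" for x
  proof -
    have "(\<Sum>\<sigma>\<in>I. \<sigma> x * uc \<sigma>) = (\<Sum>\<sigma>\<in>I. conj_vec K x \<sigma> * cnj (P c \<sigma>)) / of_real (sqn I (P c))"
      by (simp add: uc_def conj_vec_def sum_divide_distrib)
    also have "(\<Sum>\<sigma>\<in>I. conj_vec K x \<sigma> * cnj (P c \<sigma>)) = cip I (P x) (P c)"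
      using lp_adj[OF L x c(1)] by (simp add: cip_def)
    finally show ?thesis .
  qed
  have tri': "(\<Sum>\<sigma>\<in>I. \<sigma> (b' i) * u' k \<sigma>) = (if i = k then 1 else 0)" if ik: "k < Suc r" "i \<le> k" for i k
  proof (cases "k = r")
    case False
    then show ?thesis using tri[of k i] ik by (simp add: b'_def u'_def)
  next
    case k: True
    show ?thesis
    proof (cases "i = r")
      case True
      then show ?thesis using k uc[OF c(1)] pos by (simp add: b'_def u'_def cip_self)
    next
      case False
      then have i: "i < r" using ik k by simp
      have "b i \<in> int_span {..<r} b" using int_span_base[of "{..<r}" i b] i by simp
      then have "P (b i) = (\<lambda>_. 0)" using ker[OF bG[OF i]] by simp
      then show ?thesis using uc[OF bG[OF i]] i k by (simp add: b'_def u'_def cip_def)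
    qed
  qed
  have un': "sqn I (u' k) \<le> (4/3) ^ (k - 1) / \<mu>" if k: "k < Suc r" "1 \<le> k" for k
  proof (cases "k = r")
    case False
    then show ?thesis using un[of k] k by (simp add: u'_def)
  next
    case True
    have "sqn I uc = (\<Sum>s\<in>I. (cmod (P c s))\<^sup>2 / (sqn I (P c))\<^sup>2)"
      by (subst sqn_def) (simp add: uc_def norm_divide power_divide)
    also have "\<dots> = sqn I (P c) / (sqn I (P c))\<^sup>2"
      unfolding sqn_def[of I "P c"] by (rule sum_divide_distrib[symmetric])
    also have "\<dots> = 1 / sqn I (P c)" using pos by (simp add: power2_eq_square)
    also have "\<dots> \<le> 1 / ((3/4) ^ (r - 1) * \<mu>)" using low[OF c(1,2)] pos \<mu> by (intro divide_left_mono) auto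
    also have "\<dots> = (4/3) ^ (r - 1) / \<mu>" by (simp add: field_simps power_divide)
    finally show ?thesis using True by (simp add: u'_def)
  qed
  have low': "sqn I (P' x) \<ge> (3/4) ^ (Suc r - 1) * \<mu>" if x: "x \<in> G" "P' x \<noteq> (\<lambda>_. 0)" for x
  proof -
    have "(3/4) ^ (Suc r - 1) * \<mu> = 3/4 * ((3/4) ^ (r - 1) * \<mu>)" using r by (cases r) auto
    also have "\<dots> \<le> 3/4 * sqn I (P c)" using low[OF c(1,2)] by (intro mult_left_mono) auto
    also have "\<dots> \<le> sqn I (P' x)" unfolding P'_def
      by (rule proj_min[OF L c(1,2)]) (use c(3) x in \<open>auto simp: P'_def\<close>)
    finally show ?thesis .
  qed
  have sp: "int_span {..<r} b' = int_span {..<r} b" by (rule int_span_cong) (simp add: b'_def)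
  have ker': "P' x = (\<lambda>_. 0) \<longleftrightarrow> x \<in> int_span {..<Suc r} b'" if x: "x \<in> G" for x
  proof
    assume "P' x = (\<lambda>_. 0)"
    then obtain k where k: "P (x - of_int k * c) = (\<lambda>_. 0)"
      using proj_kernel[OF L c(1,2), of x] c(3) x unfolding P'_def by blast
    have "x - of_int k * c \<in> G" by (rule proj_shift(1)[OF L c(1,2) x])
    then have "x - of_int k * c \<in> int_span {..<r} b" using ker k by simp
    then show "x \<in> int_span {..<Suc r} b'" unfolding int_span_Suc sp by (auto simp: b'_def)
  next
    assume "x \<in> int_span {..<Suc r} b'"
    then obtain k where k: "x - of_int k * c \<in> int_span {..<r} b" unfolding int_span_Suc sp by (auto simp: b'_def)
    have "x - of_int k * c \<in> G" by (rule proj_shift(1)[OF L c(1,2) x])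
    then have "P (x - of_int k * c) = (\<lambda>_. 0)" using ker k by simp
    then have "P' (x - of_int k * c) = (\<lambda>_. 0)" by (simp add: P'_def proj_away_def proj_coeff_def cip_def)
    then show "P' x = (\<lambda>_. 0)" unfolding P'_def proj_shift(2)[OF L c(1,2) x] .
  qed
  have "reduced_upto \<mu> (Suc r) b' u' P'"
    unfolding reduced_upto_def
  proof (intro conjI allI impI ballI)
    show "lattice_proj I G (conj_vec K) P'" unfolding P'_def by (rule lattice_proj_away[OF L c(1,2)])
    show "b' 0 = 1" using b0 r by (simp add: b'_def)
    show "b' i \<in> G" if "i < Suc r" for i using that bG c(1) by (auto simp: b'_def less_Suc_eq)
    show "P' = P1" if "Suc r = 1" using that r by simp
    show "sqn I (P1 (b' 1)) \<le> \<mu>" if "2 \<le> Suc r"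
    proof (cases "r = 1")
      case True
      then show ?thesis using r1 c(3) \<mu>1 by (auto simp: b'_def)
    next
      case False
      then show ?thesis using r2 r by (simp add: b'_def)
    qed
  qed (use tri' un' low' ker' in auto)
  then show ?thesis by blast
qed

lemma triangular_dual_coeff:
  fixes r k :: nat
  assumes tri: "\<And>k i. k < r \<Longrightarrow> i \<le> k \<Longrightarrow> (\<Sum>\<sigma>\<in>I. \<sigma> (b i) * u k \<sigma>) = (if i = k then 1 else (0::complex))"
    and k: "k < r" and z: "\<And>i. k < i \<Longrightarrow> i < r \<Longrightarrow> c i = 0"
  shows "(\<Sum>\<sigma>\<in>I. (\<Sum>i<r. c i * \<sigma> (b i)) * u k \<sigma>) = c k"
proof -
  have "(\<Sum>\<sigma>\<in>I. (\<Sum>i<r. c i * \<sigma> (b i)) * u k \<sigma>) = (\<Sum>\<sigma>\<in>I. \<Sum>i<r. c i * (\<sigma> (b i) * u k \<sigma>))"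
    by (simp add: sum_distrib_right mult.assoc)
  also have "\<dots> = (\<Sum>i<r. c i * (\<Sum>\<sigma>\<in>I. \<sigma> (b i) * u k \<sigma>))"
    by (subst sum.swap) (simp add: sum_distrib_left)
  also have "\<dots> = (\<Sum>i<r. if i = k then c k else 0)"
  proof (rule sum.cong)
    fix i assume "i \<in> {..<r}"
    then show "c i * (\<Sum>\<sigma>\<in>I. \<sigma> (b i) * u k \<sigma>) = (if i = k then c k else 0)"
      using tri[OF k, of i] z[of i] by (cases "i \<le> k") auto
  qed simp
  also have "\<dots> = c k" using k by simp
  finally show ?thesis .
qed

text \<open>The functional belonging to the last nonzero coefficient of a relation returns this coefficient.\<close>

lemma triangular_independent:
  fixes r :: nat
  assumes tri: "\<And>k i. k < r \<Longrightarrow> i \<le> k \<Longrightarrow> (\<Sum>\<sigma>\<in>I. \<sigma> (b i) * u k \<sigma>) = (if i = k then 1 else (0::complex))"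
    and z: "\<And>\<sigma>. \<sigma> \<in> I \<Longrightarrow> (\<Sum>i<r. c i * \<sigma> (b i)) = 0"
  shows "\<forall>i<r. c i = 0"
proof (rule ccontr)
  assume "\<not> (\<forall>i<r. c i = 0)"
  then have ne: "{i. i < r \<and> c i \<noteq> 0} \<noteq> {}" by blast
  define k where "k = Max {i. i < r \<and> c i \<noteq> 0}"
  have k: "k < r" "c k \<noteq> 0" using Max_in[OF _ ne] by (auto simp: k_def)
  have "c i = 0" if "k < i" "i < r" for i
  proof (rule ccontr)
    assume "c i \<noteq> 0"
    then have "i \<le> k" unfolding k_def using that by (intro Max_ge) auto
    then show False using that by simp
  qed
  then have "(\<Sum>\<sigma>\<in>I. (\<Sum>i<r. c i * \<sigma> (b i)) * u k \<sigma>) = c k" using triangular_dual_coeff[OF tri k(1)] by blast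
  then show False using z k(2) by simp
qed

lemma triangular_rational_independent:
  assumes bK: "\<And>i. i < r \<Longrightarrow> b i \<in> K"
    and tri: "\<And>k i. k < r \<Longrightarrow> i \<le> k \<Longrightarrow> (\<Sum>\<sigma>\<in>I. \<sigma> (b i) * u k \<sigma>) = (if i = k then 1 else (0::complex))"
    and c: "\<And>i. i < (r::nat) \<Longrightarrow> c i \<in> \<rat>" "(\<Sum>i<r. c i * b i) = 0"
  shows "\<forall>i<r. c i = 0"
proof (rule triangular_independent[OF tri])
  note sK = number_field_subfield[OF K]
  have cK: "c i \<in> K" if "i < r" for i using c(1)[OF that] sf_Rats[OF sK] by blast
  fix \<sigma> assume s: "\<sigma> \<in> I"
  have "(\<Sum>i<r. c i * \<sigma> (b i)) = (\<Sum>i<r. \<sigma> (c i * b i))"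
    using c(1) bK cK by (intro sum.cong) (auto simp: emb_mult[OF sK s] emb_Rats[OF sK s])
  also have "\<dots> = \<sigma> (\<Sum>i<r. c i * b i)" using bK cK by (intro emb_sum[OF sK s, symmetric]) (auto intro: sf_mult[OF sK])
  finally show "(\<Sum>i<r. c i * \<sigma> (b i)) = 0" using c(2) emb_0[OF sK s] by simp
qed

text \<open>The construction stops when the projection kills all integers, and it stops because the chosen
  elements are independent over the rationals, which bounds their number by the degree.\<close>

theorem reduced_basis_exists:
  assumes deg: "ext_degree \<rat> K > 1"
  shows "\<exists>r b u \<mu> m. reduced_basis K r b u \<mu> m"
proof -
  note sK = number_field_subfield[OF K]
  have "K \<noteq> \<rat>"
  proof
    assume "K = \<rat>"
    then have "ext_degree \<rat> K = 1" using ext_degree_eqI[OF subfield_Rats CC.dimension_one[OF subfield_Rats]] by simp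
    with deg show False by simp
  qed
  then obtain x where x: "x \<in> K" "x \<notin> \<rat>" using sf_Rats[OF sK] by blast
  obtain a :: int where a: "a > 0" "algebraic_int (of_int a * x)"
    using algebraic_multiple_algebraic_int number_field_algebraic[OF K x(1)] by blast
  have xG: "of_int a * x \<in> G" using a x by (auto simp: ring_of_integers_def sf_mult[OF sK] sf_of_int[OF sK])
  have "of_int a * x \<notin> \<int>"
  proof
    assume "of_int a * x \<in> \<int>"
    then have "of_int a * x / of_int a \<in> \<rat>" by (intro Rats_divide) (auto simp: Ints_subset_Rats[THEN subsetD])
    then show False using a x by simp
  qed
  then have P1x: "P1 (of_int a * x) \<noteq> (\<lambda>_. 0)" using P1_kernel[OF xG] by simp
  obtain c where c: "c \<in> G" "P1 c \<noteq> (\<lambda>_. 0)" "\<And>y. y \<in> G \<Longrightarrow> P1 y \<noteq> (\<lambda>_. 0) \<Longrightarrow> sqn I (P1 c) \<le> sqn I (P1 y)"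
    using lattice_proj_min_exists[OF P1_proj xG P1x] by blast
  define \<mu> where "\<mu> = sqn I (P1 c)"
  have \<mu>: "\<mu> > 0" unfolding \<mu>_def by (rule lp_sqn_pos[OF P1_proj c(1,2)])
  have start: "reduced_upto \<mu> 1 (\<lambda>_. 1) (\<lambda>_ _. 1 / of_nat (card I)) P1"
    unfolding reduced_upto_def
  proof (intro conjI allI impI ballI)
    fix y assume y: "y \<in> G"
    have "y \<in> int_span {..<1::nat} (\<lambda>_. 1) \<longleftrightarrow> y \<in> \<int>"
    proof
      assume "y \<in> int_span {..<1::nat} (\<lambda>_. 1)"
      then obtain c :: "nat \<Rightarrow> int" where "y = (\<Sum>i<1. of_int (c i) * 1)" unfolding int_span_def by blast
      then show "y \<in> \<int>" by simp
    next
      assume "y \<in> \<int>"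
      then obtain k where "y = of_int k" by (auto elim: Ints_cases)
      then have "y = (\<Sum>i<1::nat. of_int k * 1)" by simp
      then show "y \<in> int_span {..<1::nat} (\<lambda>_. 1)" by (rule int_spanI)
    qed
    then show "(P1 y = (\<lambda>_. 0)) = (y \<in> int_span {..<1::nat} (\<lambda>_. 1))" using P1_kernel[OF y] by (simp only:)
  next
    fix k i :: nat assume "k < 1" "i \<le> k"
    moreover have "(\<Sum>\<sigma>\<in>I. \<sigma> 1 * (1 / of_nat (card I))) = (\<Sum>\<sigma>\<in>I. 1 / of_nat (card I) :: complex)"
      by (rule sum.cong) (simp_all add: emb_1[OF sK])
    ultimately show "(\<Sum>\<sigma>\<in>I. \<sigma> 1 * (1 / of_nat (card I))) = (if i = k then 1 else (0::complex))"
      using card_I \<open>k < 1\<close> \<open>i \<le> k\<close> by (simp add: card_gt_0_iff)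
  qed (use P1_proj one_mem c \<mu>_def in auto)
  have \<mu>1: "\<exists>x\<in>G. P1 x \<noteq> (\<lambda>_. 0) \<and> sqn I (P1 x) = \<mu>" using c \<mu>_def by blast
  have bound: "r \<le> ext_degree \<rat> K" if R: "reduced_upto \<mu> r b u P" for r b u P
  proof (rule number_field_independent_le[OF K])
    show "b i \<in> K" if "i < r" for i using R that integers_mem unfolding reduced_upto_def by blast
    fix c assume c: "\<And>i. i < r \<Longrightarrow> c i \<in> \<rat>" "(\<Sum>i<r. c i * b i) = 0"
    have bK: "b i \<in> K" "c i \<in> K" if "i < r" for i
      using R that integers_mem c(1) sf_Rats[OF sK] unfolding reduced_upto_def by blast+
    show "\<forall>i<r. c i = 0"
    proof (rule triangular_rational_independent[OF _ _ c])
      show "(\<Sum>\<sigma>\<in>I. \<sigma> (b i) * u k \<sigma>) = (if i = k then 1 else 0)" if "k < r" "i \<le> k" for k i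
        using R that unfolding reduced_upto_def by blast
    qed (use bK in blast)
  qed
  have "\<exists>r b u P. reduced_upto \<mu> r b u P \<and> (\<forall>x\<in>G. P x = (\<lambda>_. 0))"
  proof (rule ccontr)
    assume no: "\<nexists>r b u P. reduced_upto \<mu> r b u P \<and> (\<forall>x\<in>G. P x = (\<lambda>_. 0))"
    have "\<exists>b u P. reduced_upto \<mu> (Suc n) b u P" for n
    proof (induction n)
      case 0
      then show ?case using start by auto
    next
      case (Suc n)
      then obtain b u P where R: "reduced_upto \<mu> (Suc n) b u P" by blast
      then have "\<exists>x\<in>G. P x \<noteq> (\<lambda>_. 0)" using no by blast
      then show ?case by (rule reduced_upto_step[OF R \<mu> _ \<mu>1])
    qed
    then obtain b u P where "reduced_upto \<mu> (Suc (ext_degree \<rat> K)) b u P" by blast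
    from bound[OF this] show False by simp
  qed
  then obtain r b u P where R: "reduced_upto \<mu> r b u P" and P0: "\<And>x. x \<in> G \<Longrightarrow> P x = (\<lambda>_. 0)" by blast
  have r1: "r \<noteq> 1" using R P0 c(1,2) unfolding reduced_upto_def by blast
  then have r2: "2 \<le> r" using R unfolding reduced_upto_def by linarith
  have bG: "\<And>i. i < r \<Longrightarrow> b i \<in> G" using R unfolding reduced_upto_def by blast
  have spG: "int_span {..<r} b \<subseteq> G"
  proof
    fix y assume "y \<in> int_span {..<r} b"
    then obtain c where y: "y = (\<Sum>i<r. of_int (c i) * b i)" unfolding int_span_def by blast
    have "(\<Sum>i\<in>A. of_int (c i) * b i) \<in> G" if "A \<subseteq> {..<r}" for A
      using that by (induction A rule: infinite_finite_induct)
        (auto intro!: integers_add integers_mult integers_of_int bG simp: integers_of_int[of 0, simplified])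
    then show "y \<in> G" unfolding y by blast
  qed
  have G: "G = int_span {..<r} b" using spG R P0 unfolding reduced_upto_def by blast
  define m where "m = round (proj_coeff I (conj_vec K) 1 (b 1))"
  have b1: "cmod (\<sigma> (b 1 - of_int m)) \<le> sqrt \<mu> + 1/2" if s: "\<sigma> \<in> I" for \<sigma>
  proof -
    let ?t = "proj_coeff I (conj_vec K) 1 (b 1)"
    have bK: "b 1 \<in> K" using bG r2 integers_mem by auto
    have "(cmod (P1 (b 1) \<sigma>))\<^sup>2 \<le> sqn I (P1 (b 1))" by (rule norm_le_sqn[OF card_I(1) s])
    also have "\<dots> \<le> \<mu>" using R r2 unfolding reduced_upto_def by blast
    finally have 1: "cmod (P1 (b 1) \<sigma>) \<le> sqrt \<mu>" by (rule real_le_rsqrt)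
    have "P1 (b 1) \<sigma> = \<sigma> (b 1) - of_real ?t" using s by (simp add: P1_def proj_away_def conj_vec_def emb_1[OF sK s])
    then have "\<sigma> (b 1 - of_int m) = P1 (b 1) \<sigma> + of_real (?t - of_int m)"
      using bK by (simp add: emb_diff[OF sK s] sf_of_int[OF sK] emb_of_int[OF sK s])
    also have "cmod \<dots> \<le> cmod (P1 (b 1) \<sigma>) + \<bar>?t - of_int m\<bar>" by (metis norm_of_real norm_triangle_ineq)
    also have "\<bar>?t - of_int m\<bar> \<le> 1/2" unfolding m_def using of_int_round_abs_le[of ?t] by (simp add: abs_minus_commute)
    finally show ?thesis using 1 by simp
  qed
  have "reduced_basis K r b u \<mu> m"
    unfolding reduced_basis_def
  proof (intro conjI allI impI ballI)
    show "2 \<le> r" "\<mu> > 0" "G = int_span {..<r} b" by (rule r2, rule \<mu>, rule G)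
    show "b i \<in> G" if "i < r" for i using that by (rule bG)
    show "cmod (\<sigma> (b 1 - of_int m)) \<le> sqrt \<mu> + 1/2" if "\<sigma> \<in> I" for \<sigma> using that by (rule b1)
    show "b 0 = 1" using R unfolding reduced_upto_def by blast
    show "(\<Sum>\<sigma>\<in>I. \<sigma> (b i) * u k \<sigma>) = (if i = k then 1 else 0)" if "k < r" "i \<le> k" for k i
      using R that unfolding reduced_upto_def by blast
    fix k assume k: "1 \<le> k" "k < r"
    then have "sqn I (u k) \<le> (4/3) ^ (k - 1) / \<mu>" using R unfolding reduced_upto_def by blast
    also have "\<dots> \<le> (4/3) ^ ext_degree \<rat> K / \<mu>"
      using k bound[OF R] \<mu> by (intro divide_right_mono power_increasing) auto
    finally show "sqn I (u k) \<le> (4/3) ^ ext_degree \<rat> K / \<mu>" .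
  qed
  then show ?thesis by blast
qed

end

section \<open>Archimedean places and local degrees\<close>

lemma approx_real_by_Rats:
  obtains q :: "nat \<Rightarrow> rat" where "(\<lambda>n. of_rat (q n) :: complex) \<longlonglongrightarrow> of_real x"
proof -
  have "\<exists>q. \<bar>real_of_rat q - x\<bar> < 1 / real (Suc n)" for n
    using of_rat_dense[of "x - 1 / real (Suc n)" "x + 1 / real (Suc n)"]
    by (auto simp: abs_less_iff algebra_simps)
  then obtain q where q: "\<And>n. \<bar>real_of_rat (q n) - x\<bar> < 1 / real (Suc n)" by metis
  have "(\<lambda>n. real_of_rat (q n) - x) \<longlonglongrightarrow> 0"
    by (rule LIMSEQ_norm_0) (use q in auto)
  then have "(\<lambda>n. real_of_rat (q n)) \<longlonglongrightarrow> x" by (simp add: LIM_zero_iff)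
  then have "(\<lambda>n. of_real (real_of_rat (q n)) :: complex) \<longlonglongrightarrow> of_real x" by (rule tendsto_of_real)
  moreover have "of_real (real_of_rat r) = (of_rat r :: complex)" for r
    by (cases r) (simp add: of_rat_rat)
  ultimately show thesis using that[of q] by simp
qed

lemma lim_in_Reals:
  assumes "\<And>k. f k \<in> \<real>" "f \<longlonglongrightarrow> (l :: complex)" shows "l \<in> \<real>"
proof -
  have "(\<lambda>k. Im (f k)) \<longlonglongrightarrow> Im l" using assms(2) by (rule tendsto_Im)
  moreover have "(\<lambda>k. Im (f k)) = (\<lambda>_. 0)" using assms(1) by (auto simp: complex_is_Real_iff)
  ultimately have "Im l = 0" by (metis LIMSEQ_unique tendsto_const)
  then show ?thesis by (simp add: complex_is_Real_iff)
qed

lemma subfield_Reals: "subfield \<real> CC"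
  by (rule subfield_CC_I) auto

lemma dimension_complex_over_Reals: "CC.dimension 2 \<real> UNIV"
proof -
  have "CC.independent \<real> (map (\<lambda>i. \<i> ^ i) [0..<2])"
  proof (rule CC_independentI[OF subfield_Reals])
    fix c assume c: "\<And>i. i < (2::nat) \<Longrightarrow> c i \<in> \<real>" "(\<Sum>i<2. c i * \<i> ^ i) = 0"
    have "c 0 \<in> \<real>" "c 1 \<in> \<real>" using c(1) by auto
    moreover have "c 0 + c 1 * \<i> = 0" using c(2) by (simp add: numeral_2_eq_2)
    ultimately have "c 0 = 0" "c 1 = 0" by (auto simp: complex_eq_iff complex_is_Real_iff)
    then show "\<forall>i<2. c i = 0" by (auto simp: less_2_cases_iff)
  qed
  moreover have "CC.Span \<real> (map (\<lambda>i. \<i> ^ i) [0..<2]) = UNIV"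
  proof -
    have "z \<in> CC.Span \<real> (map (\<lambda>i. \<i> ^ i) [0..<2])" for z
    proof -
      have carr: "set (map (\<lambda>i. \<i> ^ i) [0..<2]) \<subseteq> carrier CC" by simp
      have "z = CC.combine [of_real (Re z), of_real (Im z)] (map (\<lambda>i. \<i> ^ i) [0..<2])"
        by (simp add: CC_combine numeral_2_eq_2 complex_eq_iff)
      then show ?thesis unfolding CC.Span_mem_iff_length_version[OF subfield_Reals carr]
        by (intro exI[of _ "[of_real (Re z), of_real (Im z)]"]) simp
    qed
    then show ?thesis by blast
  qed
  ultimately show ?thesis using CC.dimensionI[OF subfield_Reals] by fastforce
qed

context
  fixes K \<sigma> v
  assumes K: "subfield K CC" and s: "\<sigma> \<in> embeddings K" and v: "v = restrict (\<lambda>x. cmod (\<sigma> x)) K"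
begin

private abbreviation "R \<equiv> cauchy_ring K v"
private definition "\<phi> = (\<lambda>a. lim (\<lambda>n. \<sigma> (a n)))"

private lemma carrier_R: "a \<in> carrier R \<longleftrightarrow> (\<forall>n. a n \<in> K) \<and> convergent (\<lambda>n. \<sigma> (a n))"
proof -
  have "v (a m - a n) = dist (\<sigma> (a m)) (\<sigma> (a n))" if "\<forall>n. a n \<in> K" for m n
    using that by (simp add: v dist_norm emb_diff[OF K s] sf_diff[OF K])
  then show ?thesis
    unfolding cauchy_ring_def Cauchy_convergent_iff[symmetric] Cauchy_def by auto
qed

private lemma R_sel: "x \<otimes>\<^bsub>R\<^esub> y = (\<lambda>n. x n * y n)" "x \<oplus>\<^bsub>R\<^esub> y = (\<lambda>n. x n + y n)"
  "\<one>\<^bsub>R\<^esub> = (\<lambda>_. 1)" "\<zero>\<^bsub>R\<^esub> = (\<lambda>_. 0)"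
  by (simp_all add: cauchy_ring_def)

private lemma phi_lim: "a \<in> carrier R \<Longrightarrow> (\<lambda>n. \<sigma> (a n)) \<longlonglongrightarrow> \<phi> a"
  by (simp add: carrier_R \<phi>_def convergent_LIMSEQ_iff)

private lemma phi_eqI: "(\<And>n. a n \<in> K) \<Longrightarrow> (\<lambda>n. \<sigma> (a n)) \<longlonglongrightarrow> w \<Longrightarrow> a \<in> carrier R \<and> \<phi> a = w"
  unfolding carrier_R \<phi>_def using convergentI limI by blast

private lemma phi_add: "a \<in> carrier R \<Longrightarrow> b \<in> carrier R \<Longrightarrow> (\<lambda>n. a n + b n) \<in> carrier R \<and> \<phi> (\<lambda>n. a n + b n) = \<phi> a + \<phi> b"
  by (rule phi_eqI) (auto simp: emb_add[OF K s] carrier_R intro!: sf_add[OF K] tendsto_add phi_lim)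

private lemma phi_mult: "a \<in> carrier R \<Longrightarrow> b \<in> carrier R \<Longrightarrow> (\<lambda>n. a n * b n) \<in> carrier R \<and> \<phi> (\<lambda>n. a n * b n) = \<phi> a * \<phi> b"
  by (rule phi_eqI) (auto simp: emb_mult[OF K s] carrier_R intro!: sf_mult[OF K] tendsto_mult phi_lim)

private lemma phi_const: "c \<in> K \<Longrightarrow> (\<lambda>_. c) \<in> carrier R \<and> \<phi> (\<lambda>_. c) = \<sigma> c"
  by (rule phi_eqI) auto

private lemma cring_R: "cring R"
proof (rule cringI)
  show "abelian_group R"
  proof (rule abelian_groupI)
    fix x assume x: "x \<in> carrier R"
    show "\<exists>y\<in>carrier R. y \<oplus>\<^bsub>R\<^esub> x = \<zero>\<^bsub>R\<^esub>"
    proof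
      show "(\<lambda>n. - 1 * x n) \<in> carrier R"
        using phi_mult[OF _ x] phi_const[of "-1"] sf_minus[OF K sf_1[OF K]] by blast
    qed (simp add: R_sel)
  qed (use phi_add phi_const[OF sf_0[OF K]] in \<open>auto simp: R_sel algebra_simps\<close>)
  show "comm_monoid R"
    by (rule comm_monoidI) (use phi_mult phi_const[OF sf_1[OF K]] in \<open>auto simp: R_sel algebra_simps\<close>)
qed (simp add: R_sel algebra_simps)

private lemma phi_hom: "ring_hom_ring R CC \<phi>"
proof (rule ring_hom_ringI2)
  show "ring R" using cring_R by (rule cring.axioms)
  show "ring CC" by (rule CC.ring_axioms)
  show "\<phi> \<in> Ring.ring_hom R CC"
    by (rule ring_hom_memI)
       (use phi_add phi_mult phi_const[OF sf_1[OF K]] emb_1[OF K s] in \<open>auto simp: R_sel\<close>)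
qed

private lemma kernel_phi: "null_sequences K v = a_kernel R CC \<phi>"
proof (rule Set.set_eqI)
  fix a
  have iff: "(\<lambda>n. v (a n)) \<longlonglongrightarrow> 0 \<longleftrightarrow> (\<lambda>n. \<sigma> (a n)) \<longlonglongrightarrow> 0" if "\<forall>n. a n \<in> K"
    using that by (simp add: v tendsto_norm_zero_iff)
  show "a \<in> null_sequences K v \<longleftrightarrow> a \<in> a_kernel R CC \<phi>"
  proof
    assume "a \<in> null_sequences K v"
    then have a: "\<forall>n. a n \<in> K" "(\<lambda>n. \<sigma> (a n)) \<longlonglongrightarrow> 0" using iff by (auto simp: null_sequences_def)
    then have "a \<in> carrier R \<and> \<phi> a = 0" by (intro phi_eqI) auto
    then show "a \<in> a_kernel R CC \<phi>" by (simp add: a_kernel_def')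
  next
    assume "a \<in> a_kernel R CC \<phi>"
    then have a: "a \<in> carrier R" "\<phi> a = 0" by (auto simp: a_kernel_def')
    then have "\<forall>n. a n \<in> K" "(\<lambda>n. \<sigma> (a n)) \<longlonglongrightarrow> 0" using phi_lim[OF a(1)] by (auto simp: carrier_R)
    then show "a \<in> null_sequences K v" using iff by (simp add: null_sequences_def)
  qed
qed

private lemma coset_phi: "a \<in> carrier R \<Longrightarrow> null_sequences K v +>\<^bsub>R\<^esub> a = {b \<in> carrier R. \<phi> b = \<phi> a}"
  unfolding kernel_phi by (rule ring_hom_ring.rcos_eq_homeq[OF phi_hom])

text \<open>A Cauchy sequence is sent to the limit of its conjugates. This identifies the completion with \<open>\<real>\<close> or
  \<open>\<complex>\<close>, according to whether the embedding is real, and the completion of the rationals in it with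
  \<open>\<real>\<close>.\<close>

lemma local_degree_embedding: "local_degree K v = (if \<sigma> ` K \<subseteq> \<real> then 1 else 2)"
proof -
  define W where "W = (if \<sigma> ` K \<subseteq> \<real> then \<real> else UNIV :: complex set)"
  define n :: nat where "n = (if \<sigma> ` K \<subseteq> \<real> then 1 else 2)"
  have real_img: "\<exists>q. (\<lambda>k. of_rat (q k)) \<in> carrier R \<and> \<phi> (\<lambda>k. of_rat (q k)) = of_real x" for x
  proof -
    obtain q :: "nat \<Rightarrow> rat" where q: "(\<lambda>n. of_rat (q n) :: complex) \<longlonglongrightarrow> of_real x"
      using approx_real_by_Rats by blast
    then show ?thesis by (intro exI[of _ q] phi_eqI) (auto simp: emb_Rats[OF K s] sf_of_rat[OF K])
  qed
  have img: "\<exists>a\<in>carrier R. \<phi> a = w" if w: "w \<in> W" for w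
  proof (cases "\<sigma> ` K \<subseteq> \<real>")
    case True
    then obtain x where "w = of_real x" using w by (auto simp: W_def elim: Reals_cases)
    then show ?thesis using real_img[of x] by blast
  next
    case False
    then obtain x where x: "x \<in> K" "\<sigma> x \<notin> \<real>" by auto
    define b where "b = Im w / Im (\<sigma> x)"
    define a where "a = Re w - b * Re (\<sigma> x)"
    have wab: "w = of_real a + of_real b * \<sigma> x"
      using x(2) by (simp add: a_def b_def complex_eq_iff complex_is_Real_iff)
    obtain p q where p: "(\<lambda>k. of_rat (p k)) \<in> carrier R" "\<phi> (\<lambda>k. of_rat (p k)) = of_real a"
      and q: "(\<lambda>k. of_rat (q k)) \<in> carrier R" "\<phi> (\<lambda>k. of_rat (q k)) = of_real b" using real_img by metis
    note c = phi_const[OF x(1)]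
    note m = phi_mult[OF q(1) conjunct1[OF c]]
    note ad = phi_add[OF p(1) conjunct1[OF m]]
    show ?thesis
      by (rule bexI[OF _ conjunct1[OF ad]]) (simp add: conjunct2[OF ad] conjunct2[OF m] conjunct2[OF c] p(2) q(2) wab)
  qed
  have phiW: "\<phi> a \<in> W" if a: "a \<in> carrier R" for a
  proof (cases "\<sigma> ` K \<subseteq> \<real>")
    case True
    have "\<sigma> (a k) \<in> \<real>" for k using True a by (auto simp: carrier_R)
    then have "\<phi> a \<in> \<real>" by (rule lim_in_Reals[OF _ phi_lim[OF a]])
    then show ?thesis using True by (simp add: W_def)
  qed (simp add: W_def)
  have sW: "subfield W CC" using subfield_Reals field.carrier_is_subfield[OF CC_field] by (simp add: W_def)
  define S where "S = CC\<lparr>carrier := W\<rparr>"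
  have fS: "field S" unfolding S_def by (rule CC.subfield_iff(2)[OF sW])
  interpret S: ring S using fS by (simp add: field_def domain_def cring_def)
  have W_R: "\<real> \<subseteq> W" by (simp add: W_def)
  have sub: "subfield \<real> S"
    using CC.subfield_iff(2)[OF subfield_Reals] W_R by (intro S.subfield_iff(1)) (auto simp: S_def)
  have dimS: "S.dimension n \<real> W"
  proof (cases "\<sigma> ` K \<subseteq> \<real>")
    case True
    then show ?thesis using S.dimension_one[OF sub] by (simp add: n_def W_def)
  next
    case False
    then have "S = CC" by (simp add: S_def W_def ring_of_type_algebra_def)
    then show ?thesis using False dimension_complex_over_Reals by (simp add: n_def W_def)
  qed
  define Q where "Q = completion K v"
  define N where "N = null_sequences K v"
  have QN: "Q = R Quot N" by (simp add: Q_def N_def completion_def)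
  have idN: "ideal N R" unfolding N_def kernel_phi by (rule ring_hom_ring.kernel_is_ideal[OF phi_hom])
  have ringQ: "ring Q" unfolding QN by (rule ideal.quotient_is_ring[OF idN])
  have piQ: "(+>\<^bsub>R\<^esub>) N \<in> Ring.ring_hom R Q" unfolding QN by (rule ideal.rcos_ring_hom[OF idN])
  define rep where "rep w = (SOME a. a \<in> carrier R \<and> \<phi> a = w)" for w
  have rep: "rep w \<in> carrier R" "\<phi> (rep w) = w" if "w \<in> W" for w
    using someI_ex[of "\<lambda>a. a \<in> carrier R \<and> \<phi> a = w"] img[OF that] unfolding rep_def by blast+
  define \<psi> where "\<psi> w = N +>\<^bsub>R\<^esub> rep w" for w
  have psi: "\<psi> (\<phi> a) = N +>\<^bsub>R\<^esub> a" if a: "a \<in> carrier R" for a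
    using rep[OF phiW[OF a]] coset_phi[OF a] coset_phi[OF rep(1)[OF phiW[OF a]]] by (simp add: \<psi>_def N_def)
  have psi_inj: "inj_on \<psi> W"
  proof (rule inj_onI)
    fix w w' assume w: "w \<in> W" "w' \<in> W" "\<psi> w = \<psi> w'"
    then have e: "{b \<in> carrier R. \<phi> b = w} = {b \<in> carrier R. \<phi> b = w'}"
      using coset_phi[OF rep(1)] rep(2) by (simp add: \<psi>_def N_def)
    have "rep w \<in> {b \<in> carrier R. \<phi> b = w}" using rep[OF w(1)] by simp
    then have "rep w \<in> {b \<in> carrier R. \<phi> b = w'}" by (simp only: e)
    then show "w = w'" using rep(2)[OF w(1)] by simp
  qed
  have psi_hom: "\<psi> \<in> Ring.ring_hom S Q"
  proof (rule ring_hom_memI)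
    fix x y assume "x \<in> carrier S" "y \<in> carrier S"
    then have x: "x \<in> W" and y: "y \<in> W" by (auto simp: S_def)
    show "\<psi> x \<in> carrier Q" unfolding \<psi>_def by (rule ring_hom_memE(1)[OF piQ rep(1)[OF x]])
    note m = phi_mult[OF rep(1)[OF x] rep(1)[OF y]] and ad = phi_add[OF rep(1)[OF x] rep(1)[OF y]]
    have "\<psi> (x * y) = N +>\<^bsub>R\<^esub> (rep x \<otimes>\<^bsub>R\<^esub> rep y)"
      using psi[OF conjunct1[OF m]] m rep x y by (simp add: R_sel)
    also have "\<dots> = \<psi> x \<otimes>\<^bsub>Q\<^esub> \<psi> y" unfolding \<psi>_def by (rule ring_hom_memE(2)[OF piQ rep(1)[OF x] rep(1)[OF y]])
    finally show "\<psi> (x \<otimes>\<^bsub>S\<^esub> y) = \<psi> x \<otimes>\<^bsub>Q\<^esub> \<psi> y" by (simp add: S_def)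
    have "\<psi> (x + y) = N +>\<^bsub>R\<^esub> (rep x \<oplus>\<^bsub>R\<^esub> rep y)"
      using psi[OF conjunct1[OF ad]] ad rep x y by (simp add: R_sel)
    also have "\<dots> = \<psi> x \<oplus>\<^bsub>Q\<^esub> \<psi> y" unfolding \<psi>_def by (rule ring_hom_memE(3)[OF piQ rep(1)[OF x] rep(1)[OF y]])
    finally show "\<psi> (x \<oplus>\<^bsub>S\<^esub> y) = \<psi> x \<oplus>\<^bsub>Q\<^esub> \<psi> y" by (simp add: S_def)
  next
    have "\<psi> 1 = N +>\<^bsub>R\<^esub> \<one>\<^bsub>R\<^esub>"
      using psi[of "\<lambda>_. 1"] phi_const[OF sf_1[OF K]] emb_1[OF K s] by (simp add: R_sel)
    also have "\<dots> = \<one>\<^bsub>Q\<^esub>" by (rule ring_hom_memE(4)[OF piQ])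
    finally show "\<psi> \<one>\<^bsub>S\<^esub> = \<one>\<^bsub>Q\<^esub>" by (simp add: S_def)
  qed
  interpret h: ring_hom_ring S Q \<psi> by (rule ring_hom_ringI2[OF S.ring_axioms ringQ psi_hom])
  have W01: "0 \<in> W" "1 \<in> W" using sf_0[OF sW] sf_1[OF sW] by auto
  have one_zero: "\<one>\<^bsub>Q\<^esub> \<noteq> \<zero>\<^bsub>Q\<^esub>"
  proof
    assume "\<one>\<^bsub>Q\<^esub> = \<zero>\<^bsub>Q\<^esub>"
    then have "\<psi> 1 = \<psi> 0" using h.hom_one h.hom_zero by (simp add: S_def)
    then show False using psi_inj W01 by (auto dest: inj_onD)
  qed
  have carrQ: "\<psi> ` W = carrier Q"
  proof
    show "\<psi> ` W \<subseteq> carrier Q" using ring_hom_memE(1)[OF psi_hom] by (auto simp: S_def)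
    show "carrier Q \<subseteq> \<psi> ` W"
    proof
      fix c assume "c \<in> carrier Q"
      then obtain a where a: "a \<in> carrier R" "c = N +>\<^bsub>R\<^esub> a" unfolding QN FactRing_def A_RCOSETS_def' by auto
      then show "c \<in> \<psi> ` W" using psi[OF a(1)] phiW[OF a(1)] by (metis imageI)
    qed
  qed
  have ratQ: "\<psi> ` \<real> = rational_completion K v"
  proof
    show "\<psi> ` \<real> \<subseteq> rational_completion K v"
    proof
      fix c assume "c \<in> \<psi> ` \<real>"
      then obtain x where x: "c = \<psi> (of_real x)" by (auto elim: Reals_cases)
      obtain q where q: "(\<lambda>k. of_rat (q k)) \<in> carrier R" "\<phi> (\<lambda>k. of_rat (q k)) = of_real x" using real_img by blast
      then have "(\<lambda>k. of_rat (q k)) \<in> carrier (cauchy_ring \<rat> v)" by (simp add: cauchy_ring_def)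
      then show "c \<in> rational_completion K v"
        unfolding rational_completion_def x using psi[OF q(1)] q(2) by (simp add: N_def image_iff) metis
    qed
    show "rational_completion K v \<subseteq> \<psi> ` \<real>"
    proof
      fix c assume "c \<in> rational_completion K v"
      then obtain a where a: "a \<in> carrier (cauchy_ring \<rat> v)" "c = N +>\<^bsub>R\<^esub> a"
        unfolding rational_completion_def N_def by auto
      have aQ: "\<And>k. a k \<in> \<rat>" using a(1) by (simp add: cauchy_ring_def)
      have aR: "a \<in> carrier R" using a(1) sf_Rats[OF K] by (auto simp: cauchy_ring_def)
      have "\<sigma> (a k) \<in> \<real>" for k using emb_Rats[OF K s aQ[of k]] aQ[of k] sf_Rats[OF subfield_Reals] by auto
      then have "\<phi> a \<in> \<real>" by (rule lim_in_Reals[OF _ phi_lim[OF aR]])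
      then show "c \<in> \<psi> ` \<real>" using psi[OF aR] a(2) by (metis imageI)
    qed
  qed
  have subQ: "subfield (\<psi> ` \<real>) Q" by (rule h.img_is_subfield(2)[OF sub one_zero])
  have "ring.dimension Q n (\<psi> ` \<real>) (\<psi> ` W)"
    by (rule h.inj_hom_dimension[OF sub one_zero psi_inj dimS])
  then have "ring.dim Q (\<psi> ` \<real>) (\<psi> ` W) = n"
    using ring.dimI[OF ringQ subQ] unfolding over_def by blast
  then show ?thesis unfolding local_degree_def carrQ ratQ Q_def n_def .
qed

end

section \<open>Classification of the places where an algebraic integer is large\<close>

context
  fixes K v
  assumes K: "subfield K CC" and v: "absolute_value_on K v"
begin

lemma av_nonneg: "x \<in> K \<Longrightarrow> 0 \<le> v x" and av_0_iff: "x \<in> K \<Longrightarrow> v x = 0 \<longleftrightarrow> x = 0"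
  and av_mult: "x \<in> K \<Longrightarrow> y \<in> K \<Longrightarrow> v (x * y) = v x * v y"
  and av_add: "x \<in> K \<Longrightarrow> y \<in> K \<Longrightarrow> v (x + y) \<le> v x + v y"
  using v unfolding absolute_value_on_def by blast+

lemma av_0: "v 0 = 0" using av_0_iff[OF sf_0[OF K]] by simp

lemma av_1: "v 1 = 1"
  using av_mult[OF sf_1[OF K] sf_1[OF K]] av_0_iff[OF sf_1[OF K]] by simp

lemma av_power: "x \<in> K \<Longrightarrow> v (x ^ n) = v x ^ n"
  by (induction n) (auto simp: av_1 av_mult sf_power[OF K])

lemma av_sum: "(\<And>a. a \<in> A \<Longrightarrow> f a \<in> K) \<Longrightarrow> v (sum f A) \<le> (\<Sum>a\<in>A. v (f a))"
proof (induction A rule: infinite_finite_induct)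
  case (insert a A)
  then have "v (f a + sum f A) \<le> v (f a) + v (sum f A)" by (intro av_add sf_sum[OF K]) auto
  then show ?case using insert by fastforce
qed (auto simp: av_0)

text \<open>If the integers are bounded, a monic integral equation bounds every algebraic integer by two;
  applying this to all powers improves the bound to one.\<close>

lemma av_le_1_if_bounded_on_Ints:
  assumes Z: "\<And>k. v (of_int k) \<le> 1" and x: "x \<in> K" "algebraic_int x"
  shows "v x \<le> 1"
proof -
  have lt2: "v y < 2" if y: "y \<in> K" "algebraic_int y" for y
  proof (rule ccontr)
    assume "\<not> v y < 2"
    then have t: "v y \<ge> 2" by simp
    obtain m where m: "m > 0" "\<And>i. i < m \<Longrightarrow> y * y ^ i \<in> int_span {..<m} (\<lambda>i. y ^ i)"
      using algebraic_int_powers_stable[OF y(2)] by blast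
    obtain c where "y * y ^ (m - 1) = (\<Sum>i<m. of_int (c i) * y ^ i)"
      using m(2)[of "m - 1"] m(1) unfolding int_span_def by auto
    then have "v (y ^ m) = v (\<Sum>i<m. of_int (c i) * y ^ i)" using m(1) by (simp flip: power_Suc)
    also have "\<dots> \<le> (\<Sum>i<m. v (of_int (c i) * y ^ i))"
      using y by (intro av_sum sf_mult[OF K] sf_of_int[OF K] sf_power[OF K])
    also have "\<dots> \<le> (\<Sum>i<m. v y ^ i)"
    proof (rule sum_mono)
      fix i show "v (of_int (c i) * y ^ i) \<le> v y ^ i"
        using y Z[of "c i"] av_nonneg[OF y(1)] by (simp add: av_mult sf_of_int[OF K] sf_power[OF K] av_power mult_left_le_one_le av_nonneg)
    qed
    also have "\<dots> = (v y ^ m - 1) / (v y - 1)" using t by (subst sum_gp_strict) (auto simp: field_simps)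
    also have "\<dots> \<le> (v y ^ m - 1) / 1" using t one_le_power[of "v y" m] by (intro divide_left_mono) auto
    finally show False using av_power[OF y(1), of m] by simp
  qed
  show ?thesis
  proof (rule ccontr)
    assume "\<not> v x \<le> 1"
    then obtain n where "2 < v x ^ n" using real_arch_pow[of "v x" 2] by auto
    then show False using lt2[of "x ^ n"] x by (simp add: av_power sf_power[OF K] algebraic_int_pow)
  qed
qed

end

lemma padic_abs_int_le_1:
  assumes "Factorial_Ring.prime p" shows "padic_abs p (of_int k) \<le> 1"
proof (cases "k = 0")
  case False
  have "quotient_of (of_int k :: rat) = (k, 1)" by (metis Rat.of_int_def quotient_of_int)
  then have "padic_abs p (of_int k) = real p powi (- int (multiplicity (int p) k))"
    using False by (simp add: padic_abs_def)
  also have "\<dots> = inverse (real p ^ multiplicity (int p) k)" by (simp add: power_int_minus)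
  also have "\<dots> \<le> 1" using prime_gt_1_nat[OF assms] by (simp add: inverse_le_1_iff one_le_power)
  finally show ?thesis .
qed (simp add: padic_abs_def)

text \<open>Rational polynomials of bounded degree that converge to a real polynomial in every coefficient. An
  absolute value on \<open>\<rat>(\<alpha>)\<close> is defined only at values of rational polynomials, so arguments with real
  polynomials pass to approximations.\<close>

definition approximates :: "(nat \<Rightarrow> complex poly) \<Rightarrow> complex poly \<Rightarrow> bool" where
  "approximates g p \<longleftrightarrow> (\<exists>D. \<forall>k. g k \<in> polys_over \<rat> \<and> Polynomial.degree (g k) \<le> D) \<and>
     (\<forall>i. (\<lambda>k. Polynomial.coeff (g k) i) \<longlonglongrightarrow> Polynomial.coeff p i)"

lemma approximates_coeff: "approximates g p \<Longrightarrow> (\<lambda>k. Polynomial.coeff (g k) i) \<longlonglongrightarrow> Polynomial.coeff p i"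
  by (simp add: approximates_def)

lemma approximates_polys_over: "approximates g p \<Longrightarrow> g k \<in> polys_over \<rat>"
  unfolding approximates_def by blast

lemma approximates_const: "p \<in> polys_over \<rat> \<Longrightarrow> approximates (\<lambda>_. p) p"
  unfolding approximates_def by auto

lemma approximates_mult:
  assumes "approximates g p" "approximates h q"
  shows "approximates (\<lambda>k. g k * h k) (p * q)"
proof -
  obtain D E where D: "\<And>k. g k \<in> polys_over \<rat>" "\<And>k. Polynomial.degree (g k) \<le> D"
    "\<And>k. h k \<in> polys_over \<rat>" "\<And>k. Polynomial.degree (h k) \<le> E"
    using assms unfolding approximates_def by blast
  have "Polynomial.degree (g k * h k) \<le> D + E" for k
    using degree_mult_le[of "g k" "h k"] D(2)[of k] D(4)[of k] by linarith
  then show ?thesis using D polys_over_mult[OF subfield_Rats] assms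
    unfolding approximates_def coeff_mult by (intro conjI allI tendsto_sum tendsto_mult exI[of _ "D + E"]) auto
qed

lemma approximates_add:
  assumes "approximates g p" "approximates h q"
  shows "approximates (\<lambda>k. g k + h k) (p + q)"
proof -
  obtain D E where D: "\<And>k. g k \<in> polys_over \<rat>" "\<And>k. Polynomial.degree (g k) \<le> D"
    "\<And>k. h k \<in> polys_over \<rat>" "\<And>k. Polynomial.degree (h k) \<le> E"
    using assms unfolding approximates_def by blast
  have "Polynomial.degree (g k + h k) \<le> max D E" for k
    using degree_add_le_max[of "g k" "h k"] D(2)[of k] D(4)[of k] by linarith
  then show ?thesis using D polys_over_add[OF subfield_Rats] assms
    unfolding approximates_def coeff_add by (intro conjI allI tendsto_add exI[of _ "max D E"]) auto
qed

lemma approximates_diff: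
  assumes "approximates g p" "approximates h q"
  shows "approximates (\<lambda>k. g k - h k) (p - q)"
proof -
  obtain D E where D: "\<And>k. g k \<in> polys_over \<rat>" "\<And>k. Polynomial.degree (g k) \<le> D"
    "\<And>k. h k \<in> polys_over \<rat>" "\<And>k. Polynomial.degree (h k) \<le> E"
    using assms unfolding approximates_def by blast
  have "Polynomial.degree (g k - h k) \<le> max D E" for k
    using degree_diff_le_max[of "g k" "h k"] D(2)[of k] D(4)[of k] by linarith
  then show ?thesis using D polys_over_diff[OF subfield_Rats] assms
    unfolding approximates_def coeff_diff by (intro conjI allI tendsto_diff exI[of _ "max D E"]) auto
qed

lemma approximates_prod:
  assumes "finite A" "\<And>z. z \<in> A \<Longrightarrow> approximates (g z) (p z)"
  shows "approximates (\<lambda>k. \<Prod>z\<in>A. g z k) (\<Prod>z\<in>A. p z)"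
  using assms
  by (induction A) (auto intro: approximates_const approximates_mult simp: polys_over_1[OF subfield_Rats])

lemma rational_approximants:
  obtains q :: "real \<Rightarrow> nat \<Rightarrow> rat"
    where "\<And>x. (\<lambda>n. of_rat (q x n) :: complex) \<longlonglongrightarrow> of_real x" "q 0 = (\<lambda>_. 0)"
proof -
  have "\<exists>q :: nat \<Rightarrow> rat. (\<lambda>n. of_rat (q n) :: complex) \<longlonglongrightarrow> of_real x" for x
    by (rule approx_real_by_Rats[of x]) (rule exI)
  then have "\<forall>x. \<exists>q :: nat \<Rightarrow> rat. (\<lambda>n. of_rat (q n) :: complex) \<longlonglongrightarrow> of_real x" ..
  from choice[OF this] obtain q :: "real \<Rightarrow> nat \<Rightarrow> rat"
    where q: "\<forall>x. (\<lambda>n. of_rat (q x n) :: complex) \<longlonglongrightarrow> of_real x" ..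
  show thesis
  proof (rule that)
    show "(\<lambda>n. of_rat ((q(0 := \<lambda>_. 0)) x n) :: complex) \<longlonglongrightarrow> of_real x" for x
      using q[rule_format, of x] by (cases "x = 0") simp_all
  qed simp
qed

lemma approximates_exists:
  assumes p: "p \<in> polys_over \<real>"
  obtains g where "approximates g p"
proof -
  obtain q' :: "real \<Rightarrow> nat \<Rightarrow> rat"
    where q': "\<And>x. (\<lambda>n. of_rat (q' x n) :: complex) \<longlonglongrightarrow> of_real x" using rational_approximants by blast
  define q where "q i = q' (Re (Polynomial.coeff p i))" for i
  have q: "(\<lambda>n. of_rat (q i n)) \<longlonglongrightarrow> Polynomial.coeff p i" for i
  proof -
    have "of_real (Re (Polynomial.coeff p i)) = Polynomial.coeff p i" using p by (simp add: polys_over_def of_real_Re)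
    then show ?thesis using q'[of "Re (Polynomial.coeff p i)"] by (simp add: q_def)
  qed
  define g where "g k = (\<Sum>i\<le>Polynomial.degree p. Polynomial.monom (of_rat (q i k)) i :: complex poly)" for k
  have co: "Polynomial.coeff (g k) i = (if i \<le> Polynomial.degree p then of_rat (q i k) else 0)" for k i
    by (auto simp: g_def coeff_sum)
  have "approximates g p"
    unfolding approximates_def
  proof (intro conjI allI exI[of _ "Polynomial.degree p"])
    show "g k \<in> polys_over \<rat>" for k by (auto simp: polys_over_def co)
    show "Polynomial.degree (g k) \<le> Polynomial.degree p" for k by (rule degree_le) (simp add: co)
    show "(\<lambda>k. Polynomial.coeff (g k) i) \<longlonglongrightarrow> Polynomial.coeff p i" for i
      using q[of i] by (cases "i \<le> Polynomial.degree p") (simp_all add: co coeff_eq_0)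
  qed
  then show thesis using that by blast
qed

lemma cmod_of_rat: "cmod (of_rat q) = \<bar>real_of_rat q\<bar>"
  by (cases q) (simp add: of_rat_rat norm_divide)

lemma le_if_powers_le:
  assumes "0 \<le> (x::real)" "0 \<le> y" "\<And>k. x ^ k \<le> C * y ^ k"
  shows "x \<le> y"
proof (rule ccontr)
  assume "\<not> x \<le> y"
  then have xy: "y < x" by simp
  show False
  proof (cases "y = 0")
    case True
    then show False using assms(3)[of 1] xy by simp
  next
    case False
    then have y: "y > 0" using assms(2) by simp
    then obtain k where k: "C < (x / y) ^ k" using real_arch_pow[of "x / y" C] xy by auto
    then have "C * y ^ k < x ^ k" using y by (simp add: power_divide field_simps)
    then show False using assms(3)[of k] by simp
  qed
qed

context
  fixes \<alpha> m v
  assumes m: "is_minpoly \<rat> \<alpha> m" and v: "absolute_value_on (adjoin \<rat> \<alpha>) v"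
    and vQ: "\<And>q. v (of_rat q) = \<bar>real_of_rat q\<bar>"
begin

private abbreviation "K \<equiv> adjoin \<rat> \<alpha>"
private abbreviation "N g \<equiv> v (poly g \<alpha>)"

private lemma sK: "subfield K CC" by (rule adjoin_subfield)

private lemma val_mem: "g \<in> polys_over \<rat> \<Longrightarrow> poly g \<alpha> \<in> K"
  unfolding adjoin_eq_poly_values[OF subfield_Rats m] by blast

private lemma alpha_mem: "\<alpha> \<in> K" by (rule adjoin_gen)

private lemma N_nonneg: "g \<in> polys_over \<rat> \<Longrightarrow> 0 \<le> N g"
  using av_nonneg[OF sK v] val_mem by blast

private lemma N_mult: "g \<in> polys_over \<rat> \<Longrightarrow> h \<in> polys_over \<rat> \<Longrightarrow> N (g * h) = N g * N h"
  using av_mult[OF sK v] val_mem by simp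

private lemma N_prod: "finite A \<Longrightarrow> (\<And>z. z \<in> A \<Longrightarrow> g z \<in> polys_over \<rat>) \<Longrightarrow> N (\<Prod>z\<in>A. g z) = (\<Prod>z\<in>A. N (g z))"
proof (induction A rule: finite_induct)
  case (insert a A)
  have "(\<Prod>z\<in>A. g z) \<in> polys_over \<rat>"
    using insert(1,4) by (induction A) (auto intro: polys_over_mult[OF subfield_Rats] polys_over_1[OF subfield_Rats])
  then show ?case using insert by (simp add: av_mult[OF sK v] val_mem)
qed (simp add: av_1[OF sK v])

private lemma N_le: "g \<in> polys_over \<rat> \<Longrightarrow> Polynomial.degree g \<le> D \<Longrightarrow> N g \<le> (\<Sum>i\<le>D. cmod (Polynomial.coeff g i) * v \<alpha> ^ i)"
proof -
  assume g: "g \<in> polys_over \<rat>" "Polynomial.degree g \<le> D"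
  have gK: "Polynomial.coeff g i \<in> K" for i using g(1) sf_Rats[OF sK] by (auto simp: polys_over_def)
  have vc: "v (Polynomial.coeff g i) = cmod (Polynomial.coeff g i)" for i
    using g(1) vQ cmod_of_rat unfolding polys_over_def by (metis (mono_tags, lifting) Rats_cases mem_Collect_eq)
  have "poly g \<alpha> = (\<Sum>i\<le>D. Polynomial.coeff g i * \<alpha> ^ i)"
    unfolding poly_altdef using g(2) by (intro sum.mono_neutral_left) (auto simp: coeff_eq_0)
  also have "v \<dots> \<le> (\<Sum>i\<le>D. v (Polynomial.coeff g i * \<alpha> ^ i))"
    using gK by (intro av_sum[OF sK v] sf_mult[OF sK] sf_power[OF sK] alpha_mem)
  also have "\<dots> = (\<Sum>i\<le>D. cmod (Polynomial.coeff g i) * v \<alpha> ^ i)"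
    using gK by (simp add: av_mult[OF sK v] av_power[OF sK v] sf_power[OF sK] alpha_mem vc)
  finally show ?thesis .
qed

text \<open>The trivial bound for the values of the approximations has a limit in terms of the real polynomial.\<close>

private lemma N_limsup:
  assumes "approximates g p" "Polynomial.degree p \<le> D"
  obtains B where "B \<longlonglongrightarrow> (\<Sum>i\<le>D. cmod (Polynomial.coeff p i) * v \<alpha> ^ i)" "\<And>k. N (g k) \<le> B k"
proof -
  obtain E where E: "\<And>k. g k \<in> polys_over \<rat>" "\<And>k. Polynomial.degree (g k) \<le> E"
    using assms unfolding approximates_def by blast
  let ?B = "\<lambda>k. (\<Sum>i\<le>max D E. cmod (Polynomial.coeff (g k) i) * v \<alpha> ^ i)"
  have "?B \<longlonglongrightarrow> (\<Sum>i\<le>max D E. cmod (Polynomial.coeff p i) * v \<alpha> ^ i)"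
    by (intro tendsto_sum tendsto_mult tendsto_norm approximates_coeff[OF assms(1)] tendsto_const)
  also have "(\<Sum>i\<le>max D E. cmod (Polynomial.coeff p i) * v \<alpha> ^ i) = (\<Sum>i\<le>D. cmod (Polynomial.coeff p i) * v \<alpha> ^ i)"
    using assms(2) by (intro sum.mono_neutral_right) (auto simp: coeff_eq_0)
  finally show thesis using that N_le[OF E(1)] E(2) by (meson max.coboundedI2)
qed

private lemma N_diff_lim:
  assumes "approximates g p" "approximates h p"
  shows "(\<lambda>k. N (g k - h k)) \<longlonglongrightarrow> 0"
proof -
  have a: "approximates (\<lambda>k. g k - h k) 0" using approximates_diff[OF assms] by simp
  obtain B where B: "B \<longlonglongrightarrow> (\<Sum>i\<le>0. cmod (Polynomial.coeff 0 i) * v \<alpha> ^ i)" "\<And>k. N (g k - h k) \<le> B k"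
    using N_limsup[OF a, of 0] by auto
  then have "B \<longlonglongrightarrow> 0" by simp
  then show ?thesis
    by (rule tendsto_sandwich[OF always_eventually always_eventually tendsto_const, rotated 2])
       (intro allI N_nonneg approximates_polys_over[OF a] B(2))+
qed

text \<open>If approximations of a real polynomial \<open>f\<close> take arbitrarily small values at \<open>\<alpha>\<close>, then the
  value of every rational polynomial is controlled by its remainder modulo \<open>f\<close>.\<close>

private lemma N_le_remainder:
  assumes f: "approximates fk f" and small: "\<And>e. e > 0 \<Longrightarrow> \<exists>\<^sub>F k in sequentially. N (fk k) < e"
    and g: "g \<in> polys_over \<rat>" and h: "h \<in> polys_over \<real>" and r: "r \<in> polys_over \<real>" and eq: "g = f * h + r"
    and D: "Polynomial.degree r \<le> D"
  shows "N g \<le> (\<Sum>i\<le>D. cmod (Polynomial.coeff r i) * v \<alpha> ^ i)"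
proof (rule field_le_epsilon)
  fix e :: real assume e: "e > 0"
  let ?S = "\<Sum>i\<le>D. cmod (Polynomial.coeff r i) * v \<alpha> ^ i"
  obtain hk where hk: "approximates hk h" using approximates_exists[OF h] by blast
  obtain rk where rk: "approximates rk r" using approximates_exists[OF r] by blast
  have gk: "approximates (\<lambda>k. fk k * hk k + rk k) g" unfolding eq
    by (intro approximates_add approximates_mult f hk rk)
  obtain B where B: "B \<longlonglongrightarrow> (\<Sum>i\<le>Polynomial.degree h. cmod (Polynomial.coeff h i) * v \<alpha> ^ i)" "\<And>k. N (hk k) \<le> B k"
    using N_limsup[OF hk order_refl] by blast
  obtain M where M: "M > 0" "\<And>k. \<bar>B k\<bar> \<le> M"
    using convergent_imp_Bseq[OF convergentI[OF B(1)]] unfolding Bseq_def by auto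
  obtain C where C: "C \<longlonglongrightarrow> ?S" "\<And>k. N (rk k) \<le> C k" using N_limsup[OF rk D] by blast
  have 1: "\<forall>\<^sub>F k in sequentially. C k < ?S + e / 3" using C(1) e by (intro order_tendstoD) auto
  have 2: "\<forall>\<^sub>F k in sequentially. N (g - (fk k * hk k + rk k)) < e / 3"
    using N_diff_lim[OF approximates_const[OF g] gk] e by (intro order_tendstoD(2)) auto
  have 3: "\<exists>\<^sub>F k in sequentially. N (fk k) < e / (3 * M)" using small e M(1) by simp
  have 4: "\<exists>\<^sub>F k in sequentially. N (fk k) < e / (3 * M) \<and> C k < ?S + e / 3 \<and> N (g - (fk k * hk k + rk k)) < e / 3"
    using frequently_eventually_conj[OF 3 eventually_conj[OF 1 2]] by (simp add: conj_commute conj_left_commute)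
  from frequently_ex[OF 4] obtain k where k: "N (fk k) < e / (3 * M)" "C k < ?S + e / 3" "N (g - (fk k * hk k + rk k)) < e / 3"
    by blast
  note mem = approximates_polys_over[OF f, of k] approximates_polys_over[OF hk, of k] approximates_polys_over[OF rk, of k]
  define w where "w = fk k * hk k + rk k"
  have w: "w \<in> polys_over \<rat>" using approximates_polys_over[OF gk, of k] by (simp only: w_def)
  have "N g = v (poly (g - w) \<alpha> + poly w \<alpha>)" by simp
  also have "\<dots> \<le> N (g - w) + N w"
    by (rule av_add[OF sK v val_mem[OF polys_over_diff[OF subfield_Rats g w]] val_mem[OF w]])
  finally have 5: "N g \<le> N (g - w) + N w" .
  have "N w = v (poly (fk k * hk k) \<alpha> + poly (rk k) \<alpha>)" by (simp add: w_def)
  also have "\<dots> \<le> N (fk k * hk k) + N (rk k)"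
    by (rule av_add[OF sK v val_mem[OF polys_over_mult[OF subfield_Rats mem(1,2)]] val_mem[OF mem(3)]])
  also have "N (fk k * hk k) = N (fk k) * N (hk k)" by (rule N_mult[OF mem(1,2)])
  finally have 6: "N w \<le> N (fk k) * N (hk k) + N (rk k)" .
  have "N (hk k) \<le> M" using B(2)[of k] M(2)[of k] by linarith
  then have "N (fk k) * N (hk k) \<le> e / (3 * M) * M"
    using k(1) N_nonneg[OF mem(2)] e M(1) by (intro mult_mono) auto
  also have "\<dots> = e / 3" using M(1) by simp
  finally have "N (fk k) * N (hk k) \<le> e / 3" .
  moreover have "N (rk k) \<le> ?S + e / 3" using C(2)[of k] k(2) by linarith
  moreover have "N (g - w) < e / 3" using k(3) by (simp only: w_def)
  ultimately show "N g \<le> ?S + e" using 5 6 by linarith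
qed

private lemma minpoly_roots_cnj: "poly m (cnj z) = 0 \<longleftrightarrow> poly m z = 0"
proof -
  have "Polynomial.coeff m i \<in> \<real>" for i
    using m sf_Rats[OF subfield_Reals] by (auto simp: is_minpoly_def polys_over_def)
  then have e: "poly m (cnj z) = cnj (poly m z)" using poly_cnj_real[of m z] by simp
  show ?thesis unfolding e by simp
qed

text \<open>The real quadratic polynomial with the roots \<open>x + iy\<close> and \<open>x - iy\<close>.\<close>

private definition "quad x y = [:of_real (x^2 + y^2), of_real (-2 * x), 1 :: complex:]"

private lemma approximates_quad:
  assumes "(\<lambda>k. of_rat (xk k) :: complex) \<longlonglongrightarrow> of_real x" "(\<lambda>k. of_rat (yk k) :: complex) \<longlonglongrightarrow> of_real y"
  shows "approximates (\<lambda>k. quad (real_of_rat (xk k)) (real_of_rat (yk k))) (quad x y)"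
  unfolding approximates_def
proof (intro conjI allI exI[of _ 2])
  have rr: "of_real (real_of_rat q) = (of_rat q :: complex)" for q by (cases q) (simp add: of_rat_rat)
  fix k
  show "quad (real_of_rat (xk k)) (real_of_rat (yk k)) \<in> polys_over \<rat>"
    unfolding quad_def
    by (intro polys_over_pCons[OF subfield_Rats] polys_over_0[OF subfield_Rats]) (simp_all add: rr)
  show "Polynomial.degree (quad (real_of_rat (xk k)) (real_of_rat (yk k))) \<le> 2" by (simp add: quad_def)
next
  have rr: "of_real (real_of_rat q) = (of_rat q :: complex)" for q by (cases q) (simp add: of_rat_rat)
  fix i :: nat
  have lims: "(\<lambda>k. (of_rat (xk k))^2 + (of_rat (yk k))^2) \<longlonglongrightarrow> (of_real x ^ 2 + of_real y ^ 2 :: complex)"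
    "(\<lambda>k. -2 * of_rat (xk k)) \<longlonglongrightarrow> (-2 * of_real x :: complex)"
    by (intro tendsto_add tendsto_power tendsto_mult tendsto_const assms)+
  consider "i = 0" | "i = 1" | "i = 2" | "i > 2" by linarith
  then show "(\<lambda>k. Polynomial.coeff (quad (real_of_rat (xk k)) (real_of_rat (yk k))) i) \<longlonglongrightarrow> Polynomial.coeff (quad x y) i"
  proof cases
    case 1 then show ?thesis using lims(1) by (simp add: quad_def rr)
  next
    case 2 then show ?thesis using lims(2) by (simp add: quad_def rr)
  next
    case 3 then show ?thesis by (simp add: quad_def numeral_2_eq_2)
  next
    case 4 then show ?thesis by (simp add: quad_def coeff_eq_0)
  qed
qed

private lemma quad_factor: "quad (Re z) (Im z) = [:-z, 1:] * [:-cnj z, 1:]"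
  unfolding quad_def using complex_add_cnj[of z] complex_mult_cnj[of z]
  by (simp add: complex_eq_iff power2_eq_square)

private lemma minpoly_square: "m * m = (\<Prod>z|poly m z = 0. quad (Re z) (Im z))"
proof -
  have "(\<Prod>z|poly m z = 0. [:-cnj z, 1:]) = (\<Prod>z|poly m z = 0. [:-z, 1:])"
    by (rule prod.reindex_bij_witness[of _ cnj cnj]) (auto simp: minpoly_roots_cnj)
  then show ?thesis using minpoly_Rats_roots(3)[OF m] unfolding quad_factor prod.distrib by simp
qed

text \<open>The square of the minimal polynomial is the product of the real quadratics attached to its
  roots, and its value is zero; hence approximations of one of these quadratics have small values.\<close>

private lemma root_selected:
  obtains z xk yk where "poly m z = 0" "(\<lambda>k. of_rat (xk k) :: complex) \<longlonglongrightarrow> of_real (Re z)"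
    "(\<lambda>k. of_rat (yk k) :: complex) \<longlonglongrightarrow> of_real (Im z)" "Im z = 0 \<Longrightarrow> yk = (\<lambda>_. 0)"
    "\<And>e. e > 0 \<Longrightarrow> \<exists>\<^sub>F k in sequentially. N (quad (real_of_rat (xk k)) (real_of_rat (yk k))) < e"
proof -
  obtain q :: "real \<Rightarrow> nat \<Rightarrow> rat"
    where q: "\<And>x. (\<lambda>n. of_rat (q x n) :: complex) \<longlonglongrightarrow> of_real x" "q 0 = (\<lambda>_. 0)"
    using rational_approximants by blast
  define xk yk where "xk z = q (Re z)" and "yk z = q (Im z)" for z :: complex
  have xk: "(\<lambda>k. of_rat (xk z k) :: complex) \<longlonglongrightarrow> of_real (Re z)"
    and yk: "(\<lambda>k. of_rat (yk z k) :: complex) \<longlonglongrightarrow> of_real (Im z)" "Im z = 0 \<Longrightarrow> yk z = (\<lambda>_. 0)" for z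
    unfolding xk_def yk_def by (rule q(1))+ (simp add: q(2))
  define qk where "qk z k = quad (real_of_rat (xk z k)) (real_of_rat (yk z k))" for z k
  let ?Z = "{z. poly m z = 0}"
  have ap: "approximates (qk z) (quad (Re z) (Im z))" for z
    unfolding qk_def by (rule approximates_quad[OF xk yk(1)])
  have mQ: "m \<in> polys_over \<rat>" using m by (simp add: is_minpoly_def)
  have "\<exists>z. poly m z = 0 \<and> (\<forall>e>0. \<exists>\<^sub>F k in sequentially. N (qk z k) < e)"
  proof (rule ccontr)
    assume "\<nexists>z. poly m z = 0 \<and> (\<forall>e>0. \<exists>\<^sub>F k in sequentially. N (qk z k) < e)"
    then have "\<forall>z\<in>?Z. \<exists>e>0. \<forall>\<^sub>F k in sequentially. N (qk z k) \<ge> e"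
      by (auto simp: frequently_def not_less)
    then obtain e where e: "\<And>z. z \<in> ?Z \<Longrightarrow> e z > 0" "\<And>z. z \<in> ?Z \<Longrightarrow> \<forall>\<^sub>F k in sequentially. N (qk z k) \<ge> e z" by metis
    note finZ = minpoly_Rats_roots(1)[OF m]
    have 1: "\<forall>\<^sub>F k in sequentially. \<forall>z\<in>?Z. N (qk z k) \<ge> e z" using e(2) by (intro eventually_ball_finite[OF finZ]) blast
    have pos: "(\<Prod>z\<in>?Z. e z) > 0" using e(1) by (intro prod_pos) blast
    have pk: "approximates (\<lambda>k. \<Prod>z\<in>?Z. qk z k) (m * m)"
      unfolding minpoly_square by (rule approximates_prod[OF finZ ap])
    have "(\<lambda>k. N ((\<Prod>z\<in>?Z. qk z k) - m * m)) \<longlonglongrightarrow> 0"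
      by (rule N_diff_lim[OF pk approximates_const[OF polys_over_mult[OF subfield_Rats mQ mQ]]])
    then have "(\<lambda>k. N (\<Prod>z\<in>?Z. qk z k)) \<longlonglongrightarrow> 0" using m by (simp add: is_minpoly_def)
    then have 2: "\<forall>\<^sub>F k in sequentially. N (\<Prod>z\<in>?Z. qk z k) < (\<Prod>z\<in>?Z. e z)" using pos by (rule order_tendstoD(2))
    obtain k where k: "\<forall>z\<in>?Z. N (qk z k) \<ge> e z" "N (\<Prod>z\<in>?Z. qk z k) < (\<Prod>z\<in>?Z. e z)"
      using eventually_happens[OF eventually_conj[OF 1 2]] by auto
    have "(\<Prod>z\<in>?Z. e z) \<le> (\<Prod>z\<in>?Z. N (qk z k))" using k(1) e(1) by (intro prod_mono) (auto intro: less_imp_le)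
    also have "\<dots> = N (\<Prod>z\<in>?Z. qk z k)" by (rule N_prod[symmetric, OF finZ approximates_polys_over[OF ap]])
    finally show False using k(2) by simp
  qed
  then obtain z where z: "poly m z = 0" "\<And>e. e > 0 \<Longrightarrow> \<exists>\<^sub>F k in sequentially. N (qk z k) < e" by blast
  show thesis by (rule that[OF z(1) xk yk(1) yk(2) z(2)[unfolded qk_def]])
qed

text \<open>Division by the real polynomial attached to the selected root \<open>z\<close> leaves a remainder of degree at
  most one, whose coefficients are bounded by its value at \<open>z\<close>. For a real root the quadratic is the
  square of a linear polynomial, which then takes the place of the quadratic.\<close>

private lemma N_le_value:
  obtains z C where "poly m z = 0" "\<And>g. g \<in> polys_over \<rat> \<Longrightarrow> N g \<le> C * cmod (poly g z)"
proof -
  obtain z xk yk where z: "poly m z = 0" "(\<lambda>k. of_rat (xk k) :: complex) \<longlonglongrightarrow> of_real (Re z)"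
    "(\<lambda>k. of_rat (yk k) :: complex) \<longlonglongrightarrow> of_real (Im z)" "Im z = 0 \<Longrightarrow> yk = (\<lambda>_. 0)"
    "\<And>e. e > 0 \<Longrightarrow> \<exists>\<^sub>F k in sequentially. N (quad (real_of_rat (xk k)) (real_of_rat (yk k))) < e"
    by (rule root_selected) (rule that, assumption+)
  have rr: "of_real (real_of_rat q) = (of_rat q :: complex)" for q by (cases q) (simp add: of_rat_rat)
  have QR: "p \<in> polys_over \<real>" if "p \<in> polys_over \<rat>" for p
    using that sf_Rats[OF subfield_Reals] by (auto simp: polys_over_def)
  show thesis
  proof (cases "Im z = 0")
    case True
    define fk where "fk k = [:- of_rat (xk k), 1 :: complex:]" for k
    let ?f = "[:- z, 1:]"
    have zr: "z = of_real (Re z)" using True by (simp add: complex_eq_iff)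
    have fR: "?f \<in> polys_over \<real>"
      using True by (intro polys_over_pCons[OF subfield_Reals] polys_over_0[OF subfield_Reals]) (auto simp: complex_is_Real_iff)
    have ap: "approximates fk ?f"
      unfolding approximates_def
    proof (intro conjI allI exI[of _ 1])
      fix k
      show "fk k \<in> polys_over \<rat>"
        unfolding fk_def by (intro polys_over_pCons[OF subfield_Rats] polys_over_0[OF subfield_Rats]) simp_all
      show "Polynomial.degree (fk k) \<le> 1" by (simp add: fk_def)
    next
      fix i :: nat
      have "(\<lambda>k. - of_rat (xk k)) \<longlonglongrightarrow> - z" using tendsto_minus[OF z(2)] zr by simp
      then show "(\<lambda>k. Polynomial.coeff (fk k) i) \<longlonglongrightarrow> Polynomial.coeff ?f i"
        by (cases i) (simp_all add: fk_def)
    qed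
    have small: "\<exists>\<^sub>F k in sequentially. N (fk k) < e" if e: "e > 0" for e
    proof -
      have q: "quad (real_of_rat (xk k)) (real_of_rat (yk k)) = fk k * fk k" for k
        using z(4)[OF True] by (simp add: quad_def fk_def rr power2_eq_square)
      have *: "\<exists>\<^sub>F k in sequentially. N (fk k) * N (fk k) < e * e"
        using z(5)[of "e * e"] e unfolding q N_mult[OF approximates_polys_over[OF ap] approximates_polys_over[OF ap]] by simp
      have "N (fk k) < e" if "N (fk k) * N (fk k) < e * e" for k
      proof (rule ccontr)
        assume "\<not> N (fk k) < e"
        then have "e * e \<le> N (fk k) * N (fk k)" using e by (intro mult_mono) auto
        with that show False by simp
      qed
      then show ?thesis using frequently_mono[of "\<lambda>k. N (fk k) * N (fk k) < e * e" "\<lambda>k. N (fk k) < e" sequentially] * by blast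
    qed
    have "N g \<le> 1 * cmod (poly g z)" if g: "g \<in> polys_over \<rat>" for g
    proof -
      obtain h r where hr: "h \<in> polys_over \<real>" "r \<in> polys_over \<real>" "g = h * ?f + r"
        "\<And>i. i \<ge> Polynomial.degree ?f \<Longrightarrow> Polynomial.coeff r i = 0"
        using polys_over_division[OF subfield_Reals fR _ QR[OF g]] by auto
      have r: "Polynomial.degree r \<le> 0" by (rule degree_le) (use hr(4) in auto)
      then obtain c where c: "r = [:c:]" by (metis degree_eq_zeroE le_zero_eq)
      have "N g \<le> (\<Sum>i\<le>0. cmod (Polynomial.coeff r i) * v \<alpha> ^ i)"
        by (rule N_le_remainder[OF ap small g hr(1,2) _ r]) (use hr(3) in \<open>simp_all add: mult.commute\<close>)
      also have "\<dots> = cmod (poly g z)" using hr(3) c by simp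
      finally show ?thesis by simp
    qed
    then show thesis using that z(1) by blast
  next
    case False
    define fk where "fk k = quad (real_of_rat (xk k)) (real_of_rat (yk k))" for k
    let ?f = "quad (Re z) (Im z)"
    have fR: "?f \<in> polys_over \<real>" unfolding quad_def
      by (intro polys_over_pCons[OF subfield_Reals] polys_over_0[OF subfield_Reals]) auto
    have ap: "approximates fk ?f" unfolding fk_def by (rule approximates_quad[OF z(2,3)])
    have small: "\<exists>\<^sub>F k in sequentially. N (fk k) < e" if e: "e > 0" for e
      using z(5)[OF e] by (simp add: fk_def)
    define C where "C = 1 + (cmod z + v \<alpha>) / \<bar>Im z\<bar>"
    have "N g \<le> C * cmod (poly g z)" if g: "g \<in> polys_over \<rat>" for g
    proof -
      obtain h r where hr: "h \<in> polys_over \<real>" "r \<in> polys_over \<real>" "g = h * ?f + r"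
        "\<And>i. i \<ge> Polynomial.degree ?f \<Longrightarrow> Polynomial.coeff r i = 0"
        using polys_over_division[OF subfield_Reals fR _ QR[OF g]] by (auto simp: quad_def)
      have r: "Polynomial.degree r \<le> 1" by (rule degree_le) (use hr(4) in \<open>auto simp: quad_def\<close>)
      define a b where "a = Polynomial.coeff r 0" and "b = Polynomial.coeff r 1"
      have rab: "r = [:a, b:]"
        by (rule poly_eqI) (use r in \<open>auto simp: a_def b_def coeff_pCons coeff_eq_0 split: nat.split\<close>)
      have ab: "a \<in> \<real>" "b \<in> \<real>" using hr(2) by (auto simp: a_def b_def polys_over_def)
      have "poly ?f z = 0" unfolding quad_factor by simp
      then have w: "poly g z = a + b * z" using hr(3) by (simp add: rab mult.commute)
      have "\<bar>Im (a + b * z)\<bar> = cmod b * \<bar>Im z\<bar>"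
        using ab by (auto elim!: Reals_cases simp: abs_mult)
      then have "cmod b * \<bar>Im z\<bar> \<le> cmod (poly g z)" unfolding w using abs_Im_le_cmod[of "a + b * z"] by simp
      then have b: "cmod b \<le> cmod (poly g z) / \<bar>Im z\<bar>" using False by (simp add: field_simps)
      have "a = poly g z - b * z" using w by simp
      then have "cmod a \<le> cmod (poly g z) + cmod b * cmod z" by (metis norm_mult norm_triangle_ineq4)
      moreover have "N g \<le> (\<Sum>i\<le>1. cmod (Polynomial.coeff r i) * v \<alpha> ^ i)"
        by (rule N_le_remainder[OF ap small g hr(1,2) _ r]) (use hr(3) in \<open>simp_all add: mult.commute\<close>)
      ultimately have "N g \<le> cmod (poly g z) + cmod b * (cmod z + v \<alpha>)"
        by (simp add: a_def b_def algebra_simps)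
      also have "\<dots> \<le> cmod (poly g z) + cmod (poly g z) / \<bar>Im z\<bar> * (cmod z + v \<alpha>)"
        using b av_nonneg[OF sK v alpha_mem] by (intro add_left_mono mult_right_mono) auto
      finally show ?thesis by (simp add: C_def algebra_simps add_divide_distrib)
    qed
    then show thesis using that z(1) by blast
  qed
qed

text \<open>Applied to powers, the inequality of the previous lemma holds with constant one; applied to inverses,
  it becomes an equality.\<close>

lemma archimedean_place_is_embedding:
  obtains \<sigma> where "\<sigma> \<in> embeddings K" "\<And>x. x \<in> K \<Longrightarrow> v x = cmod (\<sigma> x)"
proof -
  obtain z C where z: "poly m z = 0" "\<And>g. g \<in> polys_over \<rat> \<Longrightarrow> N g \<le> C * cmod (poly g z)"
    by (rule N_le_value) (rule that, assumption+)
  have le: "N g \<le> cmod (poly g z)" if g: "g \<in> polys_over \<rat>" for g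
  proof (rule le_if_powers_le)
    fix k
    have "g ^ k \<in> polys_over \<rat>" using g by (rule polys_over_power[OF subfield_Rats])
    then show "N g ^ k \<le> C * cmod (poly g z) ^ k"
      using z(2)[of "g ^ k"] av_power[OF sK v val_mem[OF g], of k] by (simp add: norm_power)
  qed (use N_nonneg[OF g] in auto)
  have mQ: "map_poly (restrict id \<rat>) m = m" using m map_poly_id_on_Rats by (simp add: is_minpoly_def)
  have idQ: "restrict id \<rat> \<in> embeddings \<rat>" using embeddings_Rats by simp
  obtain \<sigma> where s: "\<sigma> \<in> embeddings K" "\<sigma> \<alpha> = z"
    using simple_extension_embedding_exists[OF subfield_Rats m idQ, of z] z(1) unfolding mQ by blast
  have le': "v x \<le> cmod (\<sigma> x)" if x: "x \<in> K" for x
  proof -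
    obtain g where g: "g \<in> polys_over \<rat>" "x = poly g \<alpha>" using x unfolding adjoin_eq_poly_values[OF subfield_Rats m] by blast
    have gK: "g \<in> polys_over K" using g(1) sf_Rats[OF sK] by (auto simp: polys_over_def)
    have "map_poly \<sigma> g = g"
      by (rule poly_eqI) (use g(1) in \<open>auto simp: coeff_map_poly emb_0[OF sK s(1)] emb_Rats[OF sK s(1)] polys_over_def\<close>)
    then have "\<sigma> x = poly g z" using emb_poly[OF sK s(1) gK alpha_mem] g(2) s(2) by simp
    then show ?thesis using le[OF g(1)] g(2) by simp
  qed
  have "v x = cmod (\<sigma> x)" if x: "x \<in> K" for x
  proof (cases "x = 0")
    case True
    then show ?thesis using av_0[OF sK v] emb_0[OF sK s(1)] by simp
  next
    case False
    have ix: "inverse x \<in> K" using x by (rule sf_inverse[OF sK])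
    have "v x * v (inverse x) = 1" using av_mult[OF sK v x ix] av_1[OF sK v] False by simp
    moreover have "v x > 0" using av_nonneg[OF sK v x] av_0_iff[OF sK v x] False by (simp add: less_le)
    ultimately have "v (inverse x) = 1 / v x" by (simp add: field_simps)
    moreover have "v (inverse x) \<le> 1 / cmod (\<sigma> x)"
      using le'[OF ix] emb_inverse[OF sK s(1) x] by (simp add: norm_divide inverse_eq_divide)
    ultimately have "inverse (v x) \<le> inverse (cmod (\<sigma> x))" by (simp add: inverse_eq_divide)
    then have "cmod (\<sigma> x) \<le> v x" using \<open>v x > 0\<close> by (rule inverse_le_imp_le)
    then show ?thesis using le'[OF x] by simp
  qed
  then show thesis using that s(1) by blast
qed

end

section \<open>The Weil height of an algebraic integer\<close>

lemma nonarchimedean_place_le_1: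
  assumes K: "subfield K CC" and v: "absolute_value_on K v" and p: "Factorial_Ring.prime p"
    and vQ: "\<And>q. v (of_rat q) = padic_abs p q" and x: "x \<in> K" "algebraic_int x"
  shows "v x \<le> 1"
proof (rule av_le_1_if_bounded_on_Ints[OF K v _ x])
  fix k show "v (of_int k) \<le> 1" using vQ[of "of_int k"] padic_abs_int_le_1[OF p, of k] by simp
qed

lemma embedding_place:
  assumes K: "subfield K CC" and s: "\<sigma> \<in> embeddings K"
  shows "restrict (\<lambda>x. cmod (\<sigma> x)) K \<in> places K"
  unfolding places_def absolute_value_on_def
  using emb_add[OF K s] emb_mult[OF K s] emb_eq_0_iff[OF K s] emb_Rats[OF K s] sf_of_rat[OF K] cmod_of_rat
  by (auto simp: sf_add[OF K] sf_mult[OF K] norm_mult norm_triangle_ineq)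

text \<open>Circles around 0 and 1 meet in a pair of conjugate points.\<close>

lemma complex_eq_or_cnj:
  assumes "cmod z = cmod w" "cmod (z - 1) = cmod (w - 1)"
  shows "z = w \<or> z = cnj w"
proof -
  have 1: "(Re z)\<^sup>2 + (Im z)\<^sup>2 = (Re w)\<^sup>2 + (Im w)\<^sup>2" using assms(1) by (simp flip: cmod_power2)
  have "(Re z - 1)\<^sup>2 + (Im z)\<^sup>2 = (Re w - 1)\<^sup>2 + (Im w)\<^sup>2"
    using arg_cong[OF assms(2), of "\<lambda>t. t\<^sup>2"] by (simp add: cmod_power2)
  with 1 have "Re z = Re w" by (simp add: power2_diff)
  moreover from this 1 have "Im z = Im w \<or> Im z = - Im w" by (simp add: power2_eq_iff)
  ultimately show ?thesis by (auto simp: complex_eq_iff)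
qed

context
  fixes \<alpha> m
  assumes a: "algebraic_int \<alpha>" and m: "is_minpoly \<rat> \<alpha> m"
begin

private abbreviation "Ka \<equiv> adjoin \<rat> \<alpha>"
private definition "place \<sigma> = restrict (\<lambda>x. cmod (\<sigma> x)) Ka"

private lemma place_apply: "x \<in> Ka \<Longrightarrow> place \<sigma> x = cmod (\<sigma> x)"
  by (simp add: place_def)

private lemma sKa: "subfield Ka CC" by (rule adjoin_subfield)

private lemma emb_eqI: "\<sigma> \<in> embeddings Ka \<Longrightarrow> \<sigma>' \<in> embeddings Ka \<Longrightarrow> \<sigma> \<alpha> = \<sigma>' \<alpha> \<Longrightarrow> \<sigma> = \<sigma>'"
proof (rule simple_extension_embedding_unique[OF subfield_Rats m])
  assume s: "\<sigma> \<in> embeddings Ka" "\<sigma>' \<in> embeddings Ka"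
  have "restrict \<rho> \<rat> = restrict id \<rat>" if "\<rho> \<in> embeddings Ka" for \<rho>
    using emb_restrict[OF sKa that subfield_Rats sf_Rats[OF sKa]] embeddings_Rats by simp
  then show "restrict \<sigma> \<rat> = restrict \<sigma>' \<rat>" using s by simp
qed

private lemma place_eq_iff:
  assumes s: "\<sigma> \<in> embeddings Ka" "\<sigma>' \<in> embeddings Ka"
  shows "place \<sigma>' = place \<sigma> \<longleftrightarrow> \<sigma>' = \<sigma> \<or> \<sigma>' = restrict (cnj \<circ> \<sigma>) Ka"
proof
  assume eq: "place \<sigma>' = place \<sigma>"
  have aK: "\<alpha> \<in> Ka" "\<alpha> - 1 \<in> Ka" using adjoin_gen[of \<alpha>] sf_diff[OF sKa] sf_1[OF sKa] by auto
  have "cmod (\<sigma>' \<alpha>) = cmod (\<sigma> \<alpha>)" using fun_cong[OF eq, of \<alpha>] aK by (simp add: place_apply)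
  moreover have "cmod (\<sigma>' \<alpha> - 1) = cmod (\<sigma> \<alpha> - 1)"
    using fun_cong[OF eq, of "\<alpha> - 1"] aK s
    by (simp add: place_apply emb_diff[OF sKa s(1)] emb_diff[OF sKa s(2)] emb_1[OF sKa s(1)] emb_1[OF sKa s(2)] sf_1[OF sKa])
  ultimately have "\<sigma>' \<alpha> = \<sigma> \<alpha> \<or> \<sigma>' \<alpha> = cnj (\<sigma> \<alpha>)" by (rule complex_eq_or_cnj)
  then show "\<sigma>' = \<sigma> \<or> \<sigma>' = restrict (cnj \<circ> \<sigma>) Ka"
    using emb_eqI[OF s(2,1)] emb_eqI[OF s(2) cnj_embedding[OF sKa s(1)]] aK(1) by auto
qed (auto simp: place_def fun_eq_iff restrict_def)

text \<open>A pair of conjugate nonreal embeddings gives one place of local degree two, a real embedding a place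
  of local degree one.\<close>

private lemma place_fiber:
  assumes s: "\<sigma> \<in> embeddings Ka"
  shows "{\<sigma>' \<in> embeddings Ka. place \<sigma>' = place \<sigma>} = {\<sigma>, restrict (cnj \<circ> \<sigma>) Ka}"
    "card {\<sigma>, restrict (cnj \<circ> \<sigma>) Ka} = local_degree Ka (place \<sigma>)"
proof -
  show "{\<sigma>' \<in> embeddings Ka. place \<sigma>' = place \<sigma>} = {\<sigma>, restrict (cnj \<circ> \<sigma>) Ka}"
    using place_eq_iff[OF s] s cnj_embedding[OF sKa s] by blast
  have "restrict (cnj \<circ> \<sigma>) Ka = \<sigma> \<longleftrightarrow> \<sigma> ` Ka \<subseteq> \<real>"
  proof
    assume eq: "restrict (cnj \<circ> \<sigma>) Ka = \<sigma>"
    show "\<sigma> ` Ka \<subseteq> \<real>"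
    proof
      fix y assume "y \<in> \<sigma> ` Ka"
      then obtain x where "x \<in> Ka" "y = \<sigma> x" by blast
      then have "cnj y = y" using fun_cong[OF eq, of x] by simp
      then show "y \<in> \<real>" by (simp add: Reals_cnj_iff)
    qed
  next
    assume "\<sigma> ` Ka \<subseteq> \<real>"
    then show "restrict (cnj \<circ> \<sigma>) Ka = \<sigma>"
      by (intro embeddings_eqI[OF cnj_embedding[OF sKa s] s]) (auto simp: image_subset_iff Reals_cnj_iff)
  qed
  then show "card {\<sigma>, restrict (cnj \<circ> \<sigma>) Ka} = local_degree Ka (place \<sigma>)"
    unfolding place_def local_degree_embedding[OF sKa s refl] by (auto simp: card_insert_if)
qed

lemma fin_gen_field_adjoin: "fin_gen_field Ka"
  unfolding fin_gen_field_def
proof (intro exI conjI)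
  show "finite {\<alpha>}" "{\<alpha>} \<subseteq> Qbar" using a by (auto simp: Qbar_def)
  show "Ka = field_gen {\<alpha>}"
  proof
    show "Ka \<subseteq> field_gen {\<alpha>}" unfolding adjoin_field_gen
      using sf_Rats[OF field_gen_subfield] field_gen_incl[of "{\<alpha>}"] by (intro field_gen_least field_gen_subfield) auto
    show "field_gen {\<alpha>} \<subseteq> Ka" using adjoin_gen by (intro field_gen_least sKa) auto
  qed
qed

text \<open>Only archimedean absolute values can exceed one at an algebraic integer.\<close>

lemma large_places:
  "{v \<in> places Ka. v \<alpha> > 1} = place ` {\<sigma> \<in> embeddings Ka. cmod (\<sigma> \<alpha>) > 1}"
proof
  show "place ` {\<sigma> \<in> embeddings Ka. cmod (\<sigma> \<alpha>) > 1} \<subseteq> {v \<in> places Ka. v \<alpha> > 1}"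
    using embedding_place[OF sKa] adjoin_gen[of \<alpha>] by (auto simp: place_apply) (simp add: place_def)
  show "{v \<in> places Ka. v \<alpha> > 1} \<subseteq> place ` {\<sigma> \<in> embeddings Ka. cmod (\<sigma> \<alpha>) > 1}"
  proof
    fix v assume "v \<in> {v \<in> places Ka. v \<alpha> > 1}"
    then have v: "v \<in> extensional Ka" "absolute_value_on Ka v" "v \<alpha> > 1"
      and c: "(\<forall>q::rat. v (of_rat q) = \<bar>of_rat q\<bar>) \<or> (\<exists>p::nat. Factorial_Ring.prime p \<and> (\<forall>q::rat. v (of_rat q) = padic_abs p q))"
      by (auto simp: places_def)
    have "\<not> (\<exists>p::nat. Factorial_Ring.prime p \<and> (\<forall>q::rat. v (of_rat q) = padic_abs p q))"
    proof
      assume "\<exists>p::nat. Factorial_Ring.prime p \<and> (\<forall>q::rat. v (of_rat q) = padic_abs p q)"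
      then obtain p :: nat where p: "Factorial_Ring.prime p" "\<And>q::rat. v (of_rat q) = padic_abs p q" by blast
      from nonarchimedean_place_le_1[OF sKa v(2) p adjoin_gen a] v(3) show False by simp
    qed
    then have vQ: "\<And>q::rat. v (of_rat q) = \<bar>real_of_rat q\<bar>" using c by blast
    obtain \<sigma> where s: "\<sigma> \<in> embeddings Ka" "\<And>x. x \<in> Ka \<Longrightarrow> v x = cmod (\<sigma> x)"
      by (rule archimedean_place_is_embedding[OF m v(2) vQ]) (rule that, assumption+)
    have "v = place \<sigma>" by (rule extensionalityI[OF v(1)]) (use s(2) in \<open>auto simp: place_def\<close>)
    moreover have "cmod (\<sigma> \<alpha>) > 1" using v(3) s(2)[OF adjoin_gen] by simp
    ultimately show "v \<in> place ` {\<sigma> \<in> embeddings Ka. cmod (\<sigma> \<alpha>) > 1}" using s(1) by blast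
  qed
qed

text \<open>The local degree counts the embeddings that give the same place.\<close>

lemma weil_height_eq:
  "weil_height \<alpha> = (\<Prod>\<sigma>\<in>embeddings Ka. max 1 (cmod (\<sigma> \<alpha>))) powr (1 / Polynomial.degree m)"
proof -
  define n where "n = real (Polynomial.degree m)"
  let ?E = "{\<sigma> \<in> embeddings Ka. cmod (\<sigma> \<alpha>) > 1}"
  note fin = fin_gen_field_embeddings(1)[OF fin_gen_field_adjoin]
  have finE: "finite ?E" using fin by simp
  have fib: "max 1 (v \<alpha>) powr (real (local_degree Ka v) / n) = (\<Prod>\<sigma>'\<in>{\<sigma>' \<in> ?E. place \<sigma>' = v}. cmod (\<sigma>' \<alpha>) powr (1 / n))"
    if v: "v \<in> place ` ?E" for v
  proof -
    obtain \<sigma> where s: "\<sigma> \<in> embeddings Ka" "cmod (\<sigma> \<alpha>) > 1" "v = place \<sigma>" using v by blast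
    have va: "v \<alpha> = cmod (\<sigma> \<alpha>)" using s(3) adjoin_gen by (simp add: place_apply)
    have same: "cmod (\<sigma>' \<alpha>) = cmod (\<sigma> \<alpha>)" if "place \<sigma>' = place \<sigma>" for \<sigma>'
      using fun_cong[OF that, of \<alpha>] adjoin_gen[of \<alpha>] by (simp add: place_apply)
    have eq: "{\<sigma>' \<in> ?E. place \<sigma>' = v} = {\<sigma>' \<in> embeddings Ka. place \<sigma>' = place \<sigma>}"
    proof (rule Collect_cong)
      fix \<sigma>'
      show "\<sigma>' \<in> ?E \<and> place \<sigma>' = v \<longleftrightarrow> \<sigma>' \<in> embeddings Ka \<and> place \<sigma>' = place \<sigma>"
        using same[of \<sigma>'] s(2) unfolding s(3) by auto
    qed
    have "(\<Prod>\<sigma>'\<in>{\<sigma>' \<in> ?E. place \<sigma>' = v}. cmod (\<sigma>' \<alpha>) powr (1 / n)) = (\<Prod>\<sigma>'\<in>{\<sigma>' \<in> embeddings Ka. place \<sigma>' = place \<sigma>}. cmod (\<sigma> \<alpha>) powr (1 / n))"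
      unfolding eq
    proof (rule prod.cong[OF refl])
      fix \<sigma>' assume "\<sigma>' \<in> {\<sigma>' \<in> embeddings Ka. place \<sigma>' = place \<sigma>}"
      then have "place \<sigma>' = place \<sigma>" by simp
      from same[OF this] show "cmod (\<sigma>' \<alpha>) powr (1 / n) = cmod (\<sigma> \<alpha>) powr (1 / n)" by (simp only:)
    qed
    also have "\<dots> = (cmod (\<sigma> \<alpha>) powr (1 / n)) ^ local_degree Ka v"
      using place_fiber[OF s(1)] s(3) by simp
    also have "\<dots> = cmod (\<sigma> \<alpha>) powr (real (local_degree Ka v) / n)"
      by (subst powr_power) (use s(2) in auto)
    finally show ?thesis using va s(2) by (simp add: max_def)
  qed
  have "weil_height \<alpha> = (\<Prod>v\<in>place ` ?E. max 1 (v \<alpha>) powr (real (local_degree Ka v) / n))"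
    unfolding weil_height_def height_in_def large_places ext_degree_adjoin[OF subfield_Rats m] n_def ..
  also have "\<dots> = (\<Prod>v\<in>place ` ?E. \<Prod>\<sigma>'\<in>{\<sigma>' \<in> ?E. place \<sigma>' = v}. cmod (\<sigma>' \<alpha>) powr (1 / n))"
    by (rule prod.cong[OF refl fib])
  also have "\<dots> = (\<Prod>\<sigma>\<in>?E. cmod (\<sigma> \<alpha>) powr (1 / n))"
    by (rule prod.image_gen[OF finE, of _ place, symmetric])
  also have "\<dots> = (\<Prod>\<sigma>\<in>embeddings Ka. max 1 (cmod (\<sigma> \<alpha>)) powr (1 / n))"
    by (rule prod.mono_neutral_cong_left[OF fin]) (auto simp: not_less max_absorb1 max_absorb2 less_imp_le)
  also have "\<dots> = (\<Prod>\<sigma>\<in>embeddings Ka. max 1 (cmod (\<sigma> \<alpha>))) powr (1 / n)"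
    by (rule prod_powr_distrib[symmetric])
  finally show ?thesis by (simp add: n_def)
qed

text \<open>Both sides are powers of one product over the conjugates of \<open>\<alpha>\<close>, as each conjugate is attained
  equally often on every field containing \<open>\<alpha>\<close>.\<close>

lemma prod_embeddings_weil_height:
  assumes F: "fin_gen_field F" "\<alpha> \<in> F"
  shows "(\<Prod>\<sigma>\<in>embeddings F. max 1 (cmod (\<sigma> \<alpha>))) = weil_height \<alpha> ^ card (embeddings F)" and "weil_height \<alpha> \<ge> 1"
proof -
  let ?f = "\<lambda>z. max 1 (cmod z)" and ?n = "Polynomial.degree m"
  let ?P = "\<Prod>z|poly m z = 0. ?f z"
  have n: "?n > 0" by (rule minpoly_degree_pos[OF m])
  have P1: "?P \<ge> 1" by (rule prod_ge_1) auto
  obtain k' where k': "card (embeddings Ka) = k' * ?n" "(\<Prod>\<sigma>\<in>embeddings Ka. ?f (\<sigma> \<alpha>)) = ?P ^ k'"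
    using embeddings_prod[OF fin_gen_field_adjoin adjoin_gen m, of ?f] by blast
  have "inj_on (\<lambda>\<sigma>. \<sigma> \<alpha>) (embeddings Ka)" by (rule inj_onI) (rule emb_eqI)
  moreover have "(\<lambda>\<sigma>. \<sigma> \<alpha>) ` embeddings Ka \<subseteq> {z. poly m z = 0}"
  proof -
    obtain k where "k > 0" "finite (embeddings Ka)" "\<And>\<sigma>. \<sigma> \<in> embeddings Ka \<Longrightarrow> poly m (\<sigma> \<alpha>) = 0"
      "\<And>z. poly m z = 0 \<Longrightarrow> card {\<sigma> \<in> embeddings Ka. \<sigma> \<alpha> = z} = k"
      using fin_gen_field_fibers[OF fin_gen_field_adjoin adjoin_gen m] by blast
    then show ?thesis by blast
  qed
  ultimately have "card (embeddings Ka) \<le> ?n"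
    using card_inj_on_le[OF _ _ minpoly_Rats_roots(1)[OF m]] minpoly_Rats_roots(2)[OF m] by metis
  moreover have "k' \<noteq> 0" using k'(1) fin_gen_field_embeddings(2)[OF fin_gen_field_adjoin] by (cases k') auto
  ultimately have "k' = 1" using k'(1) n by (cases k') auto
  then have H: "weil_height \<alpha> = ?P powr (1 / ?n)" using weil_height_eq k'(2) by simp
  have Hn: "weil_height \<alpha> ^ ?n = ?P" using P1 n unfolding H by (simp add: powr_power)
  show "weil_height \<alpha> \<ge> 1" unfolding H using P1 by (intro ge_one_powr_ge_zero) auto
  obtain k where k: "card (embeddings F) = k * ?n" "(\<Prod>\<sigma>\<in>embeddings F. ?f (\<sigma> \<alpha>)) = ?P ^ k"
    using embeddings_prod[OF F m, of ?f] by blast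
  show "(\<Prod>\<sigma>\<in>embeddings F. ?f (\<sigma> \<alpha>)) = weil_height \<alpha> ^ card (embeddings F)"
    unfolding k Hn[symmetric] by (simp add: mult.commute flip: power_mult)
qed

end

section \<open>Independence from linear disjointness\<close>

definition linear_extension :: "(('i \<Rightarrow> complex) \<Rightarrow> complex) \<Rightarrow> (('i \<Rightarrow> complex) \<Rightarrow>\<^sub>0 rat) \<Rightarrow> complex" where
  "linear_extension \<Psi> c = (\<Sum>x\<in>Poly_Mapping.keys c. of_rat (Poly_Mapping.lookup c x) * \<Psi> x)"

lemma linear_extension_superset:
  "finite A \<Longrightarrow> Poly_Mapping.keys c \<subseteq> A \<Longrightarrow>
    linear_extension \<Psi> c = (\<Sum>x\<in>A. of_rat (Poly_Mapping.lookup c x) * \<Psi> x)"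
  unfolding linear_extension_def by (rule sum.mono_neutral_left) (auto simp: in_keys_iff)

lemma linear_extension_add: "linear_extension \<Psi> (c + c') = linear_extension \<Psi> c + linear_extension \<Psi> c'"
proof -
  let ?A = "Poly_Mapping.keys c \<union> Poly_Mapping.keys c'"
  have "linear_extension \<Psi> (c + c') = (\<Sum>x\<in>?A. of_rat (Poly_Mapping.lookup (c + c') x) * \<Psi> x)"
    using Poly_Mapping.keys_add[of c c'] by (intro linear_extension_superset) auto
  also have "\<dots> = (\<Sum>x\<in>?A. of_rat (Poly_Mapping.lookup c x) * \<Psi> x) + (\<Sum>x\<in>?A. of_rat (Poly_Mapping.lookup c' x) * \<Psi> x)"
    by (simp add: lookup_add of_rat_add distrib_right sum.distrib)
  also have "\<dots> = linear_extension \<Psi> c + linear_extension \<Psi> c'"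
    using linear_extension_superset[of ?A c \<Psi>] linear_extension_superset[of ?A c' \<Psi>] by simp
  finally show ?thesis .
qed

lemma linear_extension_0: "linear_extension \<Psi> 0 = 0"
  by (simp add: linear_extension_def)

lemma linear_extension_diff: "linear_extension \<Psi> (c - c') = linear_extension \<Psi> c - linear_extension \<Psi> c'"
  using linear_extension_add[of \<Psi> "c - c'" c'] by simp

lemma linear_extension_single: "linear_extension \<Psi> (Poly_Mapping.single x q) = of_rat q * \<Psi> x"
  by (cases "q = 0") (simp_all add: linear_extension_def)

lemma linear_extension_sum: "linear_extension \<Psi> (sum f A) = (\<Sum>a\<in>A. linear_extension \<Psi> (f a))"
  by (induction A rule: infinite_finite_induct) (simp_all add: linear_extension_0 linear_extension_add)

text \<open>A product of additive and homogeneous functions of the single coordinates is multilinear, so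
  its linear extension kills the defining relations of the tensor product. With identities as
  factors this is the natural map; with coordinate functions it separates basis tensors.\<close>

lemma tensor_relations_linear_extension:
  assumes fin: "finite I"
    and add: "\<And>i a b. i \<in> I \<Longrightarrow> a \<in> F i \<Longrightarrow> b \<in> F i \<Longrightarrow> \<phi> i (a + b) = \<phi> i a + (\<phi> i b :: complex)"
    and hom: "\<And>i a r. i \<in> I \<Longrightarrow> a \<in> F i \<Longrightarrow> \<phi> i (of_rat r * a) = of_rat r * \<phi> i a"
    and c: "c \<in> tensor_relations I F"
  shows "linear_extension (\<lambda>x. \<Prod>i\<in>I. \<phi> i (x i)) c = 0"
proof -
  have upd: "(\<Prod>j\<in>I. \<phi> j ((x(i := a)) j)) = \<phi> i a * (\<Prod>j\<in>I - {i}. \<phi> j (x j))" if i: "i \<in> I" for x i a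
  proof -
    have "(\<Prod>j\<in>I. \<phi> j ((x(i := a)) j)) = \<phi> i ((x(i := a)) i) * (\<Prod>j\<in>I - {i}. \<phi> j ((x(i := a)) j))"
      by (rule prod.remove[OF fin i])
    also have "(\<Prod>j\<in>I - {i}. \<phi> j ((x(i := a)) j)) = (\<Prod>j\<in>I - {i}. \<phi> j (x j))" by (rule prod.cong) auto
    finally show ?thesis by simp
  qed
  from c show ?thesis
  proof induction
    case zero
    show ?case by (rule linear_extension_0)
  next
    case (plus c c')
    then show ?case by (simp add: linear_extension_add)
  next
    case (additive x i a b q)
    then show ?case by (simp only: linear_extension_diff linear_extension_single upd add) (simp add: algebra_simps)
  next
    case (homogeneous x i a r q)
    then show ?case by (simp only: linear_extension_diff linear_extension_single upd hom) (simp add: of_rat_mult)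
  qed
qed

lemma formal_product_sum_linear_extension: "formal_product_sum I c = linear_extension (\<lambda>x. \<Prod>i\<in>I. x i) c"
  by (simp add: formal_product_sum_def linear_extension_def)

text \<open>The class of an element of the kernel of the natural map is the class of zero, by injectivity.\<close>

lemma linearly_disjoint_kernel:
  assumes ld: "linearly_disjoint_family F" and fin: "finite I" and c: "c \<in> tensor_free I F"
    and z: "formal_product_sum I c = 0"
  shows "- c \<in> tensor_relations I F"
proof -
  define E where "E = {(c, c'). c \<in> tensor_free I F \<and> c' \<in> tensor_free I F \<and> c - c' \<in> tensor_relations I F}"
  have rel: "formal_product_sum I d = 0" if "d \<in> tensor_relations I F" for d
    unfolding formal_product_sum_linear_extension
    by (rule tensor_relations_linear_extension[OF fin _ _ that, of "\<lambda>_ a. a"]) auto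
  have nat: "tensor_natural_map I (E `` {d}) = formal_product_sum I d" if d: "d \<in> tensor_free I F" for d
  proof -
    have "formal_product_sum I ` (E `` {d}) = {formal_product_sum I d}"
    proof
      show "formal_product_sum I ` (E `` {d}) \<subseteq> {formal_product_sum I d}"
      proof
        fix y assume "y \<in> formal_product_sum I ` (E `` {d})"
        then obtain d' where d': "y = formal_product_sum I d'" "d - d' \<in> tensor_relations I F" by (auto simp: E_def)
        then show "y \<in> {formal_product_sum I d}"
          using rel[OF d'(2)] by (simp add: formal_product_sum_linear_extension linear_extension_diff)
      qed
      have "d \<in> E `` {d}" using d tensor_relations.zero by (simp add: E_def)
      then show "{formal_product_sum I d} \<subseteq> formal_product_sum I ` (E `` {d})" by blast
    qed
    then show ?thesis by (simp add: tensor_natural_map_def)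
  qed
  have 0: "0 \<in> tensor_free I F" by (simp add: tensor_free_def)
  have inj: "inj_on (tensor_natural_map I) (tensor_product I F)" using ld fin by (simp add: linearly_disjoint_family_def)
  have "E `` {c} = E `` {0}"
  proof (rule inj_onD[OF inj])
    show "tensor_natural_map I (E `` {c}) = tensor_natural_map I (E `` {0})"
      unfolding nat[OF c] nat[OF 0] z by (simp add: formal_product_sum_def)
    show "E `` {c} \<in> tensor_product I F" "E `` {0} \<in> tensor_product I F"
      unfolding tensor_product_def E_def[symmetric] by (rule quotientI[OF c], rule quotientI[OF 0])
  qed
  moreover have "c \<in> E `` {c}" using c tensor_relations.zero by (simp add: E_def)
  ultimately have "(0, c) \<in> E" by blast
  then show ?thesis by (simp add: E_def)
qed

definition rational_basis :: "complex set \<Rightarrow> nat \<Rightarrow> (nat \<Rightarrow> complex) \<Rightarrow> bool" where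
  "rational_basis K r b \<longleftrightarrow> (\<forall>j<r. b j \<in> K) \<and>
     (\<forall>x\<in>K. \<exists>c. (\<forall>j<r. c j \<in> \<rat>) \<and> x = (\<Sum>j<r. c j * b j)) \<and>
     (\<forall>c. (\<forall>j<r. c j \<in> \<rat>) \<longrightarrow> (\<Sum>j<r. c j * b j) = 0 \<longrightarrow> (\<forall>j<r. c j = 0))"

lemma rational_basis_coordinates:
  assumes K: "subfield K CC" and B: "rational_basis K r b"
  obtains co where "\<And>x y j. x \<in> K \<Longrightarrow> y \<in> K \<Longrightarrow> j < r \<Longrightarrow> co j (x + y) = co j x + (co j y :: complex)"
    "\<And>x q j. x \<in> K \<Longrightarrow> j < r \<Longrightarrow> co j (of_rat q * x) = of_rat q * co j x"
    "\<And>i j. i < r \<Longrightarrow> j < r \<Longrightarrow> co j (b i) = (if i = j then 1 else 0)"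
proof -
  have bK: "\<And>j. j < r \<Longrightarrow> b j \<in> K"
    and ind: "\<And>c. (\<forall>j<r. c j \<in> \<rat>) \<Longrightarrow> (\<Sum>j<r. c j * b j) = 0 \<Longrightarrow> (\<forall>j<r. c j = 0)"
    and sp: "\<forall>x. \<exists>c. x \<in> K \<longrightarrow> (\<forall>j<r. c j \<in> \<rat>) \<and> x = (\<Sum>j<r. c j * b j)"
    using B unfolding rational_basis_def by blast+
  from choice[OF sp] obtain C where C: "\<forall>x. x \<in> K \<longrightarrow> (\<forall>j<r. C x j \<in> \<rat>) \<and> x = (\<Sum>j<r. C x j * b j)" ..
  have CQ: "C x j \<in> \<rat>" if "x \<in> K" "j < r" for x j using C that by blast
  have Cx: "(\<Sum>j<r. C x j * b j) = x" if "x \<in> K" for x using C that by metis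
  have uniq: "C x j = c j" if x: "x \<in> K" and c: "\<And>j. j < r \<Longrightarrow> c j \<in> \<rat>" "(\<Sum>j<r. c j * b j) = x" and j: "j < r" for x c j
  proof -
    have "(\<Sum>j<r. (C x j - c j) * b j) = 0" using Cx[OF x] c(2) by (simp add: left_diff_distrib sum_subtractf)
    moreover have "\<forall>j<r. C x j - c j \<in> \<rat>" using CQ[OF x] c(1) by simp
    ultimately have "\<forall>j<r. C x j - c j = 0" using ind[of "\<lambda>j. C x j - c j"] by blast
    then show ?thesis using j by simp
  qed
  show thesis
  proof (rule that[of "\<lambda>j x. C x j"])
    fix x y j assume x: "x \<in> K" and y: "y \<in> K" and j: "j < r"
    show "C (x + y) j = C x j + C y j"
      by (rule uniq[OF sf_add[OF K x y] _ _ j]) (simp_all add: CQ x y distrib_right sum.distrib Cx)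
  next
    fix x q j assume x: "x \<in> K" and j: "j < r"
    have "(\<Sum>j<r. of_rat q * C x j * b j) = of_rat q * x"
      unfolding mult.assoc sum_distrib_left[symmetric] Cx[OF x] ..
    then show "C (of_rat q * x) j = of_rat q * C x j"
      by (intro uniq[OF sf_mult[OF K sf_of_rat[OF K] x] _ _ j]) (simp_all add: CQ x)
  next
    fix i j assume i: "i < r" and j: "j < r"
    have "(\<Sum>j<r. (if i = j then 1 else 0) * b j) = (\<Sum>j<r. if i = j then b j else 0)" by (rule sum.cong) auto
    also have "\<dots> = b i" using i by simp
    finally show "C (b i) j = (if i = j then 1 else 0)"
      by (intro uniq[OF bK[OF i] _ _ j]) auto
  qed
qed

definition basis_product :: "nat set \<Rightarrow> (nat \<Rightarrow> nat \<Rightarrow> complex) \<Rightarrow> (nat \<Rightarrow> nat) \<Rightarrow> complex" where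
  "basis_product A b J = (\<Prod>i\<in>A. b i (J i))"

text \<open>A relation is an element of the tensor product killed by the natural map, so it is a sum of relations
  of multilinearity. The product of the coordinate functions at \<open>J0\<close> is multilinear, hence vanishes on
  it; but its value is \<open>a J0\<close>.\<close>

lemma basis_products_independent:
  assumes ld: "linearly_disjoint_family (K(0 := L))" and A: "finite A" "0 \<notin> A"
    and K: "\<And>i. i \<in> A \<Longrightarrow> subfield (K i) CC" and B: "\<And>i. i \<in> A \<Longrightarrow> rational_basis (K i) (r i) (b i)"
    and a: "\<And>J. J \<in> PiE A (\<lambda>i. {..<r i}) \<Longrightarrow> a J \<in> L"
    and z: "(\<Sum>J\<in>PiE A (\<lambda>i. {..<r i}). a J * basis_product A b J) = 0"
    and J0: "J0 \<in> PiE A (\<lambda>i. {..<r i})"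
  shows "a J0 = 0"
proof -
  let ?J = "PiE A (\<lambda>i. {..<r i})" and ?I = "insert 0 A" and ?F = "K(0 := L)"
  have finJ: "finite ?J" using A by (intro finite_PiE) auto
  have "\<forall>i. \<exists>co. i \<in> A \<longrightarrow> (\<forall>x y j. x \<in> K i \<longrightarrow> y \<in> K i \<longrightarrow> j < r i \<longrightarrow> co j (x + y) = co j x + (co j y :: complex)) \<and>
      (\<forall>x q j. x \<in> K i \<longrightarrow> j < r i \<longrightarrow> co j (of_rat q * x) = of_rat q * co j x) \<and>
      (\<forall>k j. k < r i \<longrightarrow> j < r i \<longrightarrow> co j (b i k) = (if k = j then 1 else 0))"
  proof
    fix i
    show "\<exists>co. i \<in> A \<longrightarrow> (\<forall>x y j. x \<in> K i \<longrightarrow> y \<in> K i \<longrightarrow> j < r i \<longrightarrow> co j (x + y) = co j x + (co j y :: complex)) \<and>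
      (\<forall>x q j. x \<in> K i \<longrightarrow> j < r i \<longrightarrow> co j (of_rat q * x) = of_rat q * co j x) \<and>
      (\<forall>k j. k < r i \<longrightarrow> j < r i \<longrightarrow> co j (b i k) = (if k = j then 1 else 0))"
    proof (cases "i \<in> A")
      case True
      show ?thesis
        by (rule rational_basis_coordinates[OF K[OF True] B[OF True]], rule exI, intro impI conjI allI) assumption+
    qed simp
  qed
  from choice[OF this] obtain co where co: "\<forall>i. i \<in> A \<longrightarrow> (\<forall>x y j. x \<in> K i \<longrightarrow> y \<in> K i \<longrightarrow> j < r i \<longrightarrow> co i j (x + y) = co i j x + (co i j y :: complex)) \<and>
      (\<forall>x q j. x \<in> K i \<longrightarrow> j < r i \<longrightarrow> co i j (of_rat q * x) = of_rat q * co i j x) \<and>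
      (\<forall>k j. k < r i \<longrightarrow> j < r i \<longrightarrow> co i j (b i k) = (if k = j then 1 else 0))" ..
  define x where "x J = (\<lambda>i. if i = 0 then a J else if i \<in> A then b i (J i) else undefined)" for J
  define c where "c = (\<Sum>J\<in>?J. Poly_Mapping.single (x J) (1::rat))"
  have bK: "b i j \<in> K i" if "i \<in> A" "j < r i" for i j using B[OF that(1)] that(2) by (simp add: rational_basis_def)
  have xP: "x J \<in> PiE ?I ?F" if J: "J \<in> ?J" for J
  proof (rule PiE_I)
    fix i assume "i \<in> ?I"
    then show "x J i \<in> ?F i" using a[OF J] bK PiE_mem[OF J] A(2) by (auto simp: x_def)
  next
    fix i assume "i \<notin> ?I"
    then show "x J i = undefined" by (simp add: x_def)
  qed
  have cf: "c \<in> tensor_free ?I ?F"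
    unfolding tensor_free_def
  proof (rule CollectI, rule order_trans)
    show "Poly_Mapping.keys c \<subseteq> (\<Union>J\<in>?J. Poly_Mapping.keys (Poly_Mapping.single (x J) (1::rat)))"
      unfolding c_def by (rule Poly_Mapping.keys_sum)
    show "(\<Union>J\<in>?J. Poly_Mapping.keys (Poly_Mapping.single (x J) (1::rat))) \<subseteq> PiE ?I ?F" using xP by auto
  qed
  have xprod: "(\<Prod>i\<in>?I. \<phi> i (x J i)) = \<phi> 0 (a J) * (\<Prod>i\<in>A. \<phi> i (b i (J i)))" for J and \<phi> :: "nat \<Rightarrow> complex \<Rightarrow> complex"
  proof -
    have "(\<Prod>i\<in>A. \<phi> i (x J i)) = (\<Prod>i\<in>A. \<phi> i (b i (J i)))" using A(2) by (intro prod.cong) (auto simp: x_def)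
    then show ?thesis using A by (simp add: x_def)
  qed
  have "formal_product_sum ?I c = (\<Sum>J\<in>?J. a J * basis_product A b J)"
    unfolding formal_product_sum_linear_extension c_def linear_extension_sum linear_extension_single
    using xprod[of "\<lambda>_ y. y"] by (simp add: basis_product_def)
  then have rel: "- c \<in> tensor_relations ?I ?F"
    using z A by (intro linearly_disjoint_kernel[OF ld _ cf]) auto
  define \<phi> where "\<phi> i = (if i = 0 then (\<lambda>y. y) else co i (J0 i))" for i
  have J0r: "J0 i < r i" if "i \<in> A" for i using PiE_mem[OF J0 that] by simp
  have "linear_extension (\<lambda>x. \<Prod>i\<in>?I. \<phi> i (x i)) (- c) = 0"
  proof (rule tensor_relations_linear_extension[OF _ _ _ rel])
    fix i y z assume i: "i \<in> ?I" and y: "y \<in> ?F i" and z: "z \<in> ?F i"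
    show "\<phi> i (y + z) = \<phi> i y + \<phi> i z" using i y z co J0r by (cases "i = 0") (simp_all add: \<phi>_def)
  next
    fix i y q assume i: "i \<in> ?I" and y: "y \<in> ?F i"
    show "\<phi> i (of_rat q * y) = of_rat q * \<phi> i y" using i y co J0r by (cases "i = 0") (simp_all add: \<phi>_def)
  qed (use A in simp)
  moreover have "linear_extension \<Psi> (- c) = - linear_extension \<Psi> c" for \<Psi>
    using linear_extension_diff[of \<Psi> 0 c] by (simp add: linear_extension_0)
  ultimately have "linear_extension (\<lambda>x. \<Prod>i\<in>?I. \<phi> i (x i)) c = 0" by simp
  then have "(\<Sum>J\<in>?J. \<phi> 0 (a J) * (\<Prod>i\<in>A. \<phi> i (b i (J i)))) = 0"
    unfolding c_def linear_extension_sum linear_extension_single xprod by simp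
  moreover have "\<phi> 0 (a J) * (\<Prod>i\<in>A. \<phi> i (b i (J i))) = (if J = J0 then a J0 else 0)" if J: "J \<in> ?J" for J
  proof -
    have "(\<Prod>i\<in>A. \<phi> i (b i (J i))) = (\<Prod>i\<in>A. if J i = J0 i then 1 else 0)"
    proof (rule prod.cong[OF refl])
      fix i assume i: "i \<in> A"
      have "i \<noteq> 0"
      proof
        assume "i = 0"
        with i A(2) show False by simp
      qed
      then show "\<phi> i (b i (J i)) = (if J i = J0 i then 1 else 0)"
        using co i J0r[OF i] PiE_mem[OF J i] by (simp add: \<phi>_def)
    qed
    also have "\<dots> = (if J = J0 then 1 else 0)"
    proof (cases "J = J0")
      case False
      then obtain i where "i \<in> A" "J i \<noteq> J0 i" using PiE_ext[OF J J0] by blast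
      then have "(\<Prod>i\<in>A. if J i = J0 i then 1 else 0 :: complex) = 0" using A(1) by (intro prod_zero) auto
      then show ?thesis using False by simp
    qed simp
    finally show ?thesis by (simp add: \<phi>_def)
  qed
  ultimately have "(\<Sum>J\<in>?J. if J = J0 then a J0 else 0) = 0" by (simp cong: sum.cong)
  then show ?thesis using finJ J0 by simp
qed

section \<open>Spans of products of basis elements\<close>

definition products_span :: "complex set \<Rightarrow> nat set \<Rightarrow> (nat \<Rightarrow> nat) \<Rightarrow> (nat \<Rightarrow> nat \<Rightarrow> complex) \<Rightarrow> complex set" where
  "products_span R A r b = {\<Sum>J\<in>PiE A (\<lambda>i. {..<r i}). a J * basis_product A b J | a. \<forall>J\<in>PiE A (\<lambda>i. {..<r i}). a J \<in> R}"

context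
  fixes R :: "complex set" and A :: "nat set" and r :: "nat \<Rightarrow> nat" and b :: "nat \<Rightarrow> nat \<Rightarrow> complex"
  assumes R: "\<And>k. of_int k \<in> R" "\<And>x y. x \<in> R \<Longrightarrow> y \<in> R \<Longrightarrow> x + y \<in> R" "\<And>x y. x \<in> R \<Longrightarrow> y \<in> R \<Longrightarrow> x * y \<in> R"
    and A: "finite A" and r: "\<And>i. i \<in> A \<Longrightarrow> 1 \<le> r i" and b0: "\<And>i. i \<in> A \<Longrightarrow> b i 0 = (1 :: complex)"
    and mult: "\<And>i j k. i \<in> A \<Longrightarrow> j < r i \<Longrightarrow> k < r i \<Longrightarrow> b i j * b i k \<in> int_span {..<r i} (b i)"
begin

private abbreviation "JJ \<equiv> PiE A (\<lambda>i. {..<r i})"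
private abbreviation "M \<equiv> products_span R A r b"

private lemma fin_JJ: "finite JJ" using A by (intro finite_PiE) auto

private lemma M_I: "(\<And>J. J \<in> JJ \<Longrightarrow> a J \<in> R) \<Longrightarrow> (\<Sum>J\<in>JJ. a J * basis_product A b J) \<in> M"
  unfolding products_span_def by blast

private lemma M_E:
  assumes "x \<in> M" obtains a where "\<And>J. J \<in> JJ \<Longrightarrow> a J \<in> R" "x = (\<Sum>J\<in>JJ. a J * basis_product A b J)"
  using assms unfolding products_span_def by blast

lemma products_span_add: "x \<in> M \<Longrightarrow> y \<in> M \<Longrightarrow> x + y \<in> M"
proof -
  assume "x \<in> M" "y \<in> M"
  then obtain a a' where a: "\<And>J. J \<in> JJ \<Longrightarrow> a J \<in> R" "x = (\<Sum>J\<in>JJ. a J * basis_product A b J)"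
    "\<And>J. J \<in> JJ \<Longrightarrow> a' J \<in> R" "y = (\<Sum>J\<in>JJ. a' J * basis_product A b J)" by (elim M_E) blast
  have "x + y = (\<Sum>J\<in>JJ. (a J + a' J) * basis_product A b J)" by (simp add: a distrib_right sum.distrib)
  then show ?thesis using M_I[of "\<lambda>J. a J + a' J"] a R(2) by simp
qed

lemma products_span_scale: "c \<in> R \<Longrightarrow> x \<in> M \<Longrightarrow> c * x \<in> M"
proof -
  assume c: "c \<in> R" and "x \<in> M"
  then obtain a where a: "\<And>J. J \<in> JJ \<Longrightarrow> a J \<in> R" "x = (\<Sum>J\<in>JJ. a J * basis_product A b J)" by (elim M_E) blast
  have "c * x = (\<Sum>J\<in>JJ. (c * a J) * basis_product A b J)" by (simp add: a sum_distrib_left mult.assoc)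
  then show ?thesis using M_I[of "\<lambda>J. c * a J"] a c R(3) by simp
qed

lemma products_span_0: "0 \<in> M"
  using M_I[of "\<lambda>_. 0"] R(1)[of 0] by simp

lemma products_span_sum: "(\<And>a. a \<in> B \<Longrightarrow> f a \<in> M) \<Longrightarrow> sum f B \<in> M"
  by (induction B rule: infinite_finite_induct) (auto intro: products_span_0 products_span_add)

lemma products_span_base: "J \<in> JJ \<Longrightarrow> basis_product A b J \<in> M"
proof -
  assume J: "J \<in> JJ"
  have "(\<Sum>J'\<in>JJ. (if J' = J then 1 else 0) * basis_product A b J') = (\<Sum>J'\<in>JJ. if J' = J then basis_product A b J else 0)"
    by (rule sum.cong) auto
  also have "\<dots> = basis_product A b J" using J fin_JJ by simp
  finally show ?thesis using M_I[of "\<lambda>J'. if J' = J then 1 else 0"] R(1)[of 0] R(1)[of 1] by simp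
qed

lemma products_span_mult: "x \<in> M \<Longrightarrow> y \<in> M \<Longrightarrow> x * y \<in> M"
proof -
  assume "x \<in> M" "y \<in> M"
  then obtain a a' where a: "\<And>J. J \<in> JJ \<Longrightarrow> a J \<in> R" "x = (\<Sum>J\<in>JJ. a J * basis_product A b J)"
    "\<And>J. J \<in> JJ \<Longrightarrow> a' J \<in> R" "y = (\<Sum>J\<in>JJ. a' J * basis_product A b J)" by (elim M_E) blast
  have base: "basis_product A b J * basis_product A b J' \<in> M" if J: "J \<in> JJ" "J' \<in> JJ" for J J'
  proof -
    have "\<forall>i. \<exists>c. i \<in> A \<longrightarrow> b i (J i) * b i (J' i) = (\<Sum>k<r i. of_int (c k) * b i k)"
      using mult PiE_mem[OF J(1)] PiE_mem[OF J(2)] unfolding int_span_def by blast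
    from choice[OF this] obtain c where c: "\<forall>i. i \<in> A \<longrightarrow> b i (J i) * b i (J' i) = (\<Sum>k<r i. of_int (c i k) * b i k)" ..
    have "basis_product A b J * basis_product A b J' = (\<Prod>i\<in>A. b i (J i) * b i (J' i))"
      by (simp add: basis_product_def prod.distrib)
    also have "\<dots> = (\<Prod>i\<in>A. \<Sum>k<r i. of_int (c i k) * b i k)" using c by (intro prod.cong) auto
    also have "\<dots> = (\<Sum>J''\<in>JJ. \<Prod>i\<in>A. of_int (c i (J'' i)) * b i (J'' i))" by (rule prod_sum_PiE[OF A]) simp
    also have "\<dots> = (\<Sum>J''\<in>JJ. of_int (\<Prod>i\<in>A. c i (J'' i)) * basis_product A b J'')"
      by (simp add: basis_product_def prod.distrib)
    also have "\<dots> \<in> M" by (rule M_I) (rule R(1))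
    finally show ?thesis .
  qed
  have "x * y = (\<Sum>J\<in>JJ. \<Sum>J'\<in>JJ. (a J * a' J') * (basis_product A b J * basis_product A b J'))"
    unfolding a(2,4) sum_product by (simp add: mult_ac)
  also have "\<dots> \<in> M"
    by (rule products_span_sum, rule products_span_sum, rule products_span_scale, rule R(3), erule a(1), erule a(3), rule base)
  finally show ?thesis .
qed

private lemma one_basis: "restrict (\<lambda>_. 0) A \<in> JJ" "basis_product A b (restrict (\<lambda>_. 0) A) = 1"
  using r b0 by (force simp: basis_product_def)+

lemma products_span_coeff_ring: "x \<in> R \<Longrightarrow> x \<in> M"
  using products_span_scale[of x 1] products_span_base[OF one_basis(1)] one_basis(2) by simp

lemma products_span_factor:
  assumes i: "i \<in> A" and j: "j < r i" shows "b i j \<in> M"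
proof -
  define J where "J = (restrict (\<lambda>_. 0) A)(i := j)"
  have J: "J i = j" "\<And>k. k \<in> A - {i} \<Longrightarrow> J k = 0" by (auto simp: J_def)
  have "J \<in> JJ" unfolding J_def using i j r by (force simp: PiE_def extensional_def)
  then have m: "basis_product A b J \<in> M" by (rule products_span_base)
  have "basis_product A b J = b i (J i) * (\<Prod>k\<in>A - {i}. b k (J k))"
    unfolding basis_product_def by (rule prod.remove[OF A i])
  also have "(\<Prod>k\<in>A - {i}. b k (J k)) = (\<Prod>k\<in>A - {i}. 1)" by (rule prod.cong) (simp_all add: J b0)
  finally have "basis_product A b J = b i j" by (simp add: J(1))
  then show ?thesis using m by simp
qed

end

section \<open>Algebraic numbers and generated fields\<close>

lemma algebraic_if_multiple_algebraic_int:
  assumes "a \<noteq> 0" "algebraic_int (of_int a * x :: complex)" shows "algebraic x"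
proof -
  obtain p where p: "lead_coeff p = 1" "\<forall>i. Polynomial.coeff p i \<in> \<int>" "poly p (of_int a * x) = 0"
    using assms(2) by (auto elim: algebraic_int.cases)
  define n where "n = Polynomial.degree p"
  define q where "q = (\<Sum>i\<le>n. Polynomial.monom (Polynomial.coeff p i * of_int a ^ i) i)"
  have co: "Polynomial.coeff q i = (if i \<le> n then Polynomial.coeff p i * of_int a ^ i else 0)" for i
    by (auto simp: q_def coeff_sum)
  have "\<forall>i. Polynomial.coeff q i \<in> \<int>" using p(2) by (auto simp: co)
  moreover have "Polynomial.coeff q n \<noteq> 0" using p(1) assms(1) by (simp add: co n_def)
  then have "q \<noteq> 0" by auto
  moreover have "poly q x = 0"
  proof -
    have "poly q x = (\<Sum>i\<le>n. Polynomial.coeff p i * (of_int a * x) ^ i)"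
      by (simp add: q_def poly_sum poly_monom power_mult_distrib mult.assoc)
    also have "\<dots> = poly p (of_int a * x)" by (simp add: poly_altdef n_def)
    finally show ?thesis using p(3) by simp
  qed
  ultimately show ?thesis unfolding algebraic_def by blast
qed

lemma algebraic_add_mult:
  assumes x: "algebraic (x :: complex)" and y: "algebraic y"
  shows algebraic_add: "algebraic (x + y)" and algebraic_mult: "algebraic (x * y)"
proof -
  obtain a :: int where a: "a > 0" "algebraic_int (of_int a * x)" using algebraic_multiple_algebraic_int[OF x] by blast
  obtain c :: int where c: "c > 0" "algebraic_int (of_int c * y)" using algebraic_multiple_algebraic_int[OF y] by blast
  have "algebraic_int (of_int c * (of_int a * x) + of_int a * (of_int c * y))"
    by (intro algebraic_int_plus algebraic_int_times[OF algebraic_int_of_int] a c)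
  then have "algebraic_int (of_int (a * c) * (x + y))" by (simp add: algebra_simps)
  then show "algebraic (x + y)" using a c by (intro algebraic_if_multiple_algebraic_int[of "a * c"]) auto
  have "algebraic_int ((of_int a * x) * (of_int c * y))" by (rule algebraic_int_times[OF a(2) c(2)])
  then have "algebraic_int (of_int (a * c) * (x * y))" by (simp add: algebra_simps)
  then show "algebraic (x * y)" using a c by (intro algebraic_if_multiple_algebraic_int[of "a * c"]) auto
qed

text \<open>The inverse of an algebraic number is a rational polynomial in it.\<close>

lemma subfield_if_algebraic_ring:
  assumes Q: "\<rat> \<subseteq> R" and add: "\<And>x y. x \<in> R \<Longrightarrow> y \<in> R \<Longrightarrow> x + y \<in> R"
    and mult: "\<And>x y. x \<in> R \<Longrightarrow> y \<in> R \<Longrightarrow> x * y \<in> R" and alg: "\<And>x. x \<in> R \<Longrightarrow> algebraic x"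
  shows "subfield R CC"
proof (rule subfield_CC_I)
  show "1 \<in> R" using Q by auto
  show "x + y \<in> R" "x * y \<in> R" if "x \<in> R" "y \<in> R" for x y using add mult that by auto
  have "-1 \<in> R" using Q by auto
  then show "- x \<in> R" if "x \<in> R" for x using mult[of "-1" x] that by simp
  fix x assume x: "x \<in> R" "x \<noteq> 0"
  obtain m where m: "is_minpoly \<rat> x m" using minpoly_exists_algebraic[OF subfield_Rats alg[OF x(1)]] by blast
  have g: "[:0, 1:] \<in> polys_over \<rat>" by (intro polys_over_pCons[OF subfield_Rats] polys_over_0[OF subfield_Rats]) auto
  obtain u w where u: "u \<in> polys_over \<rat>" "u * [:0, 1:] + w * m = 1"
  proof (rule minpoly_bezout[OF subfield_Rats m g])
    show "poly [:0, 1:] x \<noteq> 0" using x(2) by simp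
  qed
  have "poly (u * [:0, 1:] + w * m) x = 1" by (simp only: u(2)) simp
  then have "poly u x * x = 1" using m by (simp add: is_minpoly_def mult.commute)
  then have "inverse x = poly u x" by (metis inverse_unique mult.commute)
  moreover have "poly u x \<in> R"
    using u(1)
  proof (induction u)
    case 0
    then show ?case using Q by auto
  next
    case (pCons c p)
    have c: "c \<in> \<rat>" using pCons.prems unfolding polys_over_def by (auto dest: spec[of _ 0])
    have "p \<in> polys_over \<rat>" using pCons.prems unfolding polys_over_def
      by (auto simp: coeff_pCons split: nat.splits)
    then show ?case using pCons.IH c Q x(1) add mult by auto
  qed
  ultimately show "inverse x \<in> R" by simp
qed

lemma subfield_Qbar: "subfield Qbar CC"
proof (rule subfield_if_algebraic_ring)
  show "\<rat> \<subseteq> Qbar"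
  proof
    fix x :: complex assume "x \<in> \<rat>"
    then show "x \<in> Qbar"
    proof (cases rule: Rats_cases')
      case (1 a d)
      then have "algebraic_int (of_int d * x)" by simp
      then show ?thesis using 1 algebraic_if_multiple_algebraic_int[of d x] by (simp add: Qbar_def)
    qed
  qed
qed (auto simp: Qbar_def algebraic_add algebraic_mult)

lemma field_gen_algebraic: "S \<subseteq> Qbar \<Longrightarrow> field_gen S \<subseteq> Qbar"
  by (rule field_gen_least[OF subfield_Qbar])

section \<open>A lower bound for the height from a small dual functional\<close>

context
  fixes K E :: "complex set" and r :: nat and b :: "nat \<Rightarrow> complex"
  assumes K: "number_field K" and E: "fin_gen_field E"
    and r: "1 \<le> r" and b0: "b 0 = 1" and B: "rational_basis K r b"
    and mult: "\<And>j k. j < r \<Longrightarrow> k < r \<Longrightarrow> b j * b k \<in> int_span {..<r} b"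
    and ind: "\<And>c. (\<And>j. j < r \<Longrightarrow> c j \<in> E) \<Longrightarrow> (\<Sum>j<r. c j * b j) = 0 \<Longrightarrow> (\<forall>j<r. c j = 0)"
begin

private definition "composite = {\<Sum>j<r. c j * b j | c. \<forall>j<r. c j \<in> E}"

private lemma sE: "subfield E CC" by (rule fin_gen_field_subfield[OF E])

private lemma sub_K: "subfield K CC" by (rule number_field_subfield[OF K])

private lemma bK: "j < r \<Longrightarrow> b j \<in> K" using B by (simp add: rational_basis_def)

private lemma composite_I: "(\<And>j. j < r \<Longrightarrow> c j \<in> E) \<Longrightarrow> (\<Sum>j<r. c j * b j) \<in> composite"
  unfolding composite_def by blast

private lemma composite_E:
  assumes "x \<in> composite" obtains c where "\<And>j. j < r \<Longrightarrow> c j \<in> E" "x = (\<Sum>j<r. c j * b j)"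
  using assms unfolding composite_def by blast

private lemma E_composite: "E \<subseteq> composite"
proof
  fix x assume x: "x \<in> E"
  have "(\<Sum>j<r. (if j = 0 then x else 0) * b j) = (\<Sum>j<r. if j = 0 then x else 0)"
    by (rule sum.cong) (auto simp: b0)
  also have "\<dots> = x" using r by (simp add: sum.delta)
  finally show "x \<in> composite" using composite_I[of "\<lambda>j. if j = 0 then x else 0"] x sf_0[OF sE] by simp
qed

private lemma K_composite: "K \<subseteq> composite"
proof
  fix x assume "x \<in> K"
  then obtain c where c: "\<forall>j<r. c j \<in> \<rat>" "x = (\<Sum>j<r. c j * b j)" using B unfolding rational_basis_def by blast
  show "x \<in> composite" unfolding c(2) using c(1) sf_Rats[OF sE] by (intro composite_I) blast
qed

private definition "structure_consts = (SOME N. \<forall>j<r. \<forall>k<r. b j * b k = (\<Sum>l<r. of_int (N j k l) * b l))"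

private lemma structure_consts:
  "j < r \<Longrightarrow> k < r \<Longrightarrow> b j * b k = (\<Sum>l<r. of_int (structure_consts j k l) * b l)"
proof -
  have "\<forall>jk. \<exists>N. fst jk < r \<longrightarrow> snd jk < r \<longrightarrow> b (fst jk) * b (snd jk) = (\<Sum>l<r. of_int (N l) * b l)"
    using mult unfolding int_span_def by blast
  from choice[OF this] obtain N where
    N: "\<forall>jk. fst jk < r \<longrightarrow> snd jk < r \<longrightarrow> b (fst jk) * b (snd jk) = (\<Sum>l<r. of_int (N jk l) * b l)" ..
  have "\<exists>N. \<forall>j<r. \<forall>k<r. b j * b k = (\<Sum>l<r. of_int (N j k l) * b l)"
    by (rule exI[of _ "\<lambda>j k. N (j, k)"]) (use N in auto)
  from someI_ex[OF this] show "j < r \<Longrightarrow> k < r \<Longrightarrow> ?thesis" unfolding structure_consts_def by blast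
qed

private lemma composite_mult_eq:
  "(\<Sum>j<r. c j * b j) * (\<Sum>k<r. c' k * b k) = (\<Sum>l<r. (\<Sum>j<r. \<Sum>k<r. c j * c' k * of_int (structure_consts j k l)) * b l)"
proof -
  have "(\<Sum>j<r. c j * b j) * (\<Sum>k<r. c' k * b k) = (\<Sum>j<r. \<Sum>k<r. c j * c' k * (b j * b k))"
    by (simp add: sum_product mult_ac)
  also have "\<dots> = (\<Sum>j<r. \<Sum>k<r. \<Sum>l<r. c j * c' k * of_int (structure_consts j k l) * b l)"
    by (intro sum.cong refl) (simp add: structure_consts sum_distrib_left mult.assoc)
  also have "\<dots> = (\<Sum>j<r. \<Sum>l<r. \<Sum>k<r. c j * c' k * of_int (structure_consts j k l) * b l)"
    by (rule sum.cong[OF refl], rule sum.swap)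
  also have "\<dots> = (\<Sum>l<r. \<Sum>j<r. \<Sum>k<r. c j * c' k * of_int (structure_consts j k l) * b l)"
    by (rule sum.swap)
  finally show ?thesis by (simp add: sum_distrib_right)
qed

private lemma composite_add: "x \<in> composite \<Longrightarrow> y \<in> composite \<Longrightarrow> x + y \<in> composite"
proof -
  assume "x \<in> composite" "y \<in> composite"
  then obtain c c' where c: "\<And>j. j < r \<Longrightarrow> c j \<in> E" "x = (\<Sum>j<r. c j * b j)" "\<And>j. j < r \<Longrightarrow> c' j \<in> E" "y = (\<Sum>j<r. c' j * b j)"
    by (elim composite_E) blast
  have "x + y = (\<Sum>j<r. (c j + c' j) * b j)" by (simp add: c distrib_right sum.distrib)
  then show ?thesis using composite_I[of "\<lambda>j. c j + c' j"] c sf_add[OF sE] by simp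
qed

private lemma composite_mult: "x \<in> composite \<Longrightarrow> y \<in> composite \<Longrightarrow> x * y \<in> composite"
proof -
  assume "x \<in> composite" "y \<in> composite"
  then obtain c c' where c: "\<And>j. j < r \<Longrightarrow> c j \<in> E" "x = (\<Sum>j<r. c j * b j)" "\<And>j. j < r \<Longrightarrow> c' j \<in> E" "y = (\<Sum>j<r. c' j * b j)"
    by (elim composite_E) blast
  show ?thesis unfolding c(2,4) composite_mult_eq
    using c(1,3) by (intro composite_I sf_sum[OF sE] sf_mult[OF sE] sf_of_int[OF sE]) auto
qed

private lemma E_algebraic: "x \<in> E \<Longrightarrow> algebraic x"
  using E field_gen_algebraic unfolding fin_gen_field_def Qbar_def by blast

private lemma composite_algebraic: "x \<in> composite \<Longrightarrow> algebraic x"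
proof -
  assume "x \<in> composite"
  then obtain c where c: "\<And>j. j < r \<Longrightarrow> c j \<in> E" "x = (\<Sum>j<r. c j * b j)" by (elim composite_E) blast
  have "c j \<in> Qbar" "b j \<in> Qbar" if "j < r" for j
    using E_algebraic[OF c(1)[OF that]] number_field_algebraic[OF K bK[OF that]] by (auto simp: Qbar_def)
  then have "x \<in> Qbar" unfolding c(2) by (intro sf_sum[OF subfield_Qbar] sf_mult[OF subfield_Qbar]) auto
  then show ?thesis by (simp add: Qbar_def)
qed

private lemma composite_subfield: "subfield composite CC"
  by (rule subfield_if_algebraic_ring)
     (use E_composite sf_Rats[OF sE] composite_add composite_mult composite_algebraic in auto)

private lemma composite_fin_gen: "fin_gen_field composite"
proof -
  obtain S where S: "finite S" "S \<subseteq> Qbar" "E = field_gen S" using E by (auto simp: fin_gen_field_def)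
  let ?T = "S \<union> b ` {..<r}"
  have bQ: "b ` {..<r} \<subseteq> Qbar" using number_field_algebraic[OF K bK] by (auto simp: Qbar_def)
  have ET: "E \<subseteq> field_gen ?T" unfolding S(3) by (rule field_gen_mono) simp
  have "composite = field_gen ?T"
  proof
    show "field_gen ?T \<subseteq> composite"
      using field_gen_incl[of S] S(3) E_composite bK K_composite by (intro field_gen_least composite_subfield) auto
    show "composite \<subseteq> field_gen ?T"
    proof
      fix x assume "x \<in> composite"
      then obtain c where c: "\<And>j. j < r \<Longrightarrow> c j \<in> E" "x = (\<Sum>j<r. c j * b j)" by (elim composite_E) blast
      show "x \<in> field_gen ?T" unfolding c(2)
        using c(1) ET field_gen_incl[of ?T]
        by (intro sf_sum[OF field_gen_subfield] sf_mult[OF field_gen_subfield]) auto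
    qed
  qed
  then show ?thesis unfolding fin_gen_field_def using S bQ by (intro exI[of _ ?T]) auto
qed

private definition "composite_coeffs x = (SOME c. (\<forall>j<r. c j \<in> E) \<and> x = (\<Sum>j<r. c j * b j))"

text \<open>An embedding of \<open>E\<close> and one of \<open>K\<close> combine to an embedding of the composite field, because
  the basis of \<open>K\<close> stays independent over \<open>E\<close>.\<close>

private definition "combine \<tau> \<sigma> = restrict (\<lambda>x. \<Sum>j<r. \<tau> (composite_coeffs x j) * \<sigma> (b j)) composite"

private lemma combine_eq:
  assumes c: "\<And>j. j < r \<Longrightarrow> c j \<in> E"
  shows "combine \<tau> \<sigma> (\<Sum>j<r. c j * b j) = (\<Sum>j<r. \<tau> (c j) * \<sigma> (b j))"
proof -
  let ?x = "\<Sum>j<r. c j * b j" and ?c = "composite_coeffs (\<Sum>j<r. c j * b j)"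
  have "\<exists>c'. (\<forall>j<r. c' j \<in> E) \<and> ?x = (\<Sum>j<r. c' j * b j)" using c by (intro exI[of _ c]) simp
  from someI_ex[OF this] have c': "\<And>j. j < r \<Longrightarrow> ?c j \<in> E" "?x = (\<Sum>j<r. ?c j * b j)" unfolding composite_coeffs_def by blast+
  have "(\<Sum>j<r. (c j - ?c j) * b j) = ?x - (\<Sum>j<r. ?c j * b j)" by (simp add: left_diff_distrib sum_subtractf)
  also have "\<dots> = 0" using c'(2) by simp
  finally have "\<forall>j<r. c j - ?c j = 0"
    by (intro ind) (auto intro: sf_diff[OF sE] c c'(1))
  then have "(\<Sum>j<r. \<tau> (?c j) * \<sigma> (b j)) = (\<Sum>j<r. \<tau> (c j) * \<sigma> (b j))" by (intro sum.cong) auto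
  then show ?thesis using composite_I[OF c] by (simp add: combine_def)
qed

private lemma combine_embedding:
  assumes t: "\<tau> \<in> embeddings E" and s: "\<sigma> \<in> embeddings K"
  shows "combine \<tau> \<sigma> \<in> embeddings composite" "restrict (combine \<tau> \<sigma>) E = \<tau>" "restrict (combine \<tau> \<sigma>) K = \<sigma>"
proof -
  have onE: "combine \<tau> \<sigma> x = \<tau> x" if x: "x \<in> E" for x
  proof -
    have "(\<Sum>j<r. (if j = 0 then x else 0) * b j) = (\<Sum>j<r. if j = 0 then x else 0)"
      by (rule sum.cong) (auto simp: b0)
    also have "\<dots> = x" using r by (simp add: sum.delta)
    finally have "combine \<tau> \<sigma> x = (\<Sum>j<r. \<tau> (if j = 0 then x else 0) * \<sigma> (b j))"
      using combine_eq[of "\<lambda>j. if j = 0 then x else 0" \<tau> \<sigma>] x sf_0[OF sE] by simp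
    also have "\<dots> = (\<Sum>j<r. if j = 0 then \<tau> x else 0)"
      by (rule sum.cong) (auto simp: b0 emb_0[OF sE t] emb_1[OF sub_K s])
    also have "\<dots> = \<tau> x" using r by (simp add: sum.delta)
    finally show ?thesis .
  qed
  have onK: "combine \<tau> \<sigma> x = \<sigma> x" if x: "x \<in> K" for x
  proof -
    obtain c where c: "\<forall>j<r. c j \<in> \<rat>" "x = (\<Sum>j<r. c j * b j)" using B x unfolding rational_basis_def by blast
    have cE: "c j \<in> E" "c j \<in> K" if "j < r" for j using c(1) that sf_Rats[OF sE] sf_Rats[OF sub_K] by auto
    have "combine \<tau> \<sigma> x = (\<Sum>j<r. \<tau> (c j) * \<sigma> (b j))" unfolding c(2) by (rule combine_eq) (rule cE)
    also have "\<dots> = (\<Sum>j<r. \<sigma> (c j * b j))"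
      using c(1) cE bK by (intro sum.cong) (auto simp: emb_Rats[OF sE t] emb_Rats[OF sub_K s] emb_mult[OF sub_K s])
    also have "\<dots> = \<sigma> x" unfolding c(2) using cE bK by (intro emb_sum[OF sub_K s, symmetric]) (auto intro: sf_mult[OF sub_K])
    finally show ?thesis .
  qed
  show "restrict (combine \<tau> \<sigma>) E = \<tau>" "restrict (combine \<tau> \<sigma>) K = \<sigma>"
    using t s onE onK by (auto simp: embeddings_def extensional_def fun_eq_iff restrict_def)
  show "combine \<tau> \<sigma> \<in> embeddings composite"
    unfolding embeddings_def
  proof (intro CollectI conjI ballI)
    show "combine \<tau> \<sigma> \<in> extensional composite" by (simp add: combine_def)
    show "combine \<tau> \<sigma> 1 = 1" using onE[OF sf_1[OF sE]] emb_1[OF sE t] by simp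
    fix x y assume "x \<in> composite" "y \<in> composite"
    then obtain c c' where c: "\<And>j. j < r \<Longrightarrow> c j \<in> E" "x = (\<Sum>j<r. c j * b j)" "\<And>j. j < r \<Longrightarrow> c' j \<in> E" "y = (\<Sum>j<r. c' j * b j)"
      by (elim composite_E) blast
    have "x + y = (\<Sum>j<r. (c j + c' j) * b j)" by (simp add: c distrib_right sum.distrib)
    also have "combine \<tau> \<sigma> \<dots> = (\<Sum>j<r. \<tau> (c j + c' j) * \<sigma> (b j))" by (rule combine_eq) (auto intro: sf_add[OF sE] c)
    also have "\<dots> = (\<Sum>j<r. \<tau> (c j) * \<sigma> (b j)) + (\<Sum>j<r. \<tau> (c' j) * \<sigma> (b j))"
      using c by (simp add: emb_add[OF sE t] distrib_right sum.distrib)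
    finally show "combine \<tau> \<sigma> (x + y) = combine \<tau> \<sigma> x + combine \<tau> \<sigma> y"
      unfolding c(2,4) using combine_eq[of c \<tau> \<sigma>, OF c(1)] combine_eq[of c' \<tau> \<sigma>, OF c(3)] by simp
    let ?d = "\<lambda>l. \<Sum>j<r. \<Sum>k<r. c j * c' k * of_int (structure_consts j k l)"
    have dE: "?d l \<in> E" for l using c(1,3) by (intro sf_sum[OF sE] sf_mult[OF sE] sf_of_int[OF sE]) auto
    have td: "\<tau> (?d l) = (\<Sum>j<r. \<Sum>k<r. \<tau> (c j) * \<tau> (c' k) * of_int (structure_consts j k l))" for l
    proof -
      have m: "c j * c' k \<in> E" "c j * c' k * of_int (structure_consts j k l) \<in> E" if "j < r" "k < r" for j k
        using c(1)[OF that(1)] c(3)[OF that(2)] by (auto intro: sf_mult[OF sE] sf_of_int[OF sE])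
      have "\<tau> (?d l) = (\<Sum>j<r. \<tau> (\<Sum>k<r. c j * c' k * of_int (structure_consts j k l)))"
        using m by (intro emb_sum[OF sE t] sf_sum[OF sE]) auto
      also have "\<dots> = (\<Sum>j<r. \<Sum>k<r. \<tau> (c j * c' k * of_int (structure_consts j k l)))"
        using m by (intro sum.cong refl emb_sum[OF sE t]) auto
      also have "\<dots> = (\<Sum>j<r. \<Sum>k<r. \<tau> (c j) * \<tau> (c' k) * of_int (structure_consts j k l))"
        using m c by (intro sum.cong refl) (auto simp: emb_mult[OF sE t] sf_of_int[OF sE] emb_of_int[OF sE t])
      finally show ?thesis .
    qed
    have "(\<Sum>l<r. \<tau> (?d l) * \<sigma> (b l)) = (\<Sum>l<r. \<Sum>j<r. \<Sum>k<r. \<tau> (c j) * \<tau> (c' k) * of_int (structure_consts j k l) * \<sigma> (b l))"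
      by (simp add: td sum_distrib_right)
    also have "\<dots> = (\<Sum>j<r. \<Sum>l<r. \<Sum>k<r. \<tau> (c j) * \<tau> (c' k) * of_int (structure_consts j k l) * \<sigma> (b l))"
      by (rule sum.swap)
    also have "\<dots> = (\<Sum>j<r. \<Sum>k<r. \<Sum>l<r. \<tau> (c j) * \<tau> (c' k) * of_int (structure_consts j k l) * \<sigma> (b l))"
      by (rule sum.cong[OF refl], rule sum.swap)
    also have "\<dots> = (\<Sum>j<r. \<Sum>k<r. (\<tau> (c j) * \<sigma> (b j)) * (\<tau> (c' k) * \<sigma> (b k)))"
    proof (intro sum.cong refl)
      fix j k assume jk: "j \<in> {..<r}" "k \<in> {..<r}"
      have "(\<Sum>l<r. of_int (structure_consts j k l) * \<sigma> (b l)) = (\<Sum>l<r. \<sigma> (of_int (structure_consts j k l) * b l))"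
        by (intro sum.cong refl) (auto simp: emb_mult[OF sub_K s] emb_of_int[OF sub_K s] sf_of_int[OF sub_K] bK)
      also have "\<dots> = \<sigma> (\<Sum>l<r. of_int (structure_consts j k l) * b l)"
        using bK by (intro emb_sum[OF sub_K s, symmetric]) (auto intro!: sf_mult[OF sub_K] sf_of_int[OF sub_K])
      also have "\<dots> = \<sigma> (b j * b k)" using jk structure_consts by simp
      also have "\<dots> = \<sigma> (b j) * \<sigma> (b k)" using jk bK by (simp add: emb_mult[OF sub_K s])
      finally have "(\<Sum>l<r. of_int (structure_consts j k l) * \<sigma> (b l)) = \<sigma> (b j) * \<sigma> (b k)" .
      then show "(\<Sum>l<r. \<tau> (c j) * \<tau> (c' k) * of_int (structure_consts j k l) * \<sigma> (b l)) = (\<tau> (c j) * \<sigma> (b j)) * (\<tau> (c' k) * \<sigma> (b k))"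
        by (simp add: mult.assoc flip: sum_distrib_left)
    qed
    also have "\<dots> = (\<Sum>j<r. \<tau> (c j) * \<sigma> (b j)) * (\<Sum>k<r. \<tau> (c' k) * \<sigma> (b k))" by (rule sum_product[symmetric])
    also have "\<dots> = combine \<tau> \<sigma> x * combine \<tau> \<sigma> y"
      unfolding c(2,4) by (intro arg_cong2[where f = "(*)"] combine_eq[symmetric]) (rule c(1), assumption, rule c(3), assumption)
    finally show "combine \<tau> \<sigma> (x * y) = combine \<tau> \<sigma> x * combine \<tau> \<sigma> y"
      unfolding c(2,4) composite_mult_eq combine_eq[of ?d, OF dE] .
  qed
qed

private lemma combine_bij: "bij_betw (\<lambda>(\<tau>, \<sigma>). combine \<tau> \<sigma>) (embeddings E \<times> embeddings K) (embeddings composite)"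
proof (rule bij_betw_byWitness[where f' = "\<lambda>\<rho>. (restrict \<rho> E, restrict \<rho> K)"])
  show "\<forall>p\<in>embeddings E \<times> embeddings K. (\<lambda>\<rho>. (restrict \<rho> E, restrict \<rho> K)) ((\<lambda>(\<tau>, \<sigma>). combine \<tau> \<sigma>) p) = p"
    by (auto simp: combine_embedding)
  show "(\<lambda>(\<tau>, \<sigma>). combine \<tau> \<sigma>) ` (embeddings E \<times> embeddings K) \<subseteq> embeddings composite"
    using combine_embedding(1) by fast
  show "(\<lambda>\<rho>. (restrict \<rho> E, restrict \<rho> K)) ` embeddings composite \<subseteq> embeddings E \<times> embeddings K"
    using emb_restrict[OF composite_subfield _ sE E_composite] emb_restrict[OF composite_subfield _ sub_K K_composite] by fast
  show "\<forall>\<rho>\<in>embeddings composite. (\<lambda>(\<tau>, \<sigma>). combine \<tau> \<sigma>) (restrict \<rho> E, restrict \<rho> K) = \<rho>"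
  proof
    fix \<rho> assume p: "\<rho> \<in> embeddings composite"
    have t: "restrict \<rho> E \<in> embeddings E" by (rule emb_restrict[OF composite_subfield p sE E_composite])
    have s: "restrict \<rho> K \<in> embeddings K" by (rule emb_restrict[OF composite_subfield p sub_K K_composite])
    have "combine (restrict \<rho> E) (restrict \<rho> K) = \<rho>"
    proof (rule embeddings_eqI[OF combine_embedding(1)[OF t s] p])
      fix x assume "x \<in> composite"
      then obtain c where c: "\<And>j. j < r \<Longrightarrow> c j \<in> E" "x = (\<Sum>j<r. c j * b j)" by (elim composite_E) blast
      have m: "c j \<in> composite" "b j \<in> composite" if "j < r" for j
        using c(1)[OF that] bK[OF that] E_composite K_composite by auto
      have "combine (restrict \<rho> E) (restrict \<rho> K) x = (\<Sum>j<r. restrict \<rho> E (c j) * restrict \<rho> K (b j))"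
        unfolding c(2) by (rule combine_eq) (rule c(1))
      also have "\<dots> = (\<Sum>j<r. \<rho> (c j) * \<rho> (b j))" using c(1) bK by (intro sum.cong) auto
      also have "\<dots> = (\<Sum>j<r. \<rho> (c j * b j))" using m by (intro sum.cong) (auto simp: emb_mult[OF composite_subfield p])
      also have "\<dots> = \<rho> x" unfolding c(2)
        using m by (intro emb_sum[OF composite_subfield p, symmetric]) (auto intro: sf_mult[OF composite_subfield])
      finally show "combine (restrict \<rho> E) (restrict \<rho> K) x = \<rho> x" .
    qed
    then show "(\<lambda>(\<tau>, \<sigma>). combine \<tau> \<sigma>) (restrict \<rho> E, restrict \<rho> K) = \<rho>" by simp
  qed
qed

text \<open>The last nonzero coefficient \<open>\<beta> k\<close> of \<open>\<alpha>\<close> has norm at least one. Since all later coefficients vanish,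
  the functional \<open>u k\<close> expresses each conjugate of \<open>\<beta> k\<close> through the conjugates of \<open>\<alpha>\<close>, and their product
  is bounded by the height; so a small functional forces a large height.\<close>

lemma height_lower_bound_functional:
  assumes beta: "\<And>j. j < r \<Longrightarrow> \<beta> j \<in> E" "\<And>j. j < r \<Longrightarrow> algebraic_int (\<beta> j)"
    and a: "\<alpha> = (\<Sum>j<r. \<beta> j * b j)" "algebraic_int \<alpha>"
    and nz: "\<exists>j. 1 \<le> j \<and> j < r \<and> \<beta> j \<noteq> 0"
    and tri: "\<And>k i. k < r \<Longrightarrow> i \<le> k \<Longrightarrow> (\<Sum>\<sigma>\<in>embeddings K. \<sigma> (b i) * u k \<sigma>) = (if i = k then 1 else (0::complex))"
    and U: "\<And>k \<sigma>. 1 \<le> k \<Longrightarrow> k < r \<Longrightarrow> \<sigma> \<in> embeddings K \<Longrightarrow> cmod (u k \<sigma>) \<le> U"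
  shows "1 \<le> real (card (embeddings K)) * U * weil_height \<alpha> ^ card (embeddings K)"
proof -
  let ?n = "card (embeddings K)" and ?N = "card (embeddings E)"
  have finK: "finite (embeddings K)" and posK: "?n > 0"
    using fin_gen_field_embeddings[OF number_field_fin_gen[OF K]] by blast+
  have finE: "finite (embeddings E)" and posE: "?N > 0" using fin_gen_field_embeddings[OF E] by blast+
  let ?T = "{j. 1 \<le> j \<and> j < r \<and> \<beta> j \<noteq> 0}"
  have ne: "?T \<noteq> {}" using nz by blast
  define k where "k = Max ?T"
  have k: "1 \<le> k" "k < r" "\<beta> k \<noteq> 0" using Max_in[OF _ ne] by (auto simp: k_def)
  have top: "\<beta> i = 0" if "k < i" "i < r" for i
  proof (rule ccontr)
    assume "\<beta> i \<noteq> 0"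
    then have "i \<le> k" unfolding k_def using that k(1) by (intro Max_ge) auto
    then show False using that by simp
  qed
  obtain \<sigma>0 where s0: "\<sigma>0 \<in> embeddings K" using posK by (metis card_gt_0_iff ex_in_conv)
  have U0: "U \<ge> 0" using U[OF k(1,2) s0] norm_ge_zero order_trans by blast
  let ?H = "\<lambda>\<tau> \<sigma>. max 1 (cmod (combine \<tau> \<sigma> \<alpha>))"
  have one: "cmod (\<tau> (\<beta> k)) \<le> real ?n * U * (\<Prod>\<sigma>\<in>embeddings K. ?H \<tau> \<sigma>)" if t: "\<tau> \<in> embeddings E" for \<tau>
  proof -
    let ?P = "\<Prod>\<sigma>\<in>embeddings K. ?H \<tau> \<sigma>"
    have val: "combine \<tau> \<sigma> \<alpha> = (\<Sum>j<r. \<tau> (\<beta> j) * \<sigma> (b j))" for \<sigma> unfolding a(1) by (rule combine_eq) (rule beta(1))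
    have z: "\<tau> (\<beta> i) = 0" if "k < i" "i < r" for i using top[OF that] emb_0[OF sE t] by simp
    have "\<tau> (\<beta> k) = (\<Sum>\<sigma>\<in>embeddings K. (\<Sum>i<r. \<tau> (\<beta> i) * \<sigma> (b i)) * u k \<sigma>)"
      by (rule triangular_dual_coeff[OF K tri k(2) z, symmetric])
    then have "cmod (\<tau> (\<beta> k)) = cmod (\<Sum>\<sigma>\<in>embeddings K. combine \<tau> \<sigma> \<alpha> * u k \<sigma>)" by (simp only: val)
    also have "\<dots> \<le> (\<Sum>\<sigma>\<in>embeddings K. ?P * U)"
    proof (rule sum_norm_le)
      fix \<sigma> assume s: "\<sigma> \<in> embeddings K"
      have P1: "1 \<le> (\<Prod>\<sigma>\<in>embeddings K - {\<sigma>}. ?H \<tau> \<sigma>)" by (rule prod_ge_1) auto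
      have "cmod (combine \<tau> \<sigma> \<alpha>) \<le> ?H \<tau> \<sigma> * 1" by simp
      also have "\<dots> \<le> ?H \<tau> \<sigma> * (\<Prod>\<sigma>\<in>embeddings K - {\<sigma>}. ?H \<tau> \<sigma>)" using P1 by (intro mult_left_mono) auto
      also have "\<dots> = ?P" by (rule prod.remove[OF finK s, symmetric])
      finally have c: "cmod (combine \<tau> \<sigma> \<alpha>) \<le> ?P" .
      then have "0 \<le> ?P" using norm_ge_zero order_trans by blast
      with c U[OF k(1,2) s] show "cmod (combine \<tau> \<sigma> \<alpha> * u k \<sigma>) \<le> ?P * U"
        unfolding norm_mult by (intro mult_mono) auto
    qed
    finally show ?thesis by (simp add: mult_ac)
  qed
  have aC: "\<alpha> \<in> composite" unfolding a(1) by (rule composite_I) (rule beta(1))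
  have "algebraic \<alpha>" using a(2) by auto
  then obtain m where m: "is_minpoly \<rat> \<alpha> m" using minpoly_exists_algebraic[OF subfield_Rats] by blast
  have "1 \<le> (\<Prod>\<tau>\<in>embeddings E. cmod (\<tau> (\<beta> k)))" by (rule norm_ge_1[OF E beta(1)[OF k(2)] beta(2)[OF k(2)] k(3)])
  also have "\<dots> \<le> (\<Prod>\<tau>\<in>embeddings E. real ?n * U * (\<Prod>\<sigma>\<in>embeddings K. ?H \<tau> \<sigma>))" using one by (intro prod_mono) auto
  also have "\<dots> = (real ?n * U) ^ ?N * (\<Prod>\<tau>\<in>embeddings E. \<Prod>\<sigma>\<in>embeddings K. ?H \<tau> \<sigma>)" by (simp add: prod.distrib)
  also have "(\<Prod>\<tau>\<in>embeddings E. \<Prod>\<sigma>\<in>embeddings K. ?H \<tau> \<sigma>) = (\<Prod>p\<in>embeddings E \<times> embeddings K. max 1 (cmod ((\<lambda>(\<tau>, \<sigma>). combine \<tau> \<sigma>) p \<alpha>)))"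
    by (simp add: prod.cartesian_product case_prod_unfold)
  also have "\<dots> = (\<Prod>\<rho>\<in>embeddings composite. max 1 (cmod (\<rho> \<alpha>)))"
    by (rule prod.reindex_bij_betw[OF combine_bij, of "\<lambda>\<rho>. max 1 (cmod (\<rho> \<alpha>))"])
  also have "\<dots> = weil_height \<alpha> ^ card (embeddings composite)"
    by (rule prod_embeddings_weil_height(1)[OF a(2) m composite_fin_gen aC])
  also have "card (embeddings composite) = ?N * ?n"
    using bij_betw_same_card[OF combine_bij] by (simp add: card_cartesian_product)
  also have "(real ?n * U) ^ ?N * weil_height \<alpha> ^ (?N * ?n) = (real ?n * U * weil_height \<alpha> ^ ?n) ^ ?N"
    by (simp only: power_mult_distrib) (simp add: mult.commute flip: power_mult)
  finally have "1 \<le> (real ?n * U * weil_height \<alpha> ^ ?n) ^ ?N" .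
  moreover have "0 \<le> real ?n * U * weil_height \<alpha> ^ ?n"
    using U0 prod_embeddings_weil_height(2)[OF a(2) m composite_fin_gen aC] by auto
  ultimately show ?thesis using posE by (metis linorder_not_le power_less_one_iff)
qed

end

section \<open>Height and degree of elements of the composite\<close>

lemma reduced_basis_rational:
  assumes K: "number_field K" and red: "reduced_basis K r b u \<mu> m"
  shows "rational_basis K r b"
  unfolding rational_basis_def
proof (intro conjI ballI)
  note sK = number_field_subfield[OF K]
  have G: "ring_of_integers K = int_span {..<r} b" and bG: "\<And>i. i < r \<Longrightarrow> b i \<in> ring_of_integers K"
    and tri: "\<And>k i. k < r \<Longrightarrow> i \<le> k \<Longrightarrow> (\<Sum>\<sigma>\<in>embeddings K. \<sigma> (b i) * u k \<sigma>) = (if i = k then 1 else (0::complex))"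
    using red by (auto simp: reduced_basis_def)
  have bK: "b i \<in> K" if "i < r" for i using bG[OF that] by (simp add: ring_of_integers_def)
  show "\<forall>j<r. b j \<in> K" using bK by simp
  show "\<forall>c. (\<forall>j<r. c j \<in> \<rat>) \<longrightarrow> (\<Sum>j<r. c j * b j) = 0 \<longrightarrow> (\<forall>j<r. c j = 0)"
  proof (intro allI impI)
    fix c j assume "\<forall>j<r. c j \<in> \<rat>" "(\<Sum>j<r. c j * b j) = 0" "j < r"
    then show "c j = 0" using triangular_rational_independent[OF K bK tri, where c = c] by blast
  qed
  fix x assume x: "x \<in> K"
  obtain a :: int where a: "a > 0" "algebraic_int (of_int a * x)"
    using algebraic_multiple_algebraic_int[OF number_field_algebraic[OF K x]] by blast
  then have "of_int a * x \<in> int_span {..<r} b"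
    using x unfolding G[symmetric] by (auto simp: ring_of_integers_def intro!: sf_mult[OF sK] sf_of_int[OF sK])
  then obtain c where c: "of_int a * x = (\<Sum>i<r. of_int (c i) * b i)" unfolding int_span_def by blast
  have "x = of_int a * x / of_int a" using a(1) by simp
  also have "\<dots> = (\<Sum>i<r. of_int (c i) / of_int a * b i)" unfolding c by (simp add: sum_divide_distrib)
  finally show "\<exists>c. (\<forall>j<r. c j \<in> \<rat>) \<and> x = (\<Sum>j<r. c j * b j)"
    by (intro exI[of _ "\<lambda>i. of_int (c i) / of_int a"] conjI allI impI Rats_divide Rats_of_int)
qed

lemma reduced_basis_mult:
  assumes K: "number_field K" and red: "reduced_basis K r b u \<mu> m" and jk: "j < r" "k < r"
  shows "b j * b k \<in> int_span {..<r} b"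
proof -
  have "b j * b k \<in> ring_of_integers K"
    using red jk by (intro subring_of_integers[OF number_field_subfield[OF K]]) (auto simp: reduced_basis_def)
  then show ?thesis using red by (simp add: reduced_basis_def)
qed

lemma sum_PiE_remove:
  assumes A: "finite A" "i \<in> A" and T: "\<And>k. k \<in> A \<Longrightarrow> finite (T k)"
  shows "(\<Sum>J\<in>PiE A T. f J) = (\<Sum>j\<in>T i. \<Sum>J\<in>PiE (A - {i}) T. f (J(i := j)))"
proof -
  have eq: "PiE A T = (\<lambda>(j, J). J(i := j)) ` (T i \<times> PiE (A - {i}) T)"
    using PiE_insert_eq[of i "A - {i}" T] A by (simp add: insert_absorb)
  have inj: "inj_on (\<lambda>(j, J). J(i := j)) (T i \<times> PiE (A - {i}) T)" by (rule inj_combinator) simp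
  show ?thesis unfolding eq sum.reindex[OF inj] by (simp add: case_prod_unfold sum.cartesian_product)
qed

lemma basis_product_upd:
  assumes "finite A" "i \<in> A"
  shows "basis_product A b (J(i := j)) = b i j * basis_product (A - {i}) b J"
proof -
  have "(\<Prod>k\<in>A - {i}. b k ((J(i := j)) k)) = (\<Prod>k\<in>A - {i}. b k (J k))" by (rule prod.cong) auto
  then show ?thesis unfolding basis_product_def prod.remove[OF assms] by simp
qed

text \<open>A conjugate of \<open>\<alpha>\<close> over \<open>L\<close> is the image under an embedding that fixes \<open>L\<close>, and this image depends
  only on the restrictions of the embedding to the fields \<open>K i\<close>.\<close>

lemma degree_le_card_embeddings:
  assumes L: "subfield L CC" and S: "finite S" and K: "\<And>i. i \<in> S \<Longrightarrow> number_field (K i)"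
    and alg: "algebraic \<alpha>" and \<alpha>: "\<alpha> = (\<Sum>J\<in>\<J>. a J * (\<Prod>i\<in>S. x i J))"
    and a: "\<And>J. J \<in> \<J> \<Longrightarrow> a J \<in> L" and x: "\<And>i J. i \<in> S \<Longrightarrow> J \<in> \<J> \<Longrightarrow> x i J \<in> K i"
  shows "ext_degree L (adjoin L \<alpha>) \<le> (\<Prod>i\<in>S. card (embeddings (K i)))" "ext_degree L (adjoin L \<alpha>) \<ge> 1"
proof -
  obtain m where m: "is_minpoly L \<alpha> m" using minpoly_exists_algebraic[OF L alg] by blast
  have deg: "ext_degree L (adjoin L \<alpha>) = Polynomial.degree m" by (rule ext_degree_adjoin[OF L m])
  show "ext_degree L (adjoin L \<alpha>) \<ge> 1" using minpoly_degree_pos[OF m] deg by simp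
  have "\<forall>i. \<exists>T. i \<in> S \<longrightarrow> finite T \<and> T \<subseteq> Qbar \<and> K i = field_gen T"
    using number_field_fin_gen[OF K] unfolding fin_gen_field_def by blast
  from choice[OF this] obtain T where T: "\<forall>i. i \<in> S \<longrightarrow> finite (T i) \<and> T i \<subseteq> Qbar \<and> K i = field_gen (T i)" ..
  define F where "F = field_gen (adjoin L \<alpha> \<union> (\<Union>i\<in>S. T i))"
  have sF: "subfield F CC" unfolding F_def by (rule field_gen_subfield)
  have EF: "adjoin L \<alpha> \<subseteq> F" using field_gen_incl[of "adjoin L \<alpha> \<union> (\<Union>i\<in>S. T i)"] unfolding F_def by blast
  have LF: "L \<subseteq> F" "\<alpha> \<in> F" using EF adjoin_incl[of L \<alpha>] adjoin_gen[of \<alpha> L] by blast+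
  have KF: "K i \<subseteq> F" if i: "i \<in> S" for i
  proof -
    have "T i \<subseteq> adjoin L \<alpha> \<union> (\<Union>i\<in>S. T i)" using i by blast
    then have "field_gen (T i) \<subseteq> F" unfolding F_def by (rule field_gen_mono)
    then show ?thesis using T i by simp
  qed
  let ?id = "restrict id L"
  have idL: "?id \<in> embeddings L" using sf_1[OF L] sf_add[OF L] sf_mult[OF L] by (auto simp: embeddings_def)
  have mid: "map_poly ?id m = m"
    using m by (intro poly_eqI) (auto simp: coeff_map_poly is_minpoly_def polys_over_def sf_0[OF L])
  have rf: "rsquarefree m" using minpoly_map_rsquarefree[OF L m idL] by (simp only: mid)
  define Z where "Z = {z. poly m z = 0}"
  have Z: "card Z = Polynomial.degree m" unfolding Z_def by (rule rsquarefree_card_roots[OF rf])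
  have "\<forall>z. \<exists>\<rho>. z \<in> Z \<longrightarrow> \<rho> \<in> embeddings F \<and> restrict \<rho> L = ?id \<and> \<rho> \<alpha> = z"
  proof
    fix z
    show "\<exists>\<rho>. z \<in> Z \<longrightarrow> \<rho> \<in> embeddings F \<and> restrict \<rho> L = ?id \<and> \<rho> \<alpha> = z"
    proof (cases "z \<in> Z")
      case True
      then have "poly (map_poly ?id m) z = 0" unfolding mid by (simp add: Z_def)
      then obtain \<tau> where t: "\<tau> \<in> embeddings (adjoin L \<alpha>)" "restrict \<tau> L = ?id" "\<tau> \<alpha> = z"
        using simple_extension_embedding_exists[OF L m idL] by metis
      have T': "finite (\<Union>i\<in>S. T i)" "(\<Union>i\<in>S. T i) \<subseteq> Qbar" using S T by auto
      obtain k where k: "k > 0" "card {\<sigma> \<in> embeddings F. restrict \<sigma> (adjoin L \<alpha>) = \<tau>} = k"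
      proof (rule extension_fibers_same_card[OF adjoin_subfield[of L \<alpha>] T'], fold F_def)
        fix k assume "0 < k"
          "\<And>\<tau>. \<tau> \<in> embeddings (adjoin L \<alpha>) \<Longrightarrow> card {\<sigma> \<in> embeddings F. restrict \<sigma> (adjoin L \<alpha>) = \<tau>} = k"
        from this(1) this(2)[OF t(1)] show thesis by (rule that)
      qed
      then have "{\<sigma> \<in> embeddings F. restrict \<sigma> (adjoin L \<alpha>) = \<tau>} \<noteq> {}" by (intro notI) simp
      then obtain \<rho> where r: "\<rho> \<in> embeddings F" "restrict \<rho> (adjoin L \<alpha>) = \<tau>" by blast
      have "\<rho> y = \<tau> y" if "y \<in> adjoin L \<alpha>" for y using r(2) that by (metis restrict_apply')
      then have "\<rho> \<alpha> = z" "restrict \<rho> L = restrict \<tau> L"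
        using t(3) adjoin_gen[of \<alpha> L] adjoin_incl[of L \<alpha>] by (auto simp: restrict_def fun_eq_iff)
      with r(1) t(2) show ?thesis by (intro exI[of _ \<rho>]) simp
    qed simp
  qed
  from choice[OF this] obtain \<rho> where
    \<rho>: "\<And>z. z \<in> Z \<Longrightarrow> \<rho> z \<in> embeddings F" "\<And>z. z \<in> Z \<Longrightarrow> restrict (\<rho> z) L = ?id" "\<And>z. z \<in> Z \<Longrightarrow> \<rho> z \<alpha> = z" by blast
  define h where "h z = restrict (\<lambda>i. restrict (\<rho> z) (K i)) S" for z
  have val: "z = (\<Sum>J\<in>\<J>. a J * (\<Prod>i\<in>S. h z i (x i J)))" if z: "z \<in> Z" for z
  proof -
    have s: "\<rho> z \<in> embeddings F" by (rule \<rho>(1)[OF z])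
    have xF: "x i J \<in> F" if "i \<in> S" "J \<in> \<J>" for i J using KF x that by blast
    have aF: "a J \<in> F" if "J \<in> \<J>" for J using a LF that by blast
    have fixL: "\<rho> z (a J) = a J" if "J \<in> \<J>" for J
      using fun_cong[OF \<rho>(2)[OF z], of "a J"] a[OF that] by simp
    have "z = \<rho> z \<alpha>" using \<rho>(3)[OF z] by simp
    also have "\<dots> = (\<Sum>J\<in>\<J>. \<rho> z (a J * (\<Prod>i\<in>S. x i J)))"
      unfolding \<alpha> using xF aF by (intro emb_sum[OF sF s] sf_mult[OF sF] sf_prod[OF sF]) auto
    also have "\<dots> = (\<Sum>J\<in>\<J>. a J * (\<Prod>i\<in>S. \<rho> z (x i J)))"
      using xF aF by (intro sum.cong refl) (simp add: emb_mult[OF sF s] emb_prod[OF sF s] sf_prod[OF sF] fixL)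
    also have "\<dots> = (\<Sum>J\<in>\<J>. a J * (\<Prod>i\<in>S. h z i (x i J)))"
      using x by (intro sum.cong refl arg_cong2[where f = "(*)"] prod.cong) (simp add: h_def)
    finally show ?thesis .
  qed
  have "inj_on h Z"
  proof (rule inj_onI)
    fix z z' assume z: "z \<in> Z" "z' \<in> Z" "h z = h z'"
    show "z = z'" by (subst val[OF z(1)], subst val[OF z(2)]) (simp only: z(3))
  qed
  moreover have "h ` Z \<subseteq> PiE S (\<lambda>i. embeddings (K i))"
  proof (rule image_subsetI)
    fix z assume z: "z \<in> Z"
    show "h z \<in> PiE S (\<lambda>i. embeddings (K i))"
      unfolding h_def
      by (rule restrict_PiE_iff[THEN iffD2], rule ballI, rule emb_restrict[OF sF \<rho>(1)[OF z] number_field_subfield[OF K] KF])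
  qed
  moreover have "finite (PiE S (\<lambda>i. embeddings (K i)))"
    using S fin_gen_field_embeddings(1)[OF number_field_fin_gen[OF K]] by (intro finite_PiE) auto
  ultimately have "card Z \<le> card (PiE S (\<lambda>i. embeddings (K i)))" by (rule card_inj_on_le)
  also have "\<dots> = (\<Prod>i\<in>S. card (embeddings (K i)))" by (rule card_PiE[OF S])
  finally show "ext_degree L (adjoin L \<alpha>) \<le> (\<Prod>i\<in>S. card (embeddings (K i)))" using Z deg by simp
qed

context
  fixes L :: "complex set" and K :: "nat \<Rightarrow> complex set" and A :: "nat set" and d :: nat
    and r :: "nat \<Rightarrow> nat" and b :: "nat \<Rightarrow> nat \<Rightarrow> complex" and u :: "nat \<Rightarrow> nat \<Rightarrow> (complex \<Rightarrow> complex) \<Rightarrow> complex"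
    and \<mu> :: "nat \<Rightarrow> real" and m :: "nat \<Rightarrow> int"
  assumes L: "subfield_Qbar L" and ld: "linearly_disjoint_family (K(0 := L))" and A: "finite A" "0 \<notin> A"
    and K: "\<And>i. i \<in> A \<Longrightarrow> number_field (K i)"
    and red: "\<And>i. i \<in> A \<Longrightarrow> reduced_basis (K i) (r i) (b i) (u i) (\<mu> i) (m i)"
begin

private lemma sL: "subfield L CC" using L by (simp add: subfield_Qbar_def)

private lemma L_algebraic: "L \<subseteq> Qbar" using L by (simp add: subfield_Qbar_def)

private lemma r2: "i \<in> A \<Longrightarrow> 2 \<le> r i" and b_0: "i \<in> A \<Longrightarrow> b i 0 = 1"
  using red unfolding reduced_basis_def by blast+

private lemma b_int: "i \<in> A \<Longrightarrow> j < r i \<Longrightarrow> b i j \<in> ring_of_integers (K i)"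
  using red unfolding reduced_basis_def by blast

private lemma r1: "i \<in> A \<Longrightarrow> 1 \<le> r i" using r2 by force

private lemma b_mem: "i \<in> A \<Longrightarrow> j < r i \<Longrightarrow> b i j \<in> K i" "i \<in> A \<Longrightarrow> j < r i \<Longrightarrow> algebraic_int (b i j)"
  using b_int by (auto simp: ring_of_integers_def)

private lemma b_mult: "i \<in> A \<Longrightarrow> j < r i \<Longrightarrow> k < r i \<Longrightarrow> b i j * b i k \<in> int_span {..<r i} (b i)"
  by (rule reduced_basis_mult[OF K red])

private lemma b_rational: "i \<in> A \<Longrightarrow> rational_basis (K i) (r i) (b i)"
  by (rule reduced_basis_rational[OF K red])

lemma integral_composite_products_span:
  "generate_ring CC (ring_of_integers L \<union> (\<Union>i\<in>A. ring_of_integers (K i))) \<subseteq> products_span (ring_of_integers L) A r b"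
proof (rule CC.generate_ring_min_subring1)
  let ?M = "products_span (ring_of_integers L) A r b"
  note R = subring_of_integers(1-3)[OF sL]
  have M_add: "x + y \<in> ?M" if "x \<in> ?M" "y \<in> ?M" for x y
    by (rule products_span_add[OF R A(1) r1 b_0 b_mult that])
  have M_mult: "x * y \<in> ?M" if "x \<in> ?M" "y \<in> ?M" for x y
    by (rule products_span_mult[OF R A(1) r1 b_0 b_mult that])
  have M_ring: "x \<in> ?M" if "x \<in> ring_of_integers L" for x
    by (rule products_span_coeff_ring[OF R A(1) r1 b_0 b_mult that])
  have M_scale: "c * x \<in> ?M" if "c \<in> ring_of_integers L" "x \<in> ?M" for c x
    by (rule products_span_scale[OF R A(1) r1 b_0 b_mult that])
  show "subring ?M CC"
  proof (rule CC.subringI)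
    show "\<ominus>\<^bsub>CC\<^esub> x \<in> ?M" if "x \<in> ?M" for x
      using M_scale[of "of_int (- 1)" x] R(1)[of "- 1"] that by simp
    show "\<one>\<^bsub>CC\<^esub> \<in> ?M" using M_ring[of 1] R(1)[of 1] by simp
  qed (auto simp: M_add M_mult)
  have "x \<in> ?M" if i: "i \<in> A" and x: "x \<in> ring_of_integers (K i)" for i x
  proof -
    obtain c where "x = (\<Sum>j<r i. of_int (c j) * b i j)"
      using x red[OF i] unfolding reduced_basis_def int_span_def by blast
    then show ?thesis by (auto intro!: products_span_sum[OF R A(1) r1 b_0 b_mult] M_scale R(1) products_span_factor[OF R A(1) r1 b_0 b_mult i])
  qed
  then show "ring_of_integers L \<union> (\<Union>i\<in>A. ring_of_integers (K i)) \<subseteq> ?M" using M_ring by blast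
qed simp

private abbreviation "JJ' B \<equiv> PiE B (\<lambda>i. {..<r i})"

private lemma span_closed:
  assumes B: "B \<subseteq> A"
  shows "x \<in> L \<Longrightarrow> x \<in> products_span L B r b" "i \<in> B \<Longrightarrow> j < r i \<Longrightarrow> b i j \<in> products_span L B r b"
    "x \<in> products_span L B r b \<Longrightarrow> y \<in> products_span L B r b \<Longrightarrow> x + y \<in> products_span L B r b"
    "x \<in> products_span L B r b \<Longrightarrow> y \<in> products_span L B r b \<Longrightarrow> x * y \<in> products_span L B r b"
proof -
  have B': "finite B" "\<And>i. i \<in> B \<Longrightarrow> 1 \<le> r i" "\<And>i. i \<in> B \<Longrightarrow> b i 0 = 1"
    "\<And>i j k. i \<in> B \<Longrightarrow> j < r i \<Longrightarrow> k < r i \<Longrightarrow> b i j * b i k \<in> int_span {..<r i} (b i)"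
    using A(1) r1 b_0 b_mult B by (auto intro: finite_subset)
  note C = sf_of_int[OF sL] sf_add[OF sL] sf_mult[OF sL] B'
  show "x \<in> L \<Longrightarrow> x \<in> products_span L B r b" by (rule products_span_coeff_ring[of L B r b]; (rule C; assumption)?)
  show "i \<in> B \<Longrightarrow> j < r i \<Longrightarrow> b i j \<in> products_span L B r b"
    by (rule products_span_factor[of L B r b]; (rule C; assumption)?)
  show "x \<in> products_span L B r b \<Longrightarrow> y \<in> products_span L B r b \<Longrightarrow> x + y \<in> products_span L B r b"
    by (rule products_span_add[of L B r b]; (rule C; assumption)?)
  show "x \<in> products_span L B r b \<Longrightarrow> y \<in> products_span L B r b \<Longrightarrow> x * y \<in> products_span L B r b"
    by (rule products_span_mult[of L B r b]; (rule C; assumption)?)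
qed

private lemma span_subfield:
  assumes B: "B \<subseteq> A" shows "subfield (products_span L B r b) CC"
proof (rule subfield_if_algebraic_ring)
  show "\<rat> \<subseteq> products_span L B r b"
    using span_closed(1)[OF B] sf_Rats[OF sL] by blast
  show "x + y \<in> products_span L B r b" "x * y \<in> products_span L B r b"
    if "x \<in> products_span L B r b" "y \<in> products_span L B r b" for x y
    by (rule span_closed(3)[OF B that], rule span_closed(4)[OF B that])
  fix x assume "x \<in> products_span L B r b"
  then obtain a where a: "\<forall>J\<in>JJ' B. a J \<in> L" "x = (\<Sum>J\<in>JJ' B. a J * basis_product B b J)"
    unfolding products_span_def by blast
  have "b i j \<in> Qbar" if "i \<in> B" "j < r i" for i j
    using b_mem(1)[of i j] number_field_algebraic[OF K[of i]] B that by (auto simp: Qbar_def)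
  then have "x \<in> Qbar" unfolding a(2) basis_product_def
    using a(1) L_algebraic
    by (intro sf_sum[OF subfield_Qbar] sf_mult[OF subfield_Qbar] sf_prod[OF subfield_Qbar]) (auto dest: PiE_mem)
  then show "algebraic x" by (simp add: Qbar_def)
qed

private lemma PiE_upd: "i \<in> A \<Longrightarrow> J \<in> JJ' (A - {i}) \<Longrightarrow> j < r i \<Longrightarrow> J(i := j) \<in> JJ' A"
  by (auto simp: PiE_iff extensional_def)

text \<open>Over the field generated by \<open>L\<close> and the other factors, the basis of one factor stays
  independent: a relation unfolds to one between the products of all the bases.\<close>

private lemma independent_over_other_factors:
  assumes i: "i \<in> A" and c: "\<And>j. j < r i \<Longrightarrow> c j \<in> products_span L (A - {i}) r b"
    and z: "(\<Sum>j<r i. c j * b i j) = 0"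
  shows "\<forall>j<r i. c j = 0"
proof -
  let ?B = "A - {i}"
  have "\<forall>j. \<exists>e. j < r i \<longrightarrow> (\<forall>J\<in>JJ' ?B. e J \<in> L) \<and> c j = (\<Sum>J\<in>JJ' ?B. e J * basis_product ?B b J)"
    using c unfolding products_span_def by blast
  from choice[OF this] obtain e where
    e: "\<And>j J. j < r i \<Longrightarrow> J \<in> JJ' ?B \<Longrightarrow> e j J \<in> L" "\<And>j. j < r i \<Longrightarrow> c j = (\<Sum>J\<in>JJ' ?B. e j J * basis_product ?B b J)"
    by blast
  define a where "a J = e (J i) (restrict J ?B)" for J
  have aL: "a J \<in> L" if J: "J \<in> JJ' A" for J
    unfolding a_def using PiE_mem[OF J] i by (intro e(1)) (auto simp: restrict_PiE_iff)
  have upd: "a (J(i := j)) = e j J" if J: "J \<in> JJ' ?B" for J j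
  proof -
    have "restrict (J(i := j)) ?B = J" using J by (auto simp: PiE_def extensional_def fun_eq_iff)
    then show ?thesis by (simp add: a_def)
  qed
  have "(\<Sum>J\<in>JJ' A. a J * basis_product A b J)
      = (\<Sum>j<r i. \<Sum>J\<in>JJ' ?B. a (J(i := j)) * basis_product A b (J(i := j)))"
    by (rule sum_PiE_remove[OF A(1) i]) simp
  also have "\<dots> = (\<Sum>j<r i. \<Sum>J\<in>JJ' ?B. e j J * basis_product ?B b J * b i j)"
    by (intro sum.cong refl) (simp add: upd basis_product_upd[OF A(1) i] mult_ac)
  also have "\<dots> = (\<Sum>j<r i. c j * b i j)"
    by (intro sum.cong refl) (simp add: e(2) sum_distrib_right)
  finally have zero: "(\<Sum>J\<in>JJ' A. a J * basis_product A b J) = 0" using z by simp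
  have ez: "e j J = 0" if j: "j < r i" and J: "J \<in> JJ' ?B" for j J
  proof -
    have "a (J(i := j)) = 0"
      by (rule basis_products_independent[of K L A r b a, OF ld A])
         (erule number_field_subfield[OF K], erule b_rational, erule aL, rule zero, rule PiE_upd[OF i J j])
    then show ?thesis by (simp add: upd[OF J])
  qed
  show ?thesis by (auto simp: e(2) ez)
qed

text \<open>The element \<open>b i 1\<close> does not lie in the field generated by the other factors, so it cannot equal
  \<open>b k 1\<close> up to an integer.\<close>

lemma second_basis_elements_distinct: "inj_on (\<lambda>i. b i 1 - of_int (m i)) A"
proof (rule inj_onI, rule ccontr)
  fix i k assume i: "i \<in> A" and k: "k \<in> A" and eq: "b i 1 - of_int (m i) = b k 1 - of_int (m k)" and ne: "i \<noteq> k"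
  let ?M = "products_span L (A - {i}) r b"
  have sM: "subfield ?M CC" by (rule span_subfield) simp
  have "b k 1 \<in> ?M" using k ne r2[OF k] by (intro span_closed(2)) auto
  then have c0: "of_int (m k) - of_int (m i) - b k 1 \<in> ?M" by (intro sf_diff[OF sM] sf_of_int[OF sM])
  define c where "c j = (if j = 0 then of_int (m k) - of_int (m i) - b k 1 else if j = 1 then 1 else 0)" for j :: nat
  define q where "q = r i - 2"
  have q: "r i = Suc (Suc q)" using r2[OF i] by (simp add: q_def)
  have "(\<Sum>j<r i. c j * b i j) = (of_int (m k) - of_int (m i) - b k 1) * b i 0 + b i 1"
    unfolding q sum.lessThan_Suc_shift by (simp add: c_def)
  also have "\<dots> = 0" using eq b_0[OF i] by (simp add: algebra_simps)
  finally have "(\<Sum>j<r i. c j * b i j) = 0" .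
  moreover have "c j \<in> ?M" for j using c0 sf_0[OF sM] sf_1[OF sM] by (simp add: c_def)
  ultimately have "\<forall>j<r i. c j = 0" by (intro independent_over_other_factors[OF i])
  then have "c 1 = 0" using q by simp
  then show False by (simp add: c_def)
qed

context
  fixes a :: "(nat \<Rightarrow> nat) \<Rightarrow> complex" and \<alpha> :: complex
  assumes a: "\<And>J. J \<in> JJ' A \<Longrightarrow> a J \<in> ring_of_integers L"
    and \<alpha>: "\<alpha> = (\<Sum>J\<in>JJ' A. a J * basis_product A b J)"
begin

private lemma aL: "J \<in> JJ' A \<Longrightarrow> a J \<in> L" "J \<in> JJ' A \<Longrightarrow> algebraic_int (a J)"
  using a by (auto simp: ring_of_integers_def)

private lemma \<alpha>_integer: "algebraic_int \<alpha>"
  unfolding \<alpha> basis_product_def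
  using aL(2) b_mem(2) by (intro algebraic_int_sum algebraic_int_times algebraic_int_prod) auto

private lemma \<alpha>_algebraic: "algebraic \<alpha>"
  using \<alpha>_integer by auto

private definition "involved = {i \<in> A. \<exists>J\<in>JJ' A. a J \<noteq> 0 \<and> J i \<noteq> 0}"

private lemma involved_subset: "involved \<subseteq> A" "finite involved"
  using A(1) by (auto simp: involved_def)

private lemma height_ge_1: "1 \<le> weil_height \<alpha>"
proof -
  obtain p where p: "is_minpoly \<rat> \<alpha> p" using minpoly_exists_algebraic[OF subfield_Rats \<alpha>_algebraic] by blast
  have "fin_gen_field (field_gen {\<alpha>})" using \<alpha>_algebraic by (auto simp: fin_gen_field_def Qbar_def)
  moreover have "\<alpha> \<in> field_gen {\<alpha>}" using field_gen_incl by blast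
  ultimately show ?thesis by (rule prod_embeddings_weil_height(2)[OF \<alpha>_integer p])
qed

text \<open>Collecting the terms of \<open>\<alpha>\<close> by the basis elements of \<open>K i\<close> gives coefficients in the field generated
  by the other factors, and a nontrivial one is nonzero by independence. The functionals of the reduced
  basis are small in terms of \<open>\<mu> i\<close>, so the height bounds \<open>\<mu> i\<close>.\<close>

private lemma height_lower_bound_involved:
  assumes i: "i \<in> involved"
  shows "sqrt (\<mu> i) \<le> real (card (embeddings (K i))) * 2 ^ ext_degree \<rat> (K i) * weil_height \<alpha> ^ card (embeddings (K i))"
proof -
  let ?B = "A - {i}" and ?n = "card (embeddings (K i))" and ?D = "ext_degree \<rat> (K i)"
  have iA: "i \<in> A" using i involved_subset by blast
  have finB: "finite ?B" using A(1) by simp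
  note updA = PiE_upd[OF iA]
  define G where "G = a ` JJ' A \<union> (\<Union>k\<in>?B. b k ` {..<r k})"
  define E where "E = field_gen G"
  have GE: "G \<subseteq> E" unfolding E_def by (rule field_gen_incl)
  have sE: "subfield E CC" unfolding E_def by (rule field_gen_subfield)
  have "finite G" unfolding G_def using A(1) by (intro finite_UnI finite_imageI finite_PiE finite_UN_I) auto
  moreover have "G \<subseteq> Qbar"
    unfolding G_def using aL(2) b_mem(2) by (auto simp: Qbar_def)
  ultimately have E: "fin_gen_field E" unfolding fin_gen_field_def E_def by blast
  have EM: "E \<subseteq> products_span L ?B r b"
    unfolding E_def
  proof (rule field_gen_least)
    show "subfield (products_span L ?B r b) CC" by (rule span_subfield) simp
    have "a J \<in> products_span L ?B r b" if "J \<in> JJ' A" for J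
      by (rule span_closed(1)[OF _ aL(1)[OF that]]) simp
    moreover have "b k j \<in> products_span L ?B r b" if "k \<in> ?B" "j < r k" for k j
      by (rule span_closed(2)[OF _ that]) simp
    ultimately show "G \<subseteq> products_span L ?B r b" unfolding G_def by blast
  qed
  define \<beta> where "\<beta> j = (\<Sum>J\<in>JJ' ?B. a (J(i := j)) * basis_product ?B b J)" for j
  have \<alpha>_eq: "\<alpha> = (\<Sum>j<r i. \<beta> j * b i j)"
  proof -
    have "\<alpha> = (\<Sum>j<r i. \<Sum>J\<in>JJ' ?B. a (J(i := j)) * basis_product A b (J(i := j)))"
      unfolding \<alpha> by (rule sum_PiE_remove[OF A(1) iA]) simp
    also have "\<dots> = (\<Sum>j<r i. \<beta> j * b i j)"
      by (intro sum.cong refl) (simp add: \<beta>_def basis_product_upd[OF A(1) iA] sum_distrib_left mult_ac)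
    finally show ?thesis .
  qed
  have \<beta>_int: "algebraic_int (\<beta> j)" if "j < r i" for j
    unfolding \<beta>_def basis_product_def using updA[OF _ that]
    by (intro algebraic_int_sum algebraic_int_times algebraic_int_prod aL(2) b_mem(2)) auto
  have \<beta>_E: "\<beta> j \<in> E" if j: "j < r i" for j
  proof -
    have "a (J(i := j)) \<in> E" if J: "J \<in> JJ' ?B" for J using GE updA[OF J j] unfolding G_def by blast
    moreover have "b k (J k) \<in> E" if J: "J \<in> JJ' ?B" and k: "k \<in> ?B" for J k
      using GE PiE_mem[OF J k] k unfolding G_def by blast
    ultimately show ?thesis unfolding \<beta>_def basis_product_def
      by (intro sf_sum[OF sE] sf_mult[OF sE] sf_prod[OF sE])
  qed
  have \<beta>_nonzero: "\<exists>j. 1 \<le> j \<and> j < r i \<and> \<beta> j \<noteq> 0"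
  proof -
    obtain J where J: "J \<in> JJ' A" "a J \<noteq> 0" "J i \<noteq> 0" using i by (auto simp: involved_def)
    have j: "J i < r i" using PiE_mem[OF J(1) iA] by simp
    have J': "restrict J ?B \<in> JJ' ?B" using PiE_mem[OF J(1)] by (auto simp: restrict_PiE_iff)
    have upd: "(restrict J ?B)(i := J i) = J" using J(1) by (auto simp: PiE_def extensional_def fun_eq_iff)
    have "\<beta> (J i) \<noteq> 0"
    proof
      assume "\<beta> (J i) = 0"
      then have z: "(\<Sum>J'\<in>JJ' ?B. a (J'(i := J i)) * basis_product ?B b J') = 0" by (simp add: \<beta>_def)
      have "a ((restrict J ?B)(i := J i)) = 0"
        by (rule basis_products_independent[OF ld finB _ _ _ _ z J'])
           (use A(2) number_field_subfield[OF K] b_rational aL(1)[OF updA[OF _ j]] in auto)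
      with J(2) show False by (simp add: upd)
    qed
    with j J(3) show ?thesis by (intro exI[of _ "J i"]) simp
  qed
  note red_i = red[OF iA, unfolded reduced_basis_def]
  have \<mu>: "\<mu> i > 0" using red_i by blast
  have H: "0 \<le> weil_height \<alpha>" using height_ge_1 by simp
  have ub: "cmod (u i k \<sigma>) \<le> 2 ^ ?D / sqrt (\<mu> i)" if k: "1 \<le> k" "k < r i" and s: "\<sigma> \<in> embeddings (K i)" for k \<sigma>
  proof -
    have "(cmod (u i k \<sigma>))\<^sup>2 \<le> sqn (embeddings (K i)) (u i k)"
      by (rule norm_le_sqn[OF fin_gen_field_embeddings(1)[OF number_field_fin_gen[OF K[OF iA]]] s])
    also have "\<dots> \<le> (4/3) ^ ?D / \<mu> i" using red_i k by blast
    also have "\<dots> \<le> (2 ^ ?D)\<^sup>2 / \<mu> i"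
    proof (rule divide_right_mono)
      have "(4/3 :: real) ^ ?D \<le> 4 ^ ?D" by (rule power_mono) auto
      also have "\<dots> = (2 ^ ?D)\<^sup>2" by (simp add: power2_eq_square flip: power_mult_distrib)
      finally show "(4/3 :: real) ^ ?D \<le> (2 ^ ?D)\<^sup>2" .
    qed (use \<mu> in simp)
    also have "\<dots> = (2 ^ ?D / sqrt (\<mu> i))\<^sup>2" using \<mu> by (simp add: power_divide)
    finally show ?thesis by (rule power2_le_imp_le) (use \<mu> in simp)
  qed
  have "1 \<le> real ?n * (2 ^ ?D / sqrt (\<mu> i)) * weil_height \<alpha> ^ ?n"
  proof (rule height_lower_bound_functional[OF K[OF iA] E r1[OF iA] b_0[OF iA] b_rational[OF iA] b_mult[OF iA] _ \<beta>_E \<beta>_int \<alpha>_eq \<alpha>_integer \<beta>_nonzero _ ub])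
    show "\<forall>j<r i. c j = 0" if "\<And>j. j < r i \<Longrightarrow> c j \<in> E" "(\<Sum>j<r i. c j * b i j) = 0" for c
    proof (rule independent_over_other_factors[OF iA _ that(2)])
      fix j assume "j < r i"
      then show "c j \<in> products_span L (A - {i}) r b" using that(1) EM by blast
    qed
    show "(\<Sum>\<sigma>\<in>embeddings (K i). \<sigma> (b i j) * u i k \<sigma>) = (if j = k then 1 else 0)" if "k < r i" "j \<le> k" for k j
      using red_i that by blast
  qed
  then show ?thesis using \<mu> by (simp add: field_simps)
qed

text \<open>The shifted second basis elements of the involved factors are distinct algebraic
  integers with conjugates bounded in terms of the height, and there are few of these.\<close>

private lemma card_involved:
  assumes d: "1 \<le> d" "\<And>i. i \<in> A \<Longrightarrow> ext_degree \<rat> (K i) \<le> d"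
  shows "real (card involved) \<le> real d * (real d * (3 * 2 ^ d) ^ d * (real d * 2 ^ d + 1) ^ d ^ 3) * weil_height \<alpha> ^ d ^ 3"
proof -
  let ?H = "weil_height \<alpha>" and ?C = "real d * 2 ^ d + 1"
  let ?x = "\<lambda>i. b i 1 - of_int (m i)"
  have H: "1 \<le> ?H" by (rule height_ge_1)
  have C: "1 \<le> ?C" by simp
  have B1: "1 \<le> ?C * ?H ^ n" for n using mult_mono[OF C one_le_power[OF H], of n] by simp
  \<comment> \<open>Degrees are positive, so they are written as successors of the numbers below \<open>d\<close>.\<close>
  let ?U = "\<Union>n\<in>{..<d}. bounded_integers (Suc n) (?C * ?H ^ Suc n)"
  have mem: "?x i \<in> ?U" if i: "i \<in> involved" for i
  proof -
    let ?n = "card (embeddings (K i))"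
    have iA: "i \<in> A" using i involved_subset by blast
    note red_i = red[OF iA, unfolded reduced_basis_def]
    have nd: "?n \<le> d" using card_embeddings_le_degree[OF K[OF iA]] d(2)[OF iA] by simp
    have n0: "0 < ?n" by (rule fin_gen_field_embeddings(2)[OF number_field_fin_gen[OF K[OF iA]]])
    have "sqrt (\<mu> i) \<le> real ?n * 2 ^ ext_degree \<rat> (K i) * ?H ^ ?n" by (rule height_lower_bound_involved[OF i])
    also have "\<dots> \<le> real d * 2 ^ d * ?H ^ ?n"
    proof (intro mult_mono)
      show "real ?n \<le> real d" using nd by simp
      show "(2::real) ^ ext_degree \<rat> (K i) \<le> 2 ^ d" using d(2)[OF iA] by (intro power_increasing) auto
    qed (use H in auto)
    finally have s: "sqrt (\<mu> i) + 1/2 \<le> ?C * ?H ^ ?n"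
      using one_le_power[OF H, of ?n] by (simp add: distrib_right)
    have "?x i \<in> ring_of_integers (K i)"
      using b_int[OF iA, of 1] r2[OF iA] number_field_subfield[OF K[OF iA]]
      by (auto simp: ring_of_integers_def intro: sf_diff sf_of_int algebraic_int_diff)
    then have "?x i \<in> bounded_integers ?n (?C * ?H ^ ?n)"
      using red_i s by (intro mem_bounded_integers[OF number_field_fin_gen[OF K[OF iA]]]) (auto simp: ring_of_integers_def intro: order_trans)
    then have "?x i \<in> bounded_integers (Suc (?n - 1)) (?C * ?H ^ Suc (?n - 1))" using n0 by simp
    moreover have "?n - 1 \<in> {..<d}" using nd n0 by auto
    ultimately show ?thesis by blast
  qed
  have fin: "finite ?U" by (intro finite_UN_I bounded_integers_count(1)[OF B1]) simp
  have "card involved \<le> card ?U"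
    using mem by (intro card_inj_on_le[OF inj_on_subset[OF second_basis_elements_distinct involved_subset(1)] _ fin]) blast
  also have "\<dots> \<le> (\<Sum>n<d. card (bounded_integers (Suc n) (?C * ?H ^ Suc n)))" by (rule card_UN_le) simp
  finally have "real (card involved) \<le> (\<Sum>n<d. real (card (bounded_integers (Suc n) (?C * ?H ^ Suc n))))"
    by (simp flip: of_nat_sum)
  also have "\<dots> \<le> (\<Sum>n<d. real d * (3 * 2 ^ d) ^ d * ?C ^ d ^ 3 * ?H ^ d ^ 3)"
  proof (rule sum_mono)
    fix n assume "n \<in> {..<d}"
    then have n: "Suc n \<le> d" by simp
    define e where "e = Suc n * (Suc n + 1) div 2"
    have "e \<le> Suc n * Suc n" unfolding e_def by (simp add: div_le_mono algebra_simps)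
    also have "\<dots> \<le> d * d" by (rule mult_le_mono[OF n n])
    finally have e: "e \<le> d * d" .
    have "d * d * 1 \<le> d * d * d" by (rule mult_le_mono2[OF d(1)])
    then have e3: "e \<le> d ^ 3" using e by (simp only: power3_eq_cube mult_1_right order_trans[OF e])
    have "real (card (bounded_integers (Suc n) (?C * ?H ^ Suc n)))
        \<le> real (Suc n) * (3 * 2 ^ Suc n) ^ Suc n * (?C * ?H ^ Suc n) ^ e"
      unfolding e_def by (rule bounded_integers_count(2)[OF B1])
    also have "\<dots> \<le> real d * (3 * 2 ^ d) ^ d * (?C ^ d ^ 3 * ?H ^ d ^ 3)"
    proof (intro mult_mono)
      show "real (Suc n) \<le> real d" using n by simp
      have "(3 * 2 ^ Suc n :: real) ^ Suc n \<le> (3 * 2 ^ d) ^ Suc n"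
        using n by (intro power_mono mult_left_mono power_increasing) auto
      also have "\<dots> \<le> (3 * 2 ^ d) ^ d"
      proof (rule power_increasing[OF n])
        show "1 \<le> 3 * (2::real) ^ d" using mult_mono[of 1 3 1 "(2::real) ^ d"] by simp
      qed
      finally show "(3 * 2 ^ Suc n :: real) ^ Suc n \<le> (3 * 2 ^ d) ^ d" .
      have "Suc n * e \<le> d * (d * d)" by (rule mult_le_mono[OF n e])
      then have "(?H ^ Suc n) ^ e \<le> ?H ^ d ^ 3"
        unfolding power_mult[symmetric] by (intro power_increasing[OF _ H]) (simp add: power3_eq_cube mult.assoc)
      moreover have "?C ^ e \<le> ?C ^ d ^ 3"
        by (rule power_increasing[OF e3 C])
      ultimately show "(?C * ?H ^ Suc n) ^ e \<le> ?C ^ d ^ 3 * ?H ^ d ^ 3"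
        unfolding power_mult_distrib using H by (intro mult_mono) auto
    qed (use H in auto)
    finally show "real (card (bounded_integers (Suc n) (?C * ?H ^ Suc n))) \<le> real d * (3 * 2 ^ d) ^ d * ?C ^ d ^ 3 * ?H ^ d ^ 3"
      by (simp only: mult.assoc)
  qed
  also have "\<dots> = real d * (real d * (3 * 2 ^ d) ^ d * ?C ^ d ^ 3) * ?H ^ d ^ 3" by simp
  finally show ?thesis .
qed

text \<open>In a term of \<open>\<alpha>\<close> with nonzero coefficient, the factors that are not involved contribute 1.\<close>

private lemma degree_le_involved:
  assumes d: "\<And>i. i \<in> A \<Longrightarrow> ext_degree \<rat> (K i) \<le> d"
  shows "ext_degree L (adjoin L \<alpha>) \<le> d ^ card involved" "1 \<le> ext_degree L (adjoin L \<alpha>)"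
proof -
  have KS: "number_field (K i)" if "i \<in> involved" for i using K involved_subset that by blast
  have \<alpha>_S: "\<alpha> = (\<Sum>J\<in>JJ' A. a J * (\<Prod>i\<in>involved. b i (J i)))"
    unfolding \<alpha>
  proof (rule sum.cong[OF refl])
    fix J assume J: "J \<in> JJ' A"
    show "a J * basis_product A b J = a J * (\<Prod>i\<in>involved. b i (J i))"
    proof (cases "a J = 0")
      case False
      have "b i (J i) = 1" if "i \<in> A - involved" for i
        using that J False b_0[of i] by (auto simp: involved_def)
      then have "basis_product A b J = (\<Prod>i\<in>involved. b i (J i))"
        unfolding basis_product_def using A(1) involved_subset(1) by (intro prod.mono_neutral_right) auto
      then show ?thesis by simp
    qed simp
  qed
  have x: "b i (J i) \<in> K i" if "i \<in> involved" "J \<in> JJ' A" for i J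
    using b_mem(1)[of i "J i"] PiE_mem[OF that(2), of i] involved_subset(1) that(1) by auto
  note bound = degree_le_card_embeddings[where a = a and x = "\<lambda>i J. b i (J i)" and \<J> = "JJ' A" and S = involved and K = K,
    OF sL involved_subset(2) _ \<alpha>_algebraic \<alpha>_S]
  show "1 \<le> ext_degree L (adjoin L \<alpha>)" by (rule bound(2)) (erule KS, erule aL(1), erule (1) x)
  have "ext_degree L (adjoin L \<alpha>) \<le> (\<Prod>i\<in>involved. card (embeddings (K i)))" by (rule bound(1)) (erule KS, erule aL(1), erule (1) x)
  also have "\<dots> \<le> (\<Prod>i\<in>involved. d)"
  proof (rule prod_mono)
    fix i assume "i \<in> involved"
    then have "i \<in> A" using involved_subset by blast
    then show "0 \<le> card (embeddings (K i)) \<and> card (embeddings (K i)) \<le> d"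
      using card_embeddings_le_degree[OF K] d order_trans by blast
  qed
  finally show "ext_degree L (adjoin L \<alpha>) \<le> d ^ card involved" by simp
qed

lemma log_degree_le_height:
  assumes d: "1 \<le> d" "\<And>i. i \<in> A \<Longrightarrow> ext_degree \<rat> (K i) \<le> d"
  shows "0 \<le> ln (real (ext_degree L (adjoin L \<alpha>)))"
    and "ln (real (ext_degree L (adjoin L \<alpha>)))
      \<le> real d * (real d * (real d * (3 * 2 ^ d) ^ d * (real d * 2 ^ d + 1) ^ d ^ 3)) * weil_height \<alpha> ^ d ^ 3"
    and "1 \<le> weil_height \<alpha>"
proof -
  let ?D = "ext_degree L (adjoin L \<alpha>)"
  have D: "?D \<le> d ^ card involved" "1 \<le> ?D" using degree_le_involved d(2) by blast+
  show "0 \<le> ln (real ?D)" using D(2) by simp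
  have "real ?D \<le> real d ^ card involved" using D(1) by (simp flip: of_nat_power)
  then have "ln (real ?D) \<le> ln (real d ^ card involved)" using D(2) d(1) by (subst ln_le_cancel_iff) auto
  also have "\<dots> = real (card involved) * ln (real d)" using d(1) by (simp add: ln_realpow)
  also have "\<dots> \<le> real (card involved) * real d"
  proof (rule mult_left_mono)
    show "ln (real d) \<le> real d" using ln_le_minus_one[of "real d"] d(1) by simp
  qed simp
  also have "\<dots> \<le> (real d * (real d * (3 * 2 ^ d) ^ d * (real d * 2 ^ d + 1) ^ d ^ 3) * weil_height \<alpha> ^ d ^ 3) * real d"
    by (rule mult_right_mono[OF card_involved[OF d] of_nat_0_le_iff])
  also have "\<dots> = real d * (real d * (real d * (3 * 2 ^ d) ^ d * (real d * 2 ^ d + 1) ^ d ^ 3)) * weil_height \<alpha> ^ d ^ 3"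
    by (simp only: mult_ac)
  finally show "ln (real ?D) \<le> real d * (real d * (real d * (3 * 2 ^ d) ^ d * (real d * 2 ^ d + 1) ^ d ^ 3)) * weil_height \<alpha> ^ d ^ 3" .
qed (rule height_ge_1)

end

end

theorem theorem1:
  fixes d :: nat
  assumes "d \<ge> 1"
  shows "\<exists>c::real. c > 0 \<and>
    (\<forall>(L\<^sub>0 :: complex set) (K :: nat \<Rightarrow> complex set).
       subfield_Qbar L\<^sub>0 \<longrightarrow>
       (\<forall>i\<ge>1. number_field (K i) \<and> ext_degree \<rat> (K i) > 1) \<longrightarrow>
       linearly_disjoint_family (K(0 := L\<^sub>0)) \<longrightarrow>
       (\<forall>i\<ge>1. Factorial_Ring.prime (ext_degree \<rat> (K i)) \<and> ext_degree \<rat> (K i) \<le> d) \<longrightarrow>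
       (\<forall>\<alpha> \<in> (\<Union>n\<in>{1..}. integers_composite L\<^sub>0 K n).
          weil_height \<alpha> \<ge> c * ln (real (ext_degree L\<^sub>0 (adjoin L\<^sub>0 \<alpha>))) powr (1 / real d ^ 3)))"
proof -
  \<comment> \<open>The bound \<open>ln [L(\<alpha>) : L] \<le> C * H ^ d ^ 3\<close>, solved for the height \<open>H\<close>, gives the constant \<open>C powr (- e)\<close>.\<close>
  define C where "C = real d * (real d * (real d * (3 * 2 ^ d) ^ d * (real d * 2 ^ d + 1) ^ d ^ 3))"
  define e where "e = 1 / real d ^ 3"
  have C: "C > 0" unfolding C_def using assms by (intro mult_pos_pos zero_less_power add_nonneg_pos) auto
  show ?thesis
  proof (intro exI[of _ "C powr (- e)"] conjI allI impI ballI)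
    show "C powr (- e) > 0" using C by simp
    fix L K \<alpha>
    assume L: "subfield_Qbar L" and K: "\<forall>i\<ge>1. number_field (K i) \<and> ext_degree \<rat> (K i) > 1"
      and ld: "linearly_disjoint_family (K(0 := L))"
      and deg: "\<forall>i\<ge>1. Factorial_Ring.prime (ext_degree \<rat> (K i)) \<and> ext_degree \<rat> (K i) \<le> d"
      and "\<alpha> \<in> (\<Union>n\<in>{1..}. integers_composite L K n)"
    then obtain n where n: "\<alpha> \<in> integers_composite L K n" by blast
    let ?A = "{1..n}"
    have "\<forall>i. \<exists>r b u \<mu> m. 1 \<le> i \<longrightarrow> reduced_basis (K i) r b u \<mu> m" using reduced_basis_exists K by blast
    from choice[OF this] obtain r where "\<forall>i. \<exists>b u \<mu> m. 1 \<le> i \<longrightarrow> reduced_basis (K i) (r i) b u \<mu> m" ..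
    from choice[OF this] obtain b where "\<forall>i. \<exists>u \<mu> m. 1 \<le> i \<longrightarrow> reduced_basis (K i) (r i) (b i) u \<mu> m" ..
    from choice[OF this] obtain u where "\<forall>i. \<exists>\<mu> m. 1 \<le> i \<longrightarrow> reduced_basis (K i) (r i) (b i) (u i) \<mu> m" ..
    from choice[OF this] obtain \<mu> where "\<forall>i. \<exists>m. 1 \<le> i \<longrightarrow> reduced_basis (K i) (r i) (b i) (u i) (\<mu> i) m" ..
    from choice[OF this] obtain m where m: "\<forall>i. 1 \<le> i \<longrightarrow> reduced_basis (K i) (r i) (b i) (u i) (\<mu> i) (m i)" ..
    have A: "finite ?A" "0 \<notin> ?A" by auto
    have KA: "number_field (K i)" and red: "reduced_basis (K i) (r i) (b i) (u i) (\<mu> i) (m i)"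
      and dA: "ext_degree \<rat> (K i) \<le> d" if "i \<in> ?A" for i
      using K m deg that by auto
    have "\<alpha> \<in> products_span (ring_of_integers L) ?A r b"
      using n integral_composite_products_span[OF L ld A KA red] unfolding integers_composite_def by blast
    then obtain a where a: "\<And>J. J \<in> PiE ?A (\<lambda>i. {..<r i}) \<Longrightarrow> a J \<in> ring_of_integers L"
      "\<alpha> = (\<Sum>J\<in>PiE ?A (\<lambda>i. {..<r i}). a J * basis_product ?A b J)" unfolding products_span_def by blast
    define D where "D = ln (real (ext_degree L (adjoin L \<alpha>)))"
    let ?H = "weil_height \<alpha>"
    have D: "0 \<le> D" "D \<le> C * ?H ^ d ^ 3" "1 \<le> ?H"
      unfolding D_def C_def by (rule log_degree_le_height[OF L ld A KA red a assms dA]; assumption)+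
    have e: "e \<ge> 0" by (simp add: e_def)
    have "D powr e \<le> (C * ?H ^ d ^ 3) powr e" using D(1,2) e by (intro powr_mono2)
    also have "\<dots> = C powr e * (?H ^ d ^ 3) powr e" using C D(3) by (intro powr_mult)
    also have "(?H ^ d ^ 3) powr e = ?H"
    proof -
      have "(?H ^ d ^ 3) powr e = (?H powr real (d ^ 3)) powr e" using D(3) by (subst powr_realpow) auto
      also have "\<dots> = ?H powr (real (d ^ 3) * e)" by (rule powr_powr)
      also have "real (d ^ 3) * e = 1" using assms by (simp add: e_def)
      finally show ?thesis using D(3) by simp
    qed
    finally have "C powr (- e) * D powr e \<le> C powr (- e) * (C powr e * ?H)" by (intro mult_left_mono) auto
    also have "\<dots> = ?H" using C by (simp add: powr_minus field_simps)
    finally show "C powr (- e) * ln (real (ext_degree L (adjoin L \<alpha>))) powr (1 / real d ^ 3) \<le> ?H"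
      unfolding D_def e_def .
  qed
qed

end
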